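(* Let $q\ge3$ be an integer and let $0\le\beta<\beta_c(q)$. There exist constants $C_1,C_2>0$ and subsets $\widetilde\Sigma_n\subseteq\Sigma_n$ ($n\ge1$) with $\mu_n(\Sigma_n\setminus\widetilde\Sigma_n)\le C_1e^{-C_2n}$ such that the Glauber dynamics for the $q$-state Curie-Weiss Potts model on $n$ vertices at inverse temperature $\beta$, started from $\widetilde\Sigma_n$, has cutoff with mixing time $\alpha_1(\beta,q)n\log n$ and cutoff window $O_\epsilon(n)$, where $\alpha_1(\beta,q)=[2(1-2\beta/q)]^{-1}$. That is, for every fixed $\epsilon\in(0,1)$, $$t^{\widetilde\Sigma_n}_{\mathrm{mix}(\epsilon)}(n)=\alpha_1(\beta,q)\,n\log n+O_\epsilon(n)\qquad(n\to\infty),$$ so that in particular $w^{\widetilde\Sigma_n}_\epsilon(n)=O_\epsilon(n)$.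
   Context: Model: $Q=\{1,\dots,q\}$, $V=\{1,\dots,n\}$, $\Sigma_n=Q^V$. The Curie-Weiss Potts distribution is $\mu_n(\sigma)=Z_{\beta,n}^{-1}\exp\{(\beta/n)\sum_{u,v\in V}\mathbf 1_{\sigma(u)=\sigma(v)}\}$, the sum being over ordered pairs $(u,v)\in V\times V$. Glauber dynamics: the discrete time Markov chain $(\sigma_t)_{t\ge0}$ on $\Sigma_n$ which at each step picks a vertex $u\in V$ uniformly and replaces its color by $k$ with probability $\mu_n(\sigma(u)=k\mid\sigma(w)=\sigma_t(w)\ \forall w\ne u)$, leaving the other vertices unchanged. $\mathbb P_{\sigma_0}$ is its law started from $\sigma_0$. Restricted mixing: for $\widetilde\Sigma_n\subseteq\Sigma_n$, $d^{\widetilde\Sigma_n}_t(n)=\max_{\sigma_0\in\widetilde\Sigma_n}\|\mathbb P_{\sigma_0}(\sigma_t\in\cdot)-\mu_n\|_{\mathrm{TV}}$, $t^{\widetilde\Sigma_n}_{\mathrm{mix}(\epsilon)}(n)=\inf\{t:d^{\widetilde\Sigma_n}_t(n)\le\epsilon\}$, $w^{\widetilde\Sigma_n}_\epsilon(n)=t^{\widetilde\Sigma_n}_{\mathrm{mix}(\epsilon)}(n)-t^{\widetilde\Sigma_n}_{\mathrm{mix}(1-\epsilon)}(n)$; cutoff means $w^{\widetilde\Sigma_n}_\epsilon(n)=o(t^{\widetilde\Sigma_n}_{\mathrm{mix}(1/4)}(n))$ for every fixed $\epsilon\in(0,1)$. The static critical inverse temperature for $q\ge3$ is $\beta_c(q)=\frac{(q-1)\log(q-1)}{q-2}$.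 $O_\epsilon$ denotes a constant that may depend on $\epsilon$ (and on $\beta,q$) but not on $n$. *)

theory Defs
  imports "HOL-Probability.Probability" "HOL-Library.FuncSet" "HOL-Library.Landau_Symbols"
begin

text \<open>Configurations are extensional functions, so that each colouring of the vertices
  \<open>{1..n}\<close> by \<open>{1..q}\<close> is represented exactly once.\<close>

definition configs :: "nat \<Rightarrow> nat \<Rightarrow> (nat \<Rightarrow> nat) set" where
  "configs q n = {1..n} \<rightarrow>\<^sub>E {1..q}"

text \<open>The interaction is summed over ordered pairs, diagonal included, with prefactor
  \<open>\<beta> / n\<close>; in this normalisation the critical value is \<open>potts_beta_c\<close> below.\<close>

definition potts_weight :: "real \<Rightarrow> nat \<Rightarrow> (nat \<Rightarrow> nat) \<Rightarrow> real" where
  "potts_weight \<beta> n \<sigma> =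
     exp (\<beta> / real n * (\<Sum>(u, v)\<in>{1..n} \<times> {1..n}. if \<sigma> u = \<sigma> v then 1 else 0))"

definition potts_Z :: "nat \<Rightarrow> real \<Rightarrow> nat \<Rightarrow> real" where
  "potts_Z q \<beta> n = (\<Sum>\<sigma>\<in>configs q n. potts_weight \<beta> n \<sigma>)"

definition potts :: "nat \<Rightarrow> real \<Rightarrow> nat \<Rightarrow> (nat \<Rightarrow> nat) pmf" where
  "potts q \<beta> n =
     embed_pmf (\<lambda>\<sigma>. if \<sigma> \<in> configs q n then potts_weight \<beta> n \<sigma> / potts_Z q \<beta> n else 0)"

text \<open>For \<open>\<sigma> \<in> configs q n\<close>, \<open>1 \<le> q\<close> and \<open>u \<in> {1..n}\<close> the conditioning event has positive
  probability (lemma \<open>potts_cond_nonempty\<close>), as \<open>cond_pmf\<close> requires.\<close>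

definition color_cond :: "nat \<Rightarrow> real \<Rightarrow> nat \<Rightarrow> (nat \<Rightarrow> nat) \<Rightarrow> nat \<Rightarrow> nat pmf" where
  "color_cond q \<beta> n \<sigma> u =
     map_pmf (\<lambda>\<tau>. \<tau> u) (cond_pmf (potts q \<beta> n) {\<tau>. \<forall>w\<in>{1..n} - {u}. \<tau> w = \<sigma> w})"

definition glauber_step :: "nat \<Rightarrow> real \<Rightarrow> nat \<Rightarrow> (nat \<Rightarrow> nat) \<Rightarrow> (nat \<Rightarrow> nat) pmf" where
  "glauber_step q \<beta> n \<sigma> =
     bind_pmf (pmf_of_set {1..n}) (\<lambda>u. map_pmf (\<lambda>k. \<sigma>(u := k)) (color_cond q \<beta> n \<sigma> u))"

primrec glauber_law :: "nat \<Rightarrow> real \<Rightarrow> nat \<Rightarrow> (nat \<Rightarrow> nat) \<Rightarrow> nat \<Rightarrow> (nat \<Rightarrow> nat) pmf" where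
  "glauber_law q \<beta> n \<sigma>\<^sub>0 0 = return_pmf \<sigma>\<^sub>0"
| "glauber_law q \<beta> n \<sigma>\<^sub>0 (Suc t) = bind_pmf (glauber_law q \<beta> n \<sigma>\<^sub>0 t) (glauber_step q \<beta> n)"

definition tv_dist :: "'a pmf \<Rightarrow> 'a pmf \<Rightarrow> real" where
  "tv_dist p p' = (SUP A. \<bar>measure_pmf.prob p A - measure_pmf.prob p' A\<bar>)"

definition d_restr :: "nat \<Rightarrow> real \<Rightarrow> nat \<Rightarrow> (nat \<Rightarrow> nat) set \<Rightarrow> nat \<Rightarrow> real" where
  "d_restr q \<beta> n S t = Max ((\<lambda>\<sigma>\<^sub>0. tv_dist (glauber_law q \<beta> n \<sigma>\<^sub>0 t) (potts q \<beta> n)) ` S)"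

text \<open>The infimum over the empty set of naturals would be \<open>0\<close>; the dynamics is ergodic on the
  finite set of configurations, so this does not arise for \<open>\<epsilon> > 0\<close>, \<open>1 \<le> n\<close>, \<open>1 \<le> q\<close> and
  nonempty \<open>S \<subseteq> configs q n\<close>. Nonemptiness is also needed for \<open>Max\<close> above.\<close>

definition t_mix :: "nat \<Rightarrow> real \<Rightarrow> nat \<Rightarrow> (nat \<Rightarrow> nat) set \<Rightarrow> real \<Rightarrow> nat" where
  "t_mix q \<beta> n S \<epsilon> = Inf {t. d_restr q \<beta> n S t \<le> \<epsilon>}"

definition mix_window :: "nat \<Rightarrow> real \<Rightarrow> nat \<Rightarrow> (nat \<Rightarrow> nat) set \<Rightarrow> real \<Rightarrow> real" where
  "mix_window q \<beta> n S \<epsilon> = real (t_mix q \<beta> n S \<epsilon>) - real (t_mix q \<beta> n S (1 - \<epsilon>))"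

definition has_cutoff :: "nat \<Rightarrow> real \<Rightarrow> (nat \<Rightarrow> (nat \<Rightarrow> nat) set) \<Rightarrow> bool" where
  "has_cutoff q \<beta> S \<longleftrightarrow>
     (\<forall>\<epsilon>\<in>{0<..<1}. (\<lambda>n. mix_window q \<beta> n (S n) \<epsilon>) \<in> o(\<lambda>n. real (t_mix q \<beta> n (S n) (1/4))))"

definition potts_beta_c :: "nat \<Rightarrow> real" where
  "potts_beta_c q = (real q - 1) * ln (real q - 1) / (real q - 2)"

definition potts_alpha1 :: "real \<Rightarrow> nat \<Rightarrow> real" where
  "potts_alpha1 \<beta> q = 1 / (2 * (1 - 2 * \<beta> / real q))"

lemma finite_configs: "finite (configs q n)"
  unfolding configs_def by (intro finite_PiE) auto

lemma configs_nonempty: "1 \<le> q \<Longrightarrow> configs q n \<noteq> {}"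
  unfolding configs_def by (auto simp: PiE_eq_empty_iff)

lemma potts_weight_pos: "potts_weight \<beta> n \<sigma> > 0"
  unfolding potts_weight_def by simp

lemma potts_Z_pos: "1 \<le> q \<Longrightarrow> potts_Z q \<beta> n > 0"
  unfolding potts_Z_def
  by (intro sum_pos finite_configs configs_nonempty potts_weight_pos)

lemma pmf_potts:
  assumes "1 \<le> q"
  shows "pmf (potts q \<beta> n) \<sigma> =
    (if \<sigma> \<in> configs q n then potts_weight \<beta> n \<sigma> / potts_Z q \<beta> n else 0)"
proof -
  let ?f = "\<lambda>\<sigma>. if \<sigma> \<in> configs q n then potts_weight \<beta> n \<sigma> / potts_Z q \<beta> n else 0"
  have nonneg: "0 \<le> ?f x" for x
    using potts_Z_pos[OF assms, of \<beta> n] potts_weight_pos[of \<beta> n x] by auto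
  have "(\<integral>\<^sup>+x. ennreal (?f x) \<partial>count_space UNIV) = (\<Sum>x\<in>configs q n. ennreal (?f x))"
    by (rule nn_integral_count_space') (auto simp: finite_configs)
  also have "\<dots> = ennreal (\<Sum>x\<in>configs q n. ?f x)"
    by (rule sum_ennreal) (rule nonneg)
  also have "(\<Sum>x\<in>configs q n. ?f x) = 1"
    using potts_Z_pos[OF assms, of \<beta> n]
    by (simp add: sum_divide_distrib[symmetric] potts_Z_def[symmetric])
  finally have "(\<integral>\<^sup>+x. ennreal (?f x) \<partial>count_space UNIV) = 1" by simp
  then show ?thesis
    unfolding potts_def using pmf_embed_pmf[of ?f] nonneg by blast
qed

lemma set_pmf_potts: "1 \<le> q \<Longrightarrow> set_pmf (potts q \<beta> n) = configs q n"
  using potts_Z_pos[of q \<beta> n] less_imp_neq[OF potts_weight_pos]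
  by (fastforce simp: set_pmf_eq pmf_potts split: if_splits)

lemma potts_cond_nonempty:
  assumes "1 \<le> q" "\<sigma> \<in> configs q n"
  shows "set_pmf (potts q \<beta> n) \<inter> {\<tau>. \<forall>w\<in>{1..n} - {u}. \<tau> w = \<sigma> w} \<noteq> {}"
  using assms by (auto simp: set_pmf_potts)

end

theory Submission
  imports Defs "HOL-Real_Asymp.Real_Asymp"
begin

text \<open>Near the balanced configurations a change of one spin alters the colour law of every other
  vertex by \<open>2\<beta>/(qn)\<close> in total variation, so the Lipschitz constant of a function contracts by
  \<open>1 - \<kappa>/n\<close> per step with \<open>\<kappa> = 1 - 2\<beta>/q\<close>. The correction caused by the imbalance \<open>\<phi>\<close> of a
  configuration is absorbed by the weight \<open>1 + K\<phi>\<close>, because \<open>\<phi>\<close> itself decays. Hence the sharp rate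
  holds all the way from a fixed distance down to distance \<open>n\<^sup>-\<^sup>1\<^sup>/\<^sup>2\<close>, which is reached at time
  \<open>n log n / (2\<kappa>)\<close>.

  During the last \<open>\<delta>n\<close> steps the dynamics is compared, by Duhamel's formula, with independent uniform
  recolouring. An event that is invariant under permutations inside the initial colour classes has
  probability varying by only \<open>O(j\<^sup>-\<^sup>1\<^sup>/\<^sup>2)\<close> under a change of one spin after \<open>j\<close> uniform recolourings, and
  such events realise the total variation distance. For the lower bound, the first colour fraction
  still exceeds its \<open>O(n\<^sup>-\<^sup>1\<^sup>/\<^sup>2)\<close> fluctuations. The region of good starting configurations is a ball around
  balance; its complement is exponentially unlikely for \<open>\<beta> < \<beta>\<^sub>c\<close> because the relative entropy
  dominates \<open>\<beta>\<^sub>c\<close> times the squared distance from balance.\<close>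

section \<open>Entropy and the quadratic energy on the simplex\<close>

text \<open>Contraction alone would need about n log n / \<kappa> steps to merge two copies: after
  half that time their summed discrepancy is still of order sqrt n. Half the time is enough for
  functions whose one-spin gradient is O(n^-1/2), and that is the gradient left by a further
  \<delta>n uniform recolourings. Replacing the dynamics by recolouring costs, with i steps left,
  the imbalance n^-1/2 times the gradient i^-1/2. Over \<delta>n steps this adds up to a multiple of
  sqrt \<delta>, so \<delta> is fixed small before the window is made long. The argument is dual: it
  works with operators on functions, not with coupled chains. The sharp rate survives n log n steps
  because its error per step is only n^-3/2. When balance is only locally attracting, no contraction
  can hold on the whole configuration space. The rule is therefore modified far from balance, and
  the modification is paid for twice: by the probability that a path of the modified chain gets
  there, and by the Gibbs mass of that region. The critical value enters through this Gibbs mass and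
  through 2\<beta> < q.\<close>

lemma ln_le_half_diff_inverse:
  fixes x :: real
  assumes "1 \<le> x"
  shows "2 * x * ln x \<le> x\<^sup>2 - 1"
proof -
  define g where "g = (\<lambda>x::real. x - 1 / x - 2 * ln x)"
  have "g 1 \<le> g x"
  proof (rule DERIV_nonneg_imp_nondecreasing[OF assms])
    fix y :: real assume y: "1 \<le> y" "y \<le> x"
    have "(g has_real_derivative (1 + 1 / y\<^sup>2 - 2 / y)) (at y)"
      unfolding g_def using y by (auto intro!: derivative_eq_intros simp: power2_eq_square)
    moreover have "1 + 1 / y\<^sup>2 - 2 / y = (1 - 1 / y)\<^sup>2"
      using y by (simp add: power2_eq_square field_simps)
    ultimately show "\<exists>D. (g has_real_derivative D) (at y) \<and> 0 \<le> D" by auto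
  qed
  then have "0 \<le> x - 1 / x - 2 * ln x" by (simp add: g_def)
  then have "0 \<le> x * (x - 1 / x - 2 * ln x)" using assms by (intro mult_nonneg_nonneg) auto
  then show ?thesis using assms by (simp add: algebra_simps power2_eq_square)
qed

text \<open>Makes the linear rate 1 - 2\<beta>/q positive for every \<beta> below the critical
  value: balance is linearly stable throughout the range considered.\<close>

lemma potts_beta_c_le: "3 \<le> q \<Longrightarrow> 2 * potts_beta_c q \<le> real q"
  using ln_le_half_diff_inverse[of "real q - 1"]
  by (simp add: potts_beta_c_def field_simps power2_eq_square)

text \<open>The Bernoulli divergence and the parabola touch at \<open>p\<close> and at \<open>1 - p\<close>; the derivative of
  their difference vanishes exactly at \<open>p\<close>, \<open>1/2\<close>, \<open>1 - p\<close>.\<close>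

definition bern_gap :: "real \<Rightarrow> real \<Rightarrow> real" where
  "bern_gap p a = a * ln (a / p) + (1 - a) * ln ((1 - a) / (1 - p))
     - ln ((1 - p) / p) / (1 - 2 * p) * (a - p)\<^sup>2"

lemma bern_gap_deriv:
  assumes "0 < p" "p < 1/2" "0 < a" "a < 1"
  shows "(bern_gap p has_real_derivative
     (ln (a / (1 - a)) + ln ((1 - p) / p) - 2 * (ln ((1 - p) / p) / (1 - 2 * p)) * (a - p))) (at a)"
proof -
  have pp: "(p - 1) / (1 - p) = - 1" using assms by (simp add: field_simps)
  define c where "c = ln ((1 - p) / p) / (1 - 2 * p)"
  have "((\<lambda>a. a * ln (a / p) + (1 - a) * ln ((1 - a) / (1 - p)) - c * (a - p)\<^sup>2) has_real_derivative
     (ln (a / p) - ln ((1 - a) / (1 - p)) - 2 * c * (a - p))) (at a)"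
    using assms by (auto intro!: derivative_eq_intros simp: power2_eq_square pp)
  moreover have "ln (a / p) - ln ((1 - a) / (1 - p)) = ln (a / (1 - a)) + ln ((1 - p) / p)"
    using assms by (simp add: ln_div)
  ultimately show ?thesis
    unfolding bern_gap_def c_def by simp
qed

lemma convex_on_logit: "convex_on {1/2..<1} (\<lambda>a::real. ln (a / (1 - a)))"
proof (rule f''_ge0_imp_convex)
  show "convex {1/2..<1::real}" by simp
  fix a :: real assume "a \<in> {1/2..<1}"
  then have a: "1/2 \<le> a" "a < 1" by auto
  show "((\<lambda>a. ln (a / (1 - a))) has_real_derivative (1 / a + 1 / (1 - a))) (at a)"
    using a by (auto intro!: derivative_eq_intros simp: divide_simps)
  show "((\<lambda>a. 1 / a + 1 / (1 - a)) has_real_derivative (1 / (1 - a)\<^sup>2 - 1 / a\<^sup>2)) (at a)"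
    using a by (auto intro!: derivative_eq_intros simp: power2_eq_square)
  have "(1 - a)\<^sup>2 \<le> a\<^sup>2" using a by (intro power_mono) auto
  then show "0 \<le> 1 / (1 - a)\<^sup>2 - 1 / a\<^sup>2"
    using a by (simp add: frac_le)
qed

text \<open>The logit vanishes at 1/2, so by convexity it lies below the chord through (1/2, 0) and
  its value at \<open>m\<close> before \<open>m\<close>, and above it afterwards. This fixes the
  signs of the derivative of \<open>bern_gap\<close>.\<close>

lemma logit_chord:
  fixes m a :: real
  assumes "1/2 < m" "m < 1" "1/2 \<le> a"  "a < 1"
  shows "a \<le> m \<Longrightarrow> ln (a / (1 - a)) \<le> ln (m / (1 - m)) / (m - 1/2) * (a - 1/2)"
    and "m \<le> a \<Longrightarrow> ln (m / (1 - m)) / (m - 1/2) * (a - 1/2) \<le> ln (a / (1 - a))"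
proof -
  let ?f = "\<lambda>a::real. ln (a / (1 - a))"
  have chord: "?f y \<le> ?f z / (z - 1/2) * (y - 1/2)" if "1/2 \<le> y" "y \<le> z" "1/2 < z" "z < 1" for y z :: real
  proof -
    define t where "t = (y - 1/2) / (z - 1/2)"
    have t: "0 \<le> t" "t \<le> 1" using that by (auto simp: t_def divide_simps)
    have "t * (z - 1/2) = y - 1/2" using that by (simp add: t_def)
    then have y: "(1 - t) *\<^sub>R (1/2) + t *\<^sub>R z = y" by (simp add: field_simps)
    have "?f ((1 - t) *\<^sub>R (1/2) + t *\<^sub>R z) \<le> (1 - t) * ?f (1/2) + t * ?f z"
      using that by (intro convex_onD[OF convex_on_logit t]) auto
    then show ?thesis unfolding y by (simp add: t_def mult.commute)
  qed
  show "a \<le> m \<Longrightarrow> ?f a \<le> ?f m / (m - 1/2) * (a - 1/2)" using chord[of a m] assms by auto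
  assume "m \<le> a"
  then have "?f m \<le> ?f a / (a - 1/2) * (m - 1/2)" using chord[of m a] assms by auto
  then show "?f m / (m - 1/2) * (a - 1/2) \<le> ?f a"
    using assms \<open>m \<le> a\<close> by (simp add: field_simps)
qed

text \<open>The derivative \<open>D\<close> is odd about 1/2, and the chord with \<open>m\<close> =
  1 - p gives it the signs +, -, + on the intervals cut at 1/2 and 1 - p. The minimum is thus taken
  at \<open>p\<close> or at 1 - p, where the gap is zero.\<close>

lemma bern_gap_nonneg_open:
  assumes p: "0 < p" "p < 1/2" and a: "p \<le> a" "a < 1"
  shows "0 \<le> bern_gap p a"
proof -
  define L where "L = ln ((1 - p) / p)"
  define D where "D = (\<lambda>a. ln (a / (1 - a)) + L - 2 * (L / (1 - 2 * p)) * (a - p))"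
  have der: "(bern_gap p has_real_derivative D a) (at a)" if "0 < a" "a < 1" for a
    using bern_gap_deriv[OF p that] by (simp add: D_def L_def)
  have L1: "L = ln ((1 - p) / (1 - (1 - p)))" by (simp add: L_def)
  have D: "D a = ln (a / (1 - a)) - L / (1 - p - 1/2) * (a - 1/2)" for a
    using p by (simp add: D_def field_simps)
  have D_sym: "D (1 - a) = - D a" if "0 < a" "a < 1" for a
    unfolding D using that p by (simp add: ln_div field_simps)
  have up: "0 \<le> D a" if "1 - p \<le> a" "a < 1" for a
    unfolding D using logit_chord(2)[of "1 - p" a] that p by (simp add: L1)
  have down: "D a \<le> 0" if "1/2 \<le> a" "a \<le> 1 - p" for a
    unfolding D using logit_chord(1)[of "1 - p" a] that p by (simp add: L1)
  have low: "0 \<le> D a" if "p \<le> a" "a \<le> 1/2" for a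
    using down[of "1 - a"] D_sym[of a] that p by auto
  have zero: "bern_gap p p = 0" using p by (simp add: bern_gap_def)
  \<comment> \<open>This second zero is what determines the coefficient of the parabola, and hence
    the critical temperature.\<close>
  have "bern_gap p (1 - p) = (1 - p) * L + p * (- L) - L / (1 - 2 * p) * (1 - 2 * p)\<^sup>2"
    using p by (simp add: bern_gap_def L_def ln_div algebra_simps)
  also have "\<dots> = 0" using p by (simp add: power2_eq_square field_simps)
  finally have zero': "bern_gap p (1 - p) = 0" .
  consider "a \<le> 1/2" | "1/2 \<le> a" "a \<le> 1 - p" | "1 - p \<le> a" using a by linarith
  then show ?thesis
  proof cases
    case 1
    have "bern_gap p p \<le> bern_gap p a"
      by (rule DERIV_nonneg_imp_nondecreasing[OF a(1)])
        (use 1 p in \<open>auto intro!: exI[of _ "D _"] der low\<close>)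
    then show ?thesis using zero by simp
  next
    case 2
    have "bern_gap p (1 - p) \<le> bern_gap p a"
      by (rule DERIV_nonpos_imp_nonincreasing[OF 2(2)])
        (use 2 p in \<open>auto intro!: exI[of _ "D _"] der down\<close>)
    then show ?thesis using zero' by simp
  next
    case 3
    have "bern_gap p (1 - p) \<le> bern_gap p a"
      by (rule DERIV_nonneg_imp_nondecreasing[OF 3])
        (use 3 p a in \<open>auto intro!: exI[of _ "D _"] der up\<close>)
    then show ?thesis using zero' by simp
  qed
qed

lemma tendsto_x_ln_x_at_left: "((\<lambda>a::real. (1 - a) * ln ((1 - a) / c)) \<longlongrightarrow> 0) (at_left 1)" if "0 < c"
  using that by real_asymp

lemma bern_gap_nonneg:
  assumes p: "0 < p" "p < 1/2" and a: "p \<le> a" "a \<le> 1"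
  shows "0 \<le> bern_gap p a"
proof (cases "a = 1")
  case True
  \<comment> \<open>At a = 1 the definition contains 0 times a logarithm of 0, which evaluates to 0
    and agrees with the limit of x ln x, so continuity carries the bound over.\<close>
  have "((\<lambda>a. a * ln (a / p) + (1 - a) * ln ((1 - a) / (1 - p))
     - ln ((1 - p) / p) / (1 - 2 * p) * (a - p)\<^sup>2) \<longlongrightarrow>
     1 * ln (1 / p) + 0 - ln ((1 - p) / p) / (1 - 2 * p) * (1 - p)\<^sup>2) (at_left 1)"
    using p by (intro tendsto_intros tendsto_x_ln_x_at_left) auto
  then have "(bern_gap p \<longlongrightarrow> bern_gap p 1) (at_left 1)"
    by (simp add: bern_gap_def[abs_def])
  moreover have "\<forall>\<^sub>F a in at_left 1. 0 \<le> bern_gap p a"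
    unfolding eventually_at_left_field
    using p by (intro exI[of _ p]) (auto intro!: bern_gap_nonneg_open)
  ultimately show ?thesis
    unfolding True by (rule tendsto_lowerbound) auto
qed (use assms bern_gap_nonneg_open in auto)

text \<open>The Bregman divergence of \<open>x ln x\<close>, divided by the square of the distance, decreases in
  \<open>x\<close>; stated without division.\<close>

lemma bregman_mono:
  fixes b x y :: real
  assumes "0 < b" "0 \<le> x" "x \<le> y" "b < y"
  shows "(y * ln (y / b) - y + b) * (x - b)\<^sup>2 \<le> (x * ln (x / b) - x + b) * (y - b)\<^sup>2"
proof -
  define f where "f = (\<lambda>t::real. t * ln (t / b) - t + b)"
  \<comment> \<open>The quadratic is the second-order expansion of \<open>f\<close> at
    \<open>b\<close>. Monotonicity of \<open>g\<close> bounds the quotient of \<open>f\<close> by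
    the squared distance from below by 1/(2b) left of \<open>b\<close> and from above by it on the
    right, which settles the case of \<open>x\<close> and \<open>y\<close> on opposite
    sides.\<close>
  define g where "g = (\<lambda>t. f t - (t - b)\<^sup>2 / (2 * b))"
  have df: "(f has_real_derivative ln (t / b)) (at t)" if "0 < t" for t
    unfolding f_def using that \<open>0 < b\<close> by (auto intro!: derivative_eq_intros)
  have dg: "(g has_real_derivative (ln (t / b) - (t - b) / b)) (at t)" if "0 < t" for t
    unfolding g_def using that \<open>0 < b\<close>
    by (auto intro!: derivative_eq_intros df simp: field_simps)
  have dg_neg: "ln (t / b) - (t - b) / b \<le> 0" if "0 < t" for t
    using ln_le_minus_one[of "t / b"] that \<open>0 < b\<close> by (simp add: diff_divide_distrib)
  have anti: "g t \<le> g s" if "0 < s" "s \<le> t" for s t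
    by (rule DERIV_nonpos_imp_nonincreasing[OF that(2)])
      (use that in \<open>auto intro!: exI[of _ "ln (_ / b) - (_ - b) / b"] dg dg_neg\<close>)
  have g_b: "g b = 0" using \<open>0 < b\<close> by (simp add: g_def f_def)
  have y_le: "f y \<le> (y - b)\<^sup>2 / (2 * b)"
    using anti[of b y] g_b assms by (simp add: g_def)
  show ?thesis
  proof (cases "x \<le> b")
    case True
    have "(x - b)\<^sup>2 / (2 * b) \<le> f x"
    proof (cases "x = 0")
      case True
      then show ?thesis using \<open>0 < b\<close> by (simp add: f_def power2_eq_square)
    next
      case False
      then show ?thesis using anti[of x b] g_b \<open>x \<le> b\<close> assms by (simp add: g_def)
    qed
    then have "(x - b)\<^sup>2 / (2 * b) * (y - b)\<^sup>2 \<le> f x * (y - b)\<^sup>2"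
      by (rule mult_right_mono) simp
    moreover have "f y * (x - b)\<^sup>2 \<le> (y - b)\<^sup>2 / (2 * b) * (x - b)\<^sup>2"
      using y_le by (rule mult_right_mono) simp
    ultimately show ?thesis unfolding f_def by (simp add: mult.commute)
  next
    case False
    \<comment> \<open>Right of \<open>b\<close> the derivative of the quotient has the sign of
      -\<open>k\<close>, and \<open>k\<close> is the excess in ln u \<ge> 2 (u - 1) / (u + 1) for u
      = t / b.\<close>
    define k where "k = (\<lambda>t. ln (t / b) - 2 * (t - b) / (t + b))"
    have dk: "(k has_real_derivative (t - b)\<^sup>2 / (t * (t + b)\<^sup>2)) (at t)" if "0 < t" for t
    proof -
      have "(k has_real_derivative (1 / b / (t / b) - (2 * (t + b) - 2 * (t - b)) / (t + b)\<^sup>2)) (at t)"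
        unfolding k_def using that \<open>0 < b\<close>
        by (auto intro!: derivative_eq_intros simp: power2_eq_square)
      moreover have "1 / b / (t / b) - (2 * (t + b) - 2 * (t - b)) / (t + b)\<^sup>2 = (t - b)\<^sup>2 / (t * (t + b)\<^sup>2)"
        using that \<open>0 < b\<close> by (simp add: divide_simps) (simp add: algebra_simps power2_eq_square)
      ultimately show ?thesis by simp
    qed
    have k_nonneg: "0 \<le> k t" if "b \<le> t" for t
    proof -
      have "k b \<le> k t"
        by (rule DERIV_nonneg_imp_nondecreasing[OF that])
          (use \<open>0 < b\<close> in \<open>auto intro!: exI[of _ "(_ - b)\<^sup>2 / (_ * (_ + b)\<^sup>2)"] dk\<close>)
      then show ?thesis using \<open>0 < b\<close> by (simp add: k_def)
    qed
    have "f y / (y - b)\<^sup>2 \<le> f x / (x - b)\<^sup>2"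
    proof (rule DERIV_nonpos_imp_nonincreasing[OF \<open>x \<le> y\<close>])
      fix t assume t: "x \<le> t" "t \<le> y"
      have t': "0 < t" "b < t" using t False assms by auto
      let ?D = "(ln (t / b) * (t - b)\<^sup>2 - f t * (2 * (t - b))) / ((t - b)\<^sup>2 * (t - b)\<^sup>2)"
      have "((\<lambda>t. f t / (t - b)\<^sup>2) has_real_derivative ?D) (at t)"
        using t' by (auto intro!: derivative_eq_intros df)
      moreover have "ln (t / b) * (t - b)\<^sup>2 - f t * (2 * (t - b)) = - (t - b) * ((t + b) * k t)"
        using t' \<open>0 < b\<close> by (simp add: f_def k_def field_simps power2_eq_square)
      moreover have "- (t - b) * ((t + b) * k t) \<le> 0"
        using t' \<open>0 < b\<close> k_nonneg[of t] by (intro mult_nonpos_nonneg mult_nonneg_nonneg) auto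
      ultimately show "\<exists>D. ((\<lambda>t. f t / (t - b)\<^sup>2) has_real_derivative D) (at t) \<and> D \<le> 0"
        by (intro exI[of _ ?D]) (auto simp: divide_nonpos_nonneg)
    qed
    then show ?thesis using False assms by (simp add: f_def field_simps)
  qed
qed

text \<open>Cauchy-Schwarz for the other coordinates, whose sum is -\<open>y k\<close>. Equality
  holds when these coincide, which is the extremal shape (a, b, ..., b).\<close>

lemma square_deviation_le:
  fixes y :: "'a \<Rightarrow> real"
  assumes "finite I" "k \<in> I" "(\<Sum>j\<in>I. y j) = 0"
  shows "real (card I) * (y k)\<^sup>2 \<le> (real (card I) - 1) * (\<Sum>j\<in>I. (y j)\<^sup>2)"
proof -
  have split: "(\<Sum>j\<in>I. g j) = g k + (\<Sum>j\<in>I - {k}. g j)" for g :: "'a \<Rightarrow> real"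
    using assms by (simp add: sum.remove)
  have "(\<Sum>j\<in>I - {k}. y j)\<^sup>2 \<le> (\<Sum>j\<in>I - {k}. (y j)\<^sup>2) * card (I - {k})"
    by (rule sum_squared_le_sum_of_squares)
  moreover have "(\<Sum>j\<in>I - {k}. y j) = - y k" using assms(3) split[of y] by simp
  moreover have "real (card (I - {k})) = real (card I) - 1"
  proof -
    have "card I \<ge> 1" using assms by (metis One_nat_def Suc_leI card_gt_0_iff empty_iff)
    then show ?thesis using assms by (simp add: of_nat_diff)
  qed
  ultimately have "(y k)\<^sup>2 \<le> ((\<Sum>j\<in>I. (y j)\<^sup>2) - (y k)\<^sup>2) * (real (card I) - 1)"
    using split[of "\<lambda>j. (y j)\<^sup>2"] by simp
  then show ?thesis by (simp add: algebra_simps)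
qed

text \<open>Among the points of the simplex with given distance from the centre, the entropy is
  largest at a point \<open>(a, b, \<dots>, b)\<close>: with this \<open>a\<close> bounding every coordinate,
  \<open>bregman_mono\<close> applies coordinatewise.\<close>

lemma entropy_ge_beta_c_energy:
  fixes s :: "'a \<Rightarrow> real"
  assumes q: "3 \<le> card I" and nn: "\<And>k. k \<in> I \<Longrightarrow> 0 \<le> s k" and s1: "(\<Sum>k\<in>I. s k) = 1"
  shows "potts_beta_c (card I) * (\<Sum>k\<in>I. (s k - 1 / card I)\<^sup>2) \<le> (\<Sum>k\<in>I. s k * ln (s k)) + ln (card I)"
proof -
  define q where "q = real (card I)"
  have q3: "3 \<le> q" using assms by (simp add: q_def)
  have fin: "finite I" using assms by (metis card.infinite not_numeral_le_zero)
  define A where "A = (\<Sum>k\<in>I. (s k - 1 / q)\<^sup>2)"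
  have A0: "0 \<le> A" unfolding A_def by (intro sum_nonneg) auto
  \<comment> \<open>Chosen so that (a, b, ..., b) has the same squared distance from the centre as
    \<open>s\<close>: d^2 + d^2 / (q - 1) = A.\<close>
  define d where "d = sqrt (A * (q - 1) / q)"
  have d0: "0 \<le> d" using A0 q3 by (simp add: d_def)
  have d2: "d\<^sup>2 = A * (q - 1) / q" using A0 q3 by (simp add: d_def)
  then have A_d: "A = d\<^sup>2 * q / (q - 1)" using q3 by (simp add: field_simps)
  define a where "a = 1 / q + d"
  define b where "b = (1 - a) / (q - 1)"
  have sum_shift: "(\<Sum>k\<in>I. (s k - c)\<^sup>2) = A + q * (1 / q - c)\<^sup>2" for c
  proof -
    have "(\<Sum>k\<in>I. (s k - c)\<^sup>2) = (\<Sum>k\<in>I. (s k - 1 / q)\<^sup>2 + (2 * (1 / q - c)) * s k + (c\<^sup>2 - 1 / q\<^sup>2))"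
      using q3 by (intro sum.cong) (auto simp: power2_eq_square field_simps)
    also have "\<dots> = A + 2 * (1 / q - c) + q * (c\<^sup>2 - 1 / q\<^sup>2)"
      by (simp add: sum.distrib A_def q_def[symmetric] flip: sum_distrib_left) (simp add: s1)
    also have "\<dots> = A + q * (1 / q - c)\<^sup>2" using q3 by (simp add: power2_eq_square field_simps)
    finally show ?thesis .
  qed
  \<comment> \<open>The right-hand side is the entropy deficit of (a, b, ..., b), which is a
    Bernoulli divergence of \<open>a\<close> from 1/q. With p = 1/q the coefficient of
    \<open>bern_gap\<close> turns into the critical value.\<close>
  have gap: "potts_beta_c (card I) * A \<le> a * ln (a * q) + (1 - a) * ln ((1 - a) / (1 - 1 / q))"
    if "a \<le> 1"
  proof -
    have "0 \<le> bern_gap (1 / q) a"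
      using q3 d0 that by (intro bern_gap_nonneg) (auto simp: a_def)
    moreover have "ln ((1 - 1 / q) / (1 / q)) / (1 - 2 * (1 / q)) * (a - 1 / q)\<^sup>2 = potts_beta_c (card I) * A"
    proof -
      have "(1 - 1 / q) / (1 / q) = q - 1" using q3 by (simp add: field_simps)
      moreover have "ln (q - 1) / (1 - 2 * (1 / q)) * d\<^sup>2 = (q - 1) * ln (q - 1) / (q - 2) * A"
      proof -
        have "1 - 2 * (1 / q) = (q - 2) / q" using q3 by (simp add: field_simps)
        then show ?thesis unfolding A_d using q3 by (simp add: mult_ac)
      qed
      ultimately show ?thesis by (simp add: a_def potts_beta_c_def q_def)
    qed
    ultimately show ?thesis by (simp add: bern_gap_def)
  qed
  have sq_le: "(\<Sum>k\<in>I. (s k)\<^sup>2) \<le> 1"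
  proof -
    have "s k \<le> 1" if "k \<in> I" for k
      using member_le_sum[OF that, of s] nn fin s1 by auto
    then have "(\<Sum>k\<in>I. (s k)\<^sup>2) \<le> (\<Sum>k\<in>I. s k)"
      by (intro sum_mono) (auto simp: power2_eq_square nn mult_left_le)
    then show ?thesis using s1 by simp
  qed
  have A_sq: "(\<Sum>k\<in>I. (s k)\<^sup>2) = A + 1 / q"
    using sum_shift[of 0] q3 by (simp add: power2_eq_square)
  have a1: "a \<le> 1"
  proof -
    have "d\<^sup>2 \<le> (1 - 1 / q) * (q - 1) / q"
      unfolding d2 using sq_le A_sq q3 by (intro divide_right_mono mult_right_mono) auto
    also have "\<dots> = (1 - 1 / q)\<^sup>2" using q3 by (simp add: power2_eq_square field_simps)
    finally have "d \<le> 1 - 1 / q" using q3 by (intro power2_le_imp_le[of d]) auto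
    then show ?thesis by (simp add: a_def)
  qed
  have "a * ln (a * q) + (1 - a) * ln ((1 - a) / (1 - 1 / q)) \<le> (\<Sum>k\<in>I. s k * ln (s k)) + ln q"
  proof (cases "a = 1")
    \<comment> \<open>Here b = 0, so no Bregman divergence from \<open>b\<close> exists. The
      distance is maximal, which forces \<open>s\<close> to be a vertex of the simplex with
      vanishing entropy.\<close>
    case True
    then have "d = 1 - 1 / q" by (simp add: a_def)
    then have "A = (1 - 1 / q)\<^sup>2 * q / (q - 1)" unfolding A_d by simp
    then have "A = 1 - 1 / q" using q3 by (simp add: power2_eq_square divide_simps)
    then have "(\<Sum>k\<in>I. s k - (s k)\<^sup>2) = 0" using A_sq s1 by (simp add: sum_subtractf)
    moreover have "0 \<le> s k - (s k)\<^sup>2" if "k \<in> I" for k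
      using member_le_sum[OF that, of s] nn[OF that] nn fin s1 by (auto simp: power2_eq_square mult_left_le)
    ultimately have "\<forall>k\<in>I. s k - (s k)\<^sup>2 = 0" using fin by (subst (asm) sum_nonneg_eq_0_iff) auto
    then have "\<forall>k\<in>I. s k = 0 \<or> s k = 1" by (auto simp: power2_eq_square)
    then have "(\<Sum>k\<in>I. s k * ln (s k)) = 0" by (intro sum.neutral) auto
    then show ?thesis using True q3 by simp
  next
    case a_ne: False
    then have b0: "0 < b" using a1 q3 by (simp add: b_def)
    show ?thesis
    proof (cases "d = 0")
      case True
      then have "A = 0" using A_d by simp
      then have "\<forall>k\<in>I. s k = 1 / q" unfolding A_def using fin by (subst (asm) sum_nonneg_eq_0_iff) auto
      then have "(\<Sum>k\<in>I. s k * ln (s k)) = (\<Sum>k\<in>I. 1 / q * ln (1 / q))" by (intro sum.cong) auto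
      also have "\<dots> = - ln q" using q3 by (simp add: q_def[symmetric] ln_div)
      finally show ?thesis using True q3 by (simp add: a_def)
    next
      case False
      then have d0: "0 < d" using d0 by simp
      have ab: "a - b = d * q / (q - 1)" using q3 by (simp add: a_def b_def field_simps)
      moreover have "0 < d * q / (q - 1)" using d0 q3 by simp
      ultimately have "0 < a - b" by (simp only:)
      then have "b < a" by simp
      have s_le: "s k \<le> a" if "k \<in> I" for k
      proof -
        have "(\<Sum>k\<in>I. s k - 1 / q) = 0" using s1 q3 by (simp add: sum_subtractf q_def)
        from square_deviation_le[OF fin that this]
        have "q * (s k - 1 / q)\<^sup>2 \<le> (q - 1) * A" by (simp add: A_def q_def)
        then have "(s k - 1 / q)\<^sup>2 \<le> d\<^sup>2" unfolding d2 using q3 by (simp add: field_simps)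
        then have "s k - 1 / q \<le> d" using d0 by (auto intro: power2_le_imp_le)
        then show ?thesis by (simp add: a_def)
      qed
      define F where "F = a * ln (a / b) - a + b"
      have "F * (\<Sum>k\<in>I. (s k - b)\<^sup>2) \<le> (\<Sum>k\<in>I. s k * ln (s k / b) - s k + b) * (a - b)\<^sup>2"
        unfolding F_def sum_distrib_left sum_distrib_right
        using b0 nn s_le \<open>b < a\<close> by (intro sum_mono bregman_mono)
      \<comment> \<open>Equal distance from the centre implies equal distance from (b, ..., b), so
        the quadratic factors of the summed Bregman inequality cancel.\<close>
      moreover have "(\<Sum>k\<in>I. (s k - b)\<^sup>2) = (a - b)\<^sup>2"
        unfolding sum_shift ab A_d b_def a_def using q3
        by (simp add: divide_simps) (simp add: algebra_simps power2_eq_square)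
      ultimately have "F \<le> (\<Sum>k\<in>I. s k * ln (s k / b) - s k + b)"
        using \<open>b < a\<close> by simp
      also have "\<dots> = (\<Sum>k\<in>I. s k * ln (s k) + (- ln b - 1) * s k + b)"
      proof (intro sum.cong refl)
        fix k assume "k \<in> I"
        show "s k * ln (s k / b) - s k + b = s k * ln (s k) + (- ln b - 1) * s k + b"
          using b0 nn[OF \<open>k \<in> I\<close>] by (cases "s k = 0") (auto simp: ln_div algebra_simps)
      qed
      also have "\<dots> = (\<Sum>k\<in>I. s k * ln (s k)) + (- ln b - 1) + q * b"
        by (simp add: sum.distrib q_def[symmetric] flip: sum_distrib_left) (simp add: s1)
      finally have main: "F \<le> (\<Sum>k\<in>I. s k * ln (s k)) + (- ln b - 1) + q * b" .
      have "(1 - a) / (1 - 1 / q) = b * q" using q3 by (simp add: b_def field_simps)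
      moreover have "0 < a" using d0 q3 by (simp add: a_def add_pos_pos)
      moreover have "a + (q - 1) * b = 1" using q3 by (simp add: b_def)
      ultimately have "a * ln (a * q) + (1 - a) * ln ((1 - a) / (1 - 1 / q)) = F + ln b + 1 - q * b + ln q"
        using b0 q3 by (simp add: F_def ln_mult ln_div algebra_simps)
      then show ?thesis using main by simp
    qed
  qed
  with gap[OF a1] show ?thesis by (simp add: A_def q_def)
qed

section \<open>Colour counts and the energy of a configuration\<close>

definition color_count :: "nat \<Rightarrow> (nat \<Rightarrow> nat) \<Rightarrow> nat \<Rightarrow> nat" where
  "color_count n \<sigma> k = card {v\<in>{1..n}. \<sigma> v = k}"

definition color_dev :: "nat \<Rightarrow> nat \<Rightarrow> (nat \<Rightarrow> nat) \<Rightarrow> nat \<Rightarrow> real" where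
  "color_dev q n \<sigma> k = real (color_count n \<sigma> k) / real n - 1 / real q"

definition energy :: "nat \<Rightarrow> nat \<Rightarrow> (nat \<Rightarrow> nat) \<Rightarrow> real" where
  "energy q n \<sigma> = (\<Sum>k=1..q. (color_dev q n \<sigma> k)\<^sup>2)"

lemma energy_nonneg: "0 \<le> energy q n \<sigma>"
  unfolding energy_def by (intro sum_nonneg) auto

lemma configs_range: "\<sigma> \<in> configs q n \<Longrightarrow> v \<in> {1..n} \<Longrightarrow> \<sigma> v \<in> {1..q}"
  by (auto simp: configs_def)

lemma sum_by_color:
  fixes g :: "nat \<Rightarrow> real"
  assumes "\<sigma> \<in> configs q n"
  shows "(\<Sum>v=1..n. g (\<sigma> v)) = (\<Sum>k=1..q. real (color_count n \<sigma> k) * g k)"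
proof -
  have "(\<Sum>v=1..n. g (\<sigma> v)) = (\<Sum>k\<in>{1..q}. \<Sum>v\<in>{v\<in>{1..n}. \<sigma> v = k}. g (\<sigma> v))"
    using configs_range[OF assms] by (intro sum.group[symmetric]) auto
  also have "\<dots> = (\<Sum>k=1..q. real (color_count n \<sigma> k) * g k)"
    by (intro sum.cong refl) (simp add: color_count_def)
  finally show ?thesis .
qed

lemma sum_color_count:
  assumes "\<sigma> \<in> configs q n"
  shows "(\<Sum>k=1..q. real (color_count n \<sigma> k)) = real n"
  using sum_by_color[OF assms, of "\<lambda>_. 1"] by simp

lemma sum_color_dev:
  assumes "\<sigma> \<in> configs q n" "1 \<le> n" "1 \<le> q"
  shows "(\<Sum>k=1..q. color_dev q n \<sigma> k) = 0"
  using assms sum_color_count[OF assms(1)]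
  by (simp add: color_dev_def sum_subtractf flip: sum_divide_distrib)

lemma sum_color_count_sq:
  assumes "\<sigma> \<in> configs q n" "1 \<le> n" "1 \<le> q"
  shows "(\<Sum>k=1..q. (real (color_count n \<sigma> k))\<^sup>2) = (real n)\<^sup>2 * (energy q n \<sigma> + 1 / real q)"
proof -
  have "(\<Sum>k=1..q. (real (color_count n \<sigma> k))\<^sup>2)
      = (\<Sum>k=1..q. (real n)\<^sup>2 * ((color_dev q n \<sigma> k)\<^sup>2 + 2 / real q * color_dev q n \<sigma> k + 1 / (real q)\<^sup>2))"
    using assms by (intro sum.cong refl) (simp add: color_dev_def power2_eq_square field_simps)
  also have "\<dots> = (real n)\<^sup>2 * (energy q n \<sigma> + 1 / real q)"
    unfolding sum_distrib_left[symmetric] sum.distrib sum_color_dev[OF assms]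
    using assms by (simp add: energy_def power2_eq_square)
  finally show ?thesis .
qed

lemma potts_weight_energy:
  assumes "\<sigma> \<in> configs q n" "1 \<le> n" "1 \<le> q"
  shows "potts_weight \<beta> n \<sigma> = exp (\<beta> * real n * (energy q n \<sigma> + 1 / real q))"
proof -
  have "(\<Sum>(u, v)\<in>{1..n} \<times> {1..n}. if \<sigma> u = \<sigma> v then 1 else 0 :: real)
      = (\<Sum>u=1..n. \<Sum>v=1..n. if \<sigma> v = \<sigma> u then 1 else 0)"
    unfolding sum.cartesian_product by (intro sum.cong) auto
  also have "\<dots> = (\<Sum>u=1..n. real (color_count n \<sigma> (\<sigma> u)))"
    by (intro sum.cong refl) (simp add: color_count_def sum.If_cases Int_def)
  also have "\<dots> = (\<Sum>k=1..q. (real (color_count n \<sigma> k))\<^sup>2)"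
    by (subst sum_by_color[OF assms(1)]) (simp add: power2_eq_square)
  finally show ?thesis
    unfolding potts_weight_def sum_color_count_sq[OF assms] using assms
    by (simp add: power2_eq_square)
qed

section \<open>Large deviations of the Gibbs measure\<close>

text \<open>For each fixed vector of counts \<open>c\<close> the inner sum is at most \<open>(\<Sum>\<^sub>k c\<^sub>k / n)\<^sup>n = 1\<close>, and
  there are at most \<open>(n + 1)\<^sup>q\<close> such vectors.\<close>

lemma sum_type_class_weights:
  assumes n: "1 \<le> n"
  shows "(\<Sum>\<sigma>\<in>configs q n. \<Prod>v=1..n. real (color_count n \<sigma> (\<sigma> v)) / real n) \<le> (real n + 1) ^ q"
proof -
  define cs where "cs = (\<lambda>\<sigma>. restrict (color_count n \<sigma>) {1..q})"
  define T where "T = {c \<in> {1..q} \<rightarrow>\<^sub>E {0..n}. (\<Sum>k=1..q. real (c k)) = real n}"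
  have finP: "finite ({1..q} \<rightarrow>\<^sub>E {0..n})" by (intro finite_PiE) auto
  have finT: "finite T" unfolding T_def using finP by simp
  have "color_count n \<sigma> k \<le> n" for \<sigma> k
    unfolding color_count_def using card_mono[of "{1..n}" "{v\<in>{1..n}. \<sigma> v = k}"] by (simp add: subset_iff)
  then have cs_T: "cs \<sigma> \<in> T" if "\<sigma> \<in> configs q n" for \<sigma>
    using sum_color_count[OF that] by (auto simp: cs_def T_def)
  let ?w = "\<lambda>c \<sigma>. \<Prod>v=1..n. real (c (\<sigma> v)) / real n"
  have "(\<Sum>\<sigma>\<in>configs q n. ?w (color_count n \<sigma>) \<sigma>) = (\<Sum>\<sigma>\<in>configs q n. ?w (cs \<sigma>) \<sigma>)"
    using configs_range by (intro sum.cong refl prod.cong) (auto simp: cs_def)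
  also have "\<dots> = (\<Sum>c\<in>T. \<Sum>\<sigma>\<in>{\<sigma>\<in>configs q n. cs \<sigma> = c}. ?w (cs \<sigma>) \<sigma>)"
    using cs_T by (intro sum.group[symmetric] finite_configs finT) auto
  also have "\<dots> = (\<Sum>c\<in>T. \<Sum>\<sigma>\<in>{\<sigma>\<in>configs q n. cs \<sigma> = c}. ?w c \<sigma>)"
    by (intro sum.cong refl) auto
  also have "\<dots> \<le> (\<Sum>c\<in>T. \<Sum>\<sigma>\<in>configs q n. ?w c \<sigma>)"
    by (intro sum_mono sum_mono2 finite_configs) (auto intro!: prod_nonneg)
  also have "\<dots> = (\<Sum>c\<in>T. \<Prod>v\<in>{1..n}. \<Sum>k\<in>{1..q}. real (c k) / real n)"
    unfolding configs_def by (subst prod_sum_PiE) auto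
  also have "\<dots> = (\<Sum>c\<in>T. 1)"
    using n by (intro sum.cong refl) (simp add: T_def flip: sum_divide_distrib)
  also have "\<dots> \<le> real (card ({1..q} \<rightarrow>\<^sub>E {0..n}))"
    using card_mono[OF finP, of T] by (simp add: T_def)
  also have "\<dots> = (real n + 1) ^ q" by (simp add: card_PiE add.commute)
  finally show ?thesis .
qed

lemma potts_Z_ge:
  assumes "0 \<le> \<beta>" "1 \<le> n" "1 \<le> q"
  shows "real q ^ n * exp (\<beta> * real n / real q) \<le> potts_Z q \<beta> n"
proof -
  have "real q ^ n * exp (\<beta> * real n / real q) = (\<Sum>\<sigma>\<in>configs q n. exp (\<beta> * real n / real q))"
    by (simp add: configs_def card_PiE)
  also have "\<dots> \<le> potts_Z q \<beta> n"
    unfolding potts_Z_def using assms energy_nonneg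
    by (intro sum_mono) (simp add: potts_weight_energy field_simps)
  finally show ?thesis .
qed

lemma potts_prob_sum:
  assumes "1 \<le> q" "B \<subseteq> configs q n"
  shows "measure_pmf.prob (potts q \<beta> n) B = (\<Sum>\<sigma>\<in>B. potts_weight \<beta> n \<sigma> / potts_Z q \<beta> n)"
  using assms finite_subset[OF assms(2) finite_configs]
  by (subst measure_measure_pmf_finite) (auto simp: pmf_potts intro!: sum.cong)

text \<open>Relative to the lower bound on the partition function a configuration has weight exp
  (\<beta> n W - n ln q). The entropy inequality trades this for the product of its own colour
  frequencies times exp (-(\<beta>_c - \<beta>) W n), and those products sum to a
  polynomial.\<close>

lemma potts_energy_large_deviation:
  assumes q: "3 \<le> q" and \<beta>: "0 \<le> \<beta>" "\<beta> < potts_beta_c q" and n: "1 \<le> n"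
  shows "measure_pmf.prob (potts q \<beta> n) {\<sigma>\<in>configs q n. r < energy q n \<sigma>}
     \<le> (real n + 1) ^ q * exp (- (potts_beta_c q - \<beta>) * r * real n)"
proof -
  let ?b = "potts_beta_c q"
  have density: "potts_weight \<beta> n \<sigma> / potts_Z q \<beta> n
      \<le> exp (- (?b - \<beta>) * r * real n) * (\<Prod>v=1..n. real (color_count n \<sigma> (\<sigma> v)) / real n)"
    if \<sigma>: "\<sigma> \<in> configs q n" and r: "r < energy q n \<sigma>" for \<sigma>
  proof -
    define W where "W = energy q n \<sigma>"
    define s where "s = (\<lambda>k. real (color_count n \<sigma> k) / real n)"
    have pos: "0 < s (\<sigma> v)" if "v \<in> {1..n}" for v
    proof -
      have "0 < color_count n \<sigma> (\<sigma> v)" unfolding color_count_def card_gt_0_iff using that by auto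
      then show ?thesis using n by (simp add: s_def)
    qed
    have "(\<Prod>v=1..n. s (\<sigma> v)) = exp (\<Sum>v=1..n. ln (s (\<sigma> v)))"
      unfolding exp_sum[OF finite_atLeastAtMost] using pos by (intro prod.cong) auto
    also have "(\<Sum>v=1..n. ln (s (\<sigma> v))) = real n * (\<Sum>k=1..q. s k * ln (s k))"
      unfolding sum_by_color[OF \<sigma>, of "\<lambda>k. ln (s k)"] using n
      by (simp add: s_def sum_distrib_left)
    finally have prod: "(\<Prod>v=1..n. s (\<sigma> v)) = exp (real n * (\<Sum>k=1..q. s k * ln (s k)))" .
    have "?b * W \<le> (\<Sum>k=1..q. s k * ln (s k)) + ln q"
      using entropy_ge_beta_c_energy[of "{1..q}" s] q n sum_color_count[OF \<sigma>]
      by (simp add: s_def W_def energy_def color_dev_def flip: sum_divide_distrib)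
    then have "real n * (?b * W - ln q) \<le> real n * (\<Sum>k=1..q. s k * ln (s k))"
      by (intro mult_left_mono) auto
    moreover have "(?b - \<beta>) * r * real n \<le> (?b - \<beta>) * W * real n"
      using r \<beta> by (intro mult_right_mono mult_left_mono) (auto simp: W_def)
    ultimately have "\<beta> * real n * W - real n * ln q
        \<le> - (?b - \<beta>) * r * real n + real n * (\<Sum>k=1..q. s k * ln (s k))"
      by (simp add: algebra_simps)
    then have "exp (\<beta> * real n * W - real n * ln q) \<le> exp (- (?b - \<beta>) * r * real n) * (\<Prod>v=1..n. s (\<sigma> v))"
      unfolding prod exp_add[symmetric] by simp
    moreover have "potts_weight \<beta> n \<sigma> / potts_Z q \<beta> n \<le> exp (\<beta> * real n * W - real n * ln q)"
    proof -
      have "real q ^ n = exp (real n * ln (real q))" using q by (simp add: exp_of_nat_mult)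
      then have "potts_weight \<beta> n \<sigma> / (real q ^ n * exp (\<beta> * real n / real q)) = exp (\<beta> * real n * W - real n * ln q)"
        using q n by (simp add: potts_weight_energy[OF \<sigma>] W_def algebra_simps flip: exp_diff exp_add)
      moreover have "potts_weight \<beta> n \<sigma> / potts_Z q \<beta> n
          \<le> potts_weight \<beta> n \<sigma> / (real q ^ n * exp (\<beta> * real n / real q))"
        using potts_Z_ge[of \<beta> n q] \<beta> n q potts_weight_pos[of \<beta> n \<sigma>]
        by (intro divide_left_mono mult_pos_pos potts_Z_pos) auto
      ultimately show ?thesis by simp
    qed
    ultimately show ?thesis by (simp add: s_def)
  qed
  have "measure_pmf.prob (potts q \<beta> n) {\<sigma>\<in>configs q n. r < energy q n \<sigma>}
      = (\<Sum>\<sigma>\<in>{\<sigma>\<in>configs q n. r < energy q n \<sigma>}. potts_weight \<beta> n \<sigma> / potts_Z q \<beta> n)"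
    using q by (intro potts_prob_sum) auto
  also have "\<dots> \<le> (\<Sum>\<sigma>\<in>{\<sigma>\<in>configs q n. r < energy q n \<sigma>}.
      exp (- (?b - \<beta>) * r * real n) * (\<Prod>v=1..n. real (color_count n \<sigma> (\<sigma> v)) / real n))"
    using density by (intro sum_mono) auto
  also have "\<dots> \<le> (\<Sum>\<sigma>\<in>configs q n.
      exp (- (?b - \<beta>) * r * real n) * (\<Prod>v=1..n. real (color_count n \<sigma> (\<sigma> v)) / real n))"
    by (intro sum_mono2 finite_configs) (auto intro!: mult_nonneg_nonneg prod_nonneg)
  also have "\<dots> \<le> exp (- (?b - \<beta>) * r * real n) * (real n + 1) ^ q"
    unfolding sum_distrib_left[symmetric] using sum_type_class_weights[OF n, of q]
    by (intro mult_left_mono) auto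
  finally show ?thesis by (simp add: mult.commute)
qed

lemma poly_exp_bound:
  fixes c :: real
  assumes "0 < c"
  shows "\<exists>K>0. \<forall>n::nat. (real n + 1) ^ q * exp (- c * real n) \<le> K * exp (- (c / 2) * real n)"
proof -
  have "(\<lambda>n::nat. (real n + 1) ^ q * exp (- (c / 2) * real n)) \<longlonglongrightarrow> 0"
    using assms by real_asymp
  then have "Bseq (\<lambda>n::nat. (real n + 1) ^ q * exp (- (c / 2) * real n))"
    by (intro convergent_imp_Bseq convergentI)
  then obtain K where K: "0 < K" "\<And>n::nat. norm ((real n + 1) ^ q * exp (- (c / 2) * real n)) \<le> K"
    by (auto simp: Bseq_def)
  have "(real n + 1) ^ q * exp (- c * real n) \<le> K * exp (- (c / 2) * real n)" for n :: nat
  proof -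
    have "(real n + 1) ^ q * exp (- c * real n) = ((real n + 1) ^ q * exp (- (c / 2) * real n)) * exp (- (c / 2) * real n)"
      by (simp add: mult.assoc flip: exp_add)
    also have "\<dots> \<le> K * exp (- (c / 2) * real n)"
      using K(2)[of n] by (intro mult_right_mono) auto
    finally show ?thesis .
  qed
  then show ?thesis using K(1) by blast
qed

section \<open>Single-site update operators\<close>

text \<open>The transition operator in its action on functions, so that iterates are expectations
  from a given start. The recolouring rule is a parameter because the Glauber, the clipped and the
  uniform dynamics are compared with each other.\<close>

definition upd_op ::
  "nat \<Rightarrow> nat \<Rightarrow> ((nat \<Rightarrow> nat) \<Rightarrow> nat \<Rightarrow> nat \<Rightarrow> real) \<Rightarrow> ((nat \<Rightarrow> nat) \<Rightarrow> real) \<Rightarrow> (nat \<Rightarrow> nat) \<Rightarrow> real" where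
  "upd_op q n r f \<sigma> = (\<Sum>v=1..n. \<Sum>k=1..q. r \<sigma> v k * f (\<sigma>(v := k))) / real n"

lemma configs_upd: "\<sigma> \<in> configs q n \<Longrightarrow> v \<in> {1..n} \<Longrightarrow> k \<in> {1..q} \<Longrightarrow> \<sigma>(v := k) \<in> configs q n"
  by (auto simp: configs_def PiE_def extensional_def)

locale update_chain =
  fixes q n :: nat and r :: "(nat \<Rightarrow> nat) \<Rightarrow> nat \<Rightarrow> nat \<Rightarrow> real"
  assumes n_pos: "1 \<le> n" and q_pos: "1 \<le> q"
    and rule_nonneg: "\<And>\<sigma> v k. 0 \<le> r \<sigma> v k"
    and rule_sum: "\<And>\<sigma> v. (\<Sum>k=1..q. r \<sigma> v k) = 1"
begin

abbreviation P where "P \<equiv> upd_op q n r"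

lemma P_const [simp]: "P (\<lambda>_. c) \<sigma> = c"
  using n_pos rule_sum by (simp add: upd_op_def flip: sum_distrib_right)

lemma P_add: "P (\<lambda>\<sigma>. f \<sigma> + g \<sigma>) \<sigma> = P f \<sigma> + P g \<sigma>"
  by (simp add: upd_op_def algebra_simps sum.distrib add_divide_distrib)

lemma P_cmult: "P (\<lambda>\<sigma>. c * f \<sigma>) \<sigma> = c * P f \<sigma>"
  by (simp add: upd_op_def sum_distrib_left mult.left_commute)

lemma P_diff: "P (\<lambda>\<sigma>. f \<sigma> - g \<sigma>) \<sigma> = P f \<sigma> - P g \<sigma>"
  using P_add[of f "\<lambda>\<sigma>. (- 1) * g \<sigma>"] P_cmult[of "- 1" g] by simp

lemma P_mono:
  assumes "\<sigma> \<in> configs q n" "\<And>\<sigma>. \<sigma> \<in> configs q n \<Longrightarrow> f \<sigma> \<le> g \<sigma>"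
  shows "P f \<sigma> \<le> P g \<sigma>"
  unfolding upd_op_def using assms rule_nonneg
  by (intro divide_right_mono sum_mono mult_left_mono) (auto simp: configs_upd)

lemma iter_const [simp]: "(P ^^ t) (\<lambda>_. c) \<sigma> = c"
proof (induction t arbitrary: \<sigma>)
  case (Suc t)
  then have "(P ^^ t) (\<lambda>_. c) = (\<lambda>_. c)" by blast
  then show ?case by simp
qed simp

lemma iter_add: "(P ^^ t) (\<lambda>\<sigma>. f \<sigma> + g \<sigma>) \<sigma> = (P ^^ t) f \<sigma> + (P ^^ t) g \<sigma>"
proof (induction t arbitrary: \<sigma>)
  case (Suc t)
  then have "(P ^^ t) (\<lambda>\<sigma>. f \<sigma> + g \<sigma>) = (\<lambda>\<sigma>. (P ^^ t) f \<sigma> + (P ^^ t) g \<sigma>)" by blast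
  then show ?case by (simp add: P_add)
qed simp

lemma iter_cmult: "(P ^^ t) (\<lambda>\<sigma>. c * f \<sigma>) \<sigma> = c * (P ^^ t) f \<sigma>"
proof (induction t arbitrary: \<sigma>)
  case (Suc t)
  then have "(P ^^ t) (\<lambda>\<sigma>. c * f \<sigma>) = (\<lambda>\<sigma>. c * (P ^^ t) f \<sigma>)" by blast
  then show ?case by (simp add: P_cmult)
qed simp

lemma iter_diff: "(P ^^ t) (\<lambda>\<sigma>. f \<sigma> - g \<sigma>) \<sigma> = (P ^^ t) f \<sigma> - (P ^^ t) g \<sigma>"
  using iter_add[of t f "\<lambda>\<sigma>. (- 1) * g \<sigma>"] iter_cmult[of t "- 1" g] by simp

lemma iter_mono:
  assumes "\<sigma> \<in> configs q n" "\<And>\<sigma>. \<sigma> \<in> configs q n \<Longrightarrow> f \<sigma> \<le> g \<sigma>"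
  shows "(P ^^ t) f \<sigma> \<le> (P ^^ t) g \<sigma>"
  using assms(1)
proof (induction t arbitrary: \<sigma>)
  case (Suc t)
  then show ?case using P_mono[of \<sigma> "(P ^^ t) f" "(P ^^ t) g"] by simp
qed (use assms(2) in simp)

lemma iter_abs_le:
  assumes "\<sigma> \<in> configs q n" "\<And>\<sigma>. \<sigma> \<in> configs q n \<Longrightarrow> \<bar>f \<sigma>\<bar> \<le> g \<sigma>"
  shows "\<bar>(P ^^ t) f \<sigma>\<bar> \<le> (P ^^ t) g \<sigma>"
proof -
  have "(P ^^ t) (\<lambda>\<sigma>. (- 1) * f \<sigma>) \<sigma> \<le> (P ^^ t) g \<sigma>"
    by (rule iter_mono[OF assms(1)]) (use assms(2) in \<open>force simp: abs_le_iff\<close>)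
  moreover have "(P ^^ t) f \<sigma> \<le> (P ^^ t) g \<sigma>"
    by (rule iter_mono[OF assms(1)]) (use assms(2) in \<open>force simp: abs_le_iff\<close>)
  ultimately show ?thesis by (simp add: iter_cmult[of t "- 1", simplified] abs_le_iff)
qed

lemma iter_affine_le:
  assumes \<sigma>: "\<sigma> \<in> configs q n" and a: "0 \<le> a" "a < 1" and d: "0 \<le> d"
    and step: "\<And>\<sigma>. \<sigma> \<in> configs q n \<Longrightarrow> P f \<sigma> \<le> a * f \<sigma> + d"
  shows "(P ^^ t) f \<sigma> \<le> a ^ t * f \<sigma> + d / (1 - a)"
  using \<sigma>
proof (induction t arbitrary: \<sigma>)
  case 0
  then show ?case using a d by simp
next
  case (Suc t)
  have "(P ^^ Suc t) f \<sigma> = (P ^^ t) (P f) \<sigma>" by (simp add: funpow_swap1)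
  also have "\<dots> \<le> (P ^^ t) (\<lambda>\<sigma>. a * f \<sigma> + d) \<sigma>"
    using Suc.prems step by (intro iter_mono)
  also have "\<dots> = a * (P ^^ t) f \<sigma> + d" by (simp add: iter_add iter_cmult)
  also have "\<dots> \<le> a * (a ^ t * f \<sigma> + d / (1 - a)) + d"
    using Suc a by (intro add_right_mono mult_left_mono) auto
  also have "\<dots> = a ^ Suc t * f \<sigma> + d / (1 - a)"
    using a by (simp add: field_simps)
  finally show ?case .
qed

lemma iter_geometric_le:
  assumes \<sigma>: "\<sigma> \<in> configs q n" and a: "0 \<le> a"
    and step: "\<And>\<sigma>. \<sigma> \<in> configs q n \<Longrightarrow> P f \<sigma> \<le> a * f \<sigma>"
  shows "(P ^^ t) f \<sigma> \<le> a ^ t * f \<sigma>"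
  using \<sigma>
proof (induction t arbitrary: \<sigma>)
  case (Suc t)
  have "(P ^^ Suc t) f \<sigma> = (P ^^ t) (P f) \<sigma>" by (simp add: funpow_swap1)
  also have "\<dots> \<le> (P ^^ t) (\<lambda>\<sigma>. a * f \<sigma>) \<sigma>"
    using Suc.prems step by (intro iter_mono)
  also have "\<dots> \<le> a * (a ^ t * f \<sigma>)"
    unfolding iter_cmult using Suc a by (intro mult_left_mono) auto
  finally show ?case by (simp add: mult.assoc)
qed simp

text \<open>The second moment about the current value \<open>g \<sigma>\<close> is at most L^2, and
  it dominates the variance of the step.\<close>

lemma P_square_increment:
  assumes \<sigma>: "\<sigma> \<in> configs q n"
    and L: "\<And>v k. v \<in> {1..n} \<Longrightarrow> k \<in> {1..q} \<Longrightarrow> \<bar>g \<sigma> - g (\<sigma>(v := k))\<bar> \<le> L"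
  shows "P (\<lambda>\<sigma>. (g \<sigma>)\<^sup>2) \<sigma> \<le> (P g \<sigma>)\<^sup>2 + L\<^sup>2"
proof -
  define c where "c = g \<sigma>"
  have "P (\<lambda>\<sigma>. (g \<sigma> - c)\<^sup>2) \<sigma> \<le> (\<Sum>v=1..n. \<Sum>k=1..q. r \<sigma> v k * L\<^sup>2) / real n"
    unfolding upd_op_def
  proof (intro divide_right_mono sum_mono mult_left_mono rule_nonneg)
    fix v k assume "v \<in> {1..n}" "k \<in> {1..q}"
    then show "(g (\<sigma>(v := k)) - c)\<^sup>2 \<le> L\<^sup>2"
      using L[of v k] power_mono[of "\<bar>g \<sigma> - g (\<sigma>(v := k))\<bar>" L 2]
      by (simp add: c_def power2_commute)
  qed auto
  also have "\<dots> = L\<^sup>2" using P_const[of "L\<^sup>2" \<sigma>] by (simp add: upd_op_def)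
  finally have "P (\<lambda>\<sigma>. (g \<sigma> - c)\<^sup>2) \<sigma> \<le> L\<^sup>2" .
  moreover have "P (\<lambda>\<sigma>. (g \<sigma> - c)\<^sup>2) \<sigma> = P (\<lambda>\<sigma>. (g \<sigma>)\<^sup>2) \<sigma> - 2 * c * P g \<sigma> + c\<^sup>2"
  proof -
    have "P (\<lambda>\<sigma>. (g \<sigma> - c)\<^sup>2) \<sigma> = P (\<lambda>\<sigma>. ((g \<sigma>)\<^sup>2 + (- 2 * c) * g \<sigma>) + c\<^sup>2) \<sigma>"
      by (simp add: power2_eq_square algebra_simps)
    also have "\<dots> = P (\<lambda>\<sigma>. (g \<sigma>)\<^sup>2) \<sigma> - 2 * c * P g \<sigma> + c\<^sup>2"
      unfolding P_add P_cmult P_const by simp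
    finally show ?thesis .
  qed
  moreover have "0 \<le> (P g \<sigma> - c)\<^sup>2" by simp
  ultimately show ?thesis by (simp add: power2_eq_square algebra_simps)
qed

text \<open>The orthogonality of martingale increments: the step made with \<open>j\<close> steps
  left moves the conditional mean by at most the gradient of \<open>(P ^^ j) f\<close>. Geometric
  decay of that gradient keeps the variance bounded uniformly in time.\<close>

lemma iter_variance_le:
  assumes \<sigma>: "\<sigma> \<in> configs q n"
    and L: "\<And>j \<sigma> v k. \<sigma> \<in> configs q n \<Longrightarrow> v \<in> {1..n} \<Longrightarrow> k \<in> {1..q} \<Longrightarrow>
      \<bar>(P ^^ j) f \<sigma> - (P ^^ j) f (\<sigma>(v := k))\<bar> \<le> L j"
  shows "(P ^^ t) (\<lambda>\<sigma>. (f \<sigma>)\<^sup>2) \<sigma> \<le> ((P ^^ t) f \<sigma>)\<^sup>2 + (\<Sum>j<t. (L j)\<^sup>2)"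
  using \<sigma>
proof (induction t arbitrary: \<sigma>)
  case (Suc t)
  have "(P ^^ Suc t) (\<lambda>\<sigma>. (f \<sigma>)\<^sup>2) \<sigma> \<le> P (\<lambda>\<sigma>. ((P ^^ t) f \<sigma>)\<^sup>2 + (\<Sum>j<t. (L j)\<^sup>2)) \<sigma>"
    using P_mono[OF Suc.prems Suc.IH] by simp
  also have "\<dots> = P (\<lambda>\<sigma>. ((P ^^ t) f \<sigma>)\<^sup>2) \<sigma> + (\<Sum>j<t. (L j)\<^sup>2)" by (simp add: P_add)
  also have "P (\<lambda>\<sigma>. ((P ^^ t) f \<sigma>)\<^sup>2) \<sigma> \<le> (P ((P ^^ t) f) \<sigma>)\<^sup>2 + (L t)\<^sup>2"
    using Suc.prems L by (intro P_square_increment)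
  finally show ?case by simp
qed simp

end

text \<open>Telescoping over the time at which the dynamics switches from \<open>r\<close> to
  \<open>s\<close>. The one-step discrepancy is averaged along a path of \<open>r\<close>, while
  regularity is asked only of the iterates of \<open>s\<close>; the choice of roles differs from one
  application to the next.\<close>

lemma duhamel:
  assumes P: "update_chain q n r" and Q: "update_chain q n s"
  shows "(upd_op q n r ^^ t) f \<sigma> - (upd_op q n s ^^ t) f \<sigma> =
    (\<Sum>j<t. (upd_op q n r ^^ j)
      (\<lambda>\<sigma>. upd_op q n r ((upd_op q n s ^^ (t - 1 - j)) f) \<sigma> - upd_op q n s ((upd_op q n s ^^ (t - 1 - j)) f) \<sigma>) \<sigma>)"
proof (induction t arbitrary: \<sigma>)
  case (Suc t)
  interpret P: update_chain q n r by fact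
  let ?P = "upd_op q n r" and ?Q = "upd_op q n s"
  let ?d = "\<lambda>i \<sigma>. ?P ((?Q ^^ i) f) \<sigma> - ?Q ((?Q ^^ i) f) \<sigma>"
  have "(?P ^^ Suc t) f \<sigma> - (?Q ^^ Suc t) f \<sigma> = ?P (\<lambda>\<sigma>. (?P ^^ t) f \<sigma> - (?Q ^^ t) f \<sigma>) \<sigma> + ?d t \<sigma>"
    by (simp add: P.P_diff)
  also have "(\<lambda>\<sigma>. (?P ^^ t) f \<sigma> - (?Q ^^ t) f \<sigma>) = (\<lambda>\<sigma>. \<Sum>j<t. (?P ^^ j) (?d (t - 1 - j)) \<sigma>)"
    using Suc by blast
  also have "?P (\<lambda>\<sigma>. \<Sum>j<t. (?P ^^ j) (?d (t - 1 - j)) \<sigma>) \<sigma> = (\<Sum>j<t. (?P ^^ Suc j) (?d (t - 1 - j)) \<sigma>)"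
  proof -
    have "?P (\<lambda>\<sigma>. \<Sum>j\<in>J. h j \<sigma>) \<sigma> = (\<Sum>j\<in>J. ?P (h j) \<sigma>)" if "finite J" for J and h :: "nat \<Rightarrow> (nat \<Rightarrow> nat) \<Rightarrow> real"
      using that by (induction J rule: finite_induct) (auto simp: P.P_add)
    then show ?thesis by simp
  qed
  also have "\<dots> + ?d t \<sigma> = (\<Sum>j<Suc t. (?P ^^ j) (?d (Suc t - 1 - j)) \<sigma>)"
    by (subst sum.lessThan_Suc_shift) simp
  finally show ?case .
qed simp

section \<open>Softmax estimates\<close>

lemma exp_diff_le: "exp x - exp y \<le> exp x * (x - y)" for x y :: real
proof -
  have "exp x * (1 + (y - x)) \<le> exp x * exp (y - x)" by (intro mult_left_mono exp_ge_add_one_self) auto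
  then show ?thesis by (simp add: algebra_simps flip: exp_add)
qed

text \<open>All mass leaves the single colour \<open>c\<close>, so subtracting \<open>G c\<close>
  gives the bound by transported mass times oscillation, without the factor 2 of a crude estimate by
  absolute values.\<close>

lemma sum_one_sign_le:
  fixes D G :: "nat \<Rightarrow> real"
  assumes fin: "finite I" and c: "c \<in> I" and D0: "(\<Sum>k\<in>I. D k) = 0"
    and D: "\<And>k. k \<in> I \<Longrightarrow> k \<noteq> c \<Longrightarrow> 0 \<le> D k"
    and G: "\<And>k. k \<in> I \<Longrightarrow> \<bar>G k - G c\<bar> \<le> B"
  shows "\<bar>\<Sum>k\<in>I. D k * G k\<bar> \<le> - D c * B"
proof -
  have split: "(\<Sum>k\<in>I. h k) = h c + (\<Sum>k\<in>I - {c}. h k)" for h :: "nat \<Rightarrow> real"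
    using fin c by (simp add: sum.remove)
  have "(\<Sum>k\<in>I. D k * G k) = (\<Sum>k\<in>I. D k * (G k - G c))"
    using D0 by (simp add: right_diff_distrib sum_subtractf flip: sum_distrib_right)
  also have "\<bar>\<dots>\<bar> \<le> (\<Sum>k\<in>I - {c}. \<bar>D k * (G k - G c)\<bar>)"
    unfolding split[of "\<lambda>k. D k * (G k - G c)"] by simp
  also have "\<dots> \<le> (\<Sum>k\<in>I - {c}. D k * B)"
    using D G by (intro sum_mono) (auto simp: abs_mult intro!: mult_mono)
  also have "\<dots> = - D c * B"
  proof -
    have "(\<Sum>k\<in>I - {c}. D k) = - D c" using D0 split[of D] by linarith
    then show ?thesis by (simp flip: sum_distrib_right)
  qed
  finally show ?thesis .
qed

definition softmax :: "nat \<Rightarrow> real \<Rightarrow> (nat \<Rightarrow> real) \<Rightarrow> nat \<Rightarrow> real" where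
  "softmax q b y k = exp (b * y k) / (\<Sum>j=1..q. exp (b * y j))"

context
  fixes q :: nat and b :: real
  assumes q: "1 \<le> q" and b: "0 \<le> b"
begin

lemma softmax_denom_pos: "0 < (\<Sum>j=1..q. exp (b * y j))"
  using q by (intro sum_pos) auto

lemma softmax_nonneg: "0 \<le> softmax q b y k"
  unfolding softmax_def using softmax_denom_pos[of y] by simp

lemma softmax_sum: "(\<Sum>k=1..q. softmax q b y k) = 1"
  unfolding softmax_def sum_divide_distrib[symmetric] using softmax_denom_pos[of y] by simp

lemma softmax_le:
  assumes "\<And>j. j \<in> {1..q} \<Longrightarrow> \<bar>y j\<bar> \<le> s" "k \<in> {1..q}"
  shows "softmax q b y k \<le> exp (2 * b * s) / q"
proof -
  have "exp (b * y k) \<le> exp (b * s)" using assms b by (force intro: mult_left_mono simp: abs_le_iff)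
  moreover have "real q * exp (- b * s) \<le> (\<Sum>j=1..q. exp (b * y j))"
  proof -
    have "- b * s \<le> b * y j" if "j \<in> {1..q}" for j
      using mult_left_mono[of "- s" "y j" b] assms(1)[OF that] b by (simp add: abs_le_iff)
    then show ?thesis using sum_mono[of "{1..q}" "\<lambda>_. exp (- b * s)" "\<lambda>j. exp (b * y j)"] by simp
  qed
  ultimately have "softmax q b y k \<le> exp (b * s) / (real q * exp (- b * s))"
    unfolding softmax_def using q by (intro frac_le) auto
  also have "\<dots> = exp (2 * b * s) / q" by (simp add: exp_minus field_simps flip: exp_add)
  finally show ?thesis .
qed

lemma softmax_ge:
  assumes "\<And>j. j \<in> {1..q} \<Longrightarrow> \<bar>y j\<bar> \<le> s" "k \<in> {1..q}"
  shows "exp (- 2 * b * s) / q \<le> softmax q b y k"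
proof -
  have "- b * s \<le> b * y k"
    using mult_left_mono[of "- s" "y k" b] assms(1)[OF assms(2)] b by (simp add: abs_le_iff)
  then have "exp (- b * s) \<le> exp (b * y k)" by simp
  moreover have "(\<Sum>j=1..q. exp (b * y j)) \<le> real q * exp (b * s)"
  proof -
    have "b * y j \<le> b * s" if "j \<in> {1..q}" for j
      using assms(1)[OF that] b by (intro mult_left_mono) (auto simp: abs_le_iff)
    then show ?thesis using sum_mono[of "{1..q}" "\<lambda>j. exp (b * y j)" "\<lambda>_. exp (b * s)"] by simp
  qed
  ultimately have "exp (- b * s) / (real q * exp (b * s)) \<le> softmax q b y k"
    unfolding softmax_def using softmax_denom_pos[of y] by (intro frac_le) auto
  also have "exp (- b * s) / (real q * exp (b * s)) = exp (- 2 * b * s) / q"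
    by (simp add: exp_minus field_simps flip: exp_add)
  finally show ?thesis .
qed

lemma softmax_uniform_diff:
  assumes "\<And>j. j \<in> {1..q} \<Longrightarrow> \<bar>y j\<bar> \<le> s" "k \<in> {1..q}"
  shows "\<bar>softmax q b y k - 1 / q\<bar> \<le> (exp (2 * b * s) - 1) / q"
proof -
  have "2 \<le> exp (2 * b * s) + exp (- 2 * b * s)"
  proof -
    have "0 \<le> (exp (b * s) - exp (- b * s))\<^sup>2" by simp
    also have "\<dots> = exp (2 * b * s) + exp (- 2 * b * s) - 2"
      by (simp add: power2_eq_square algebra_simps flip: exp_add)
    finally show ?thesis by simp
  qed
  then have "1 - exp (- 2 * b * s) \<le> exp (2 * b * s) - 1" by simp
  then have "(1 - exp (- 2 * b * s)) / q \<le> (exp (2 * b * s) - 1) / q"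
    by (intro divide_right_mono) auto
  then show ?thesis
    using softmax_le[of y s k, OF assms] softmax_ge[of y s k, OF assms]
    by (simp add: abs_le_iff diff_divide_distrib)
qed

lemma softmax_pair_diff:
  assumes s: "\<And>j. j \<in> {1..q} \<Longrightarrow> \<bar>y j\<bar> \<le> s" and kl: "k \<in> {1..q}" "l \<in> {1..q}"
  shows "\<bar>softmax q b y k - softmax q b y l\<bar> \<le> exp (2 * b * s) / q * b * \<bar>y k - y l\<bar>"
proof -
  have "softmax q b y k - softmax q b y l \<le> exp (2 * b * s) / q * b * \<bar>y k - y l\<bar>"
    if kl: "k \<in> {1..q}" "l \<in> {1..q}" for k l
  proof -
    have "softmax q b y k - softmax q b y l \<le> softmax q b y k * (b * (y k - y l))"
      using exp_diff_le[of "b * y k" "b * y l"] softmax_denom_pos[of y]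
      by (simp add: softmax_def algebra_simps divide_right_mono flip: diff_divide_distrib)
    also have "\<dots> \<le> softmax q b y k * (b * \<bar>y k - y l\<bar>)"
      using b softmax_nonneg by (intro mult_left_mono) auto
    also have "\<dots> \<le> exp (2 * b * s) / q * (b * \<bar>y k - y l\<bar>)"
      using b softmax_le[OF s kl(1)] by (intro mult_right_mono) auto
    finally show ?thesis by (simp add: mult.assoc)
  qed
  from this[OF kl] this[OF kl(2) kl(1)] show ?thesis by (auto simp: abs_le_iff abs_minus_commute)
qed

text \<open>Raising coordinate \<open>a\<close> and lowering coordinate \<open>c\<close>: if the normalisation grows, then \<open>a\<close> is
  the only colour gaining mass, otherwise \<open>c\<close> is the only one losing it.\<close>

lemma softmax_perturb:
  assumes s: "\<And>j. j \<in> {1..q} \<Longrightarrow> \<bar>y j\<bar> \<le> s" "\<And>j. j \<in> {1..q} \<Longrightarrow> \<bar>y' j\<bar> \<le> s"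
    and ac: "a \<in> {1..q}" "c \<in> {1..q}"
    and eq: "\<And>j. j \<in> {1..q} \<Longrightarrow> j \<noteq> a \<Longrightarrow> j \<noteq> c \<Longrightarrow> y' j = y j"
    and a: "y a \<le> y' a" "y' a \<le> y a + \<delta>" and c: "y' c \<le> y c" "y c \<le> y' c + \<delta>"
    and G: "\<And>k l. k \<in> {1..q} \<Longrightarrow> l \<in> {1..q} \<Longrightarrow> \<bar>G k - G l\<bar> \<le> B"
  shows "\<bar>\<Sum>k=1..q. (softmax q b y k - softmax q b y' k) * G k\<bar> \<le> exp (2 * b * s) / q * (exp (b * \<delta>) - 1) * B"
proof -
  have \<delta>0: "0 \<le> \<delta>" using a by simp
  have B0: "0 \<le> B" using G[OF ac(1) ac(1)] by simp
  have main: "\<bar>\<Sum>k=1..q. (softmax q b y k - softmax q b y' k) * G k\<bar> \<le> exp (2 * b * s) / q * (exp (b * \<delta>) - 1) * B"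
    if s: "\<And>j. j \<in> {1..q} \<Longrightarrow> \<bar>y j\<bar> \<le> s"
    and a: "a \<in> {1..q}" "y' a \<le> y a + \<delta>"
    and le: "\<And>j. j \<in> {1..q} \<Longrightarrow> j \<noteq> a \<Longrightarrow> y' j \<le> y j"
    and Z: "(\<Sum>j=1..q. exp (b * y j)) \<le> (\<Sum>j=1..q. exp (b * y' j))" for y y' :: "nat \<Rightarrow> real" and a
  proof -
    have "\<bar>\<Sum>k=1..q. (softmax q b y k - softmax q b y' k) * G k\<bar> \<le> - (softmax q b y a - softmax q b y' a) * B"
    proof (rule sum_one_sign_le)
      show "(\<Sum>k=1..q. softmax q b y k - softmax q b y' k) = 0" by (simp only: sum_subtractf softmax_sum diff_self)
      fix k assume "k \<in> {1..q}" "k \<noteq> a"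
      then have "exp (b * y' k) \<le> exp (b * y k)" using le b by (simp add: mult_left_mono)
      then show "0 \<le> softmax q b y k - softmax q b y' k"
        unfolding softmax_def using Z softmax_denom_pos[of y] by (simp add: frac_le)
    qed (use a G in auto)
    also have "\<dots> \<le> (exp (2 * b * s) / q * (exp (b * \<delta>) - 1)) * B"
    proof (rule mult_right_mono[OF _ B0])
      have "b * y' a \<le> b * (y a + \<delta>)" using a(2) b by (rule mult_left_mono)
      then have "exp (b * y' a) \<le> exp (b * y a) * exp (b * \<delta>)" by (simp add: algebra_simps flip: exp_add)
      then have "softmax q b y' a \<le> exp (b * y a) * exp (b * \<delta>) / (\<Sum>j=1..q. exp (b * y j))"
        unfolding softmax_def using Z softmax_denom_pos[of y] by (intro frac_le) auto
      then have "- (softmax q b y a - softmax q b y' a) \<le> softmax q b y a * (exp (b * \<delta>) - 1)"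
        by (simp add: softmax_def right_diff_distrib)
      also have "\<dots> \<le> exp (2 * b * s) / q * (exp (b * \<delta>) - 1)"
      proof (rule mult_right_mono)
        show "softmax q b y a \<le> exp (2 * b * s) / q" using softmax_le[OF s a(1)] by simp
        show "0 \<le> exp (b * \<delta>) - 1" using b \<delta>0 by simp
      qed
      finally show "- (softmax q b y a - softmax q b y' a) \<le> exp (2 * b * s) / q * (exp (b * \<delta>) - 1)" .
    qed
    finally show ?thesis .
  qed
  show ?thesis
  proof (cases "(\<Sum>j=1..q. exp (b * y j)) \<le> (\<Sum>j=1..q. exp (b * y' j))")
    case True
    have "y' j \<le> y j" if "j \<in> {1..q}" "j \<noteq> a" for j
      using eq[OF that] c by (cases "j = c") auto
    from main[of y a y', OF s(1) ac(1) a(2) this True] show ?thesis by simp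
  next
    case False
    have "y j \<le> y' j" if "j \<in> {1..q}" "j \<noteq> c" for j
      using eq[OF that(1)] that a by (cases "j = a") auto
    from main[of y' c y, OF s(2) ac(2) c(2) this] False
    have "\<bar>\<Sum>k=1..q. (softmax q b y' k - softmax q b y k) * G k\<bar> \<le> exp (2 * b * s) / q * (exp (b * \<delta>) - 1) * B"
      by simp
    moreover have "(\<Sum>k=1..q. (softmax q b y' k - softmax q b y k) * G k)
        = - (\<Sum>k=1..q. (softmax q b y k - softmax q b y' k) * G k)"
      by (simp add: algebra_simps flip: sum_negf)
    ultimately show ?thesis by simp
  qed
qed

end

section \<open>The clipped Glauber rule\<close>

text \<open>For \<open>\<beta>\<close> between the spinodal point and \<open>\<beta>\<^sub>c\<close> the Glauber dynamics contracts only near the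
  balanced configurations. Clipping the local fields at \<open>\<rho>\<close> makes the contraction global and
  changes nothing near balance.\<close>

definition local_dev :: "nat \<Rightarrow> nat \<Rightarrow> (nat \<Rightarrow> nat) \<Rightarrow> nat \<Rightarrow> nat \<Rightarrow> real" where
  "local_dev q n \<sigma> v k = real (card {w\<in>{1..n} - {v}. \<sigma> w = k}) / real n - 1 / real q"

definition clip :: "real \<Rightarrow> real \<Rightarrow> real" where
  "clip \<rho> x = max (- \<rho>) (min \<rho> x)"

text \<open>Used with \<open>b\<close> = 2\<beta>, since the sum over ordered pairs counts each pair
  twice. The centring of the fields by 1/q cancels in the softmax, but it makes 0 the balanced value
  about which clipping is symmetric.\<close>

definition glauber_rule :: "nat \<Rightarrow> real \<Rightarrow> nat \<Rightarrow> (nat \<Rightarrow> nat) \<Rightarrow> nat \<Rightarrow> nat \<Rightarrow> real" where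
  "glauber_rule q b n \<sigma> v = softmax q b (local_dev q n \<sigma> v)"

definition clipped_rule :: "nat \<Rightarrow> real \<Rightarrow> real \<Rightarrow> nat \<Rightarrow> (nat \<Rightarrow> nat) \<Rightarrow> nat \<Rightarrow> nat \<Rightarrow> real" where
  "clipped_rule q b \<rho> n \<sigma> v = softmax q b (\<lambda>k. clip \<rho> (local_dev q n \<sigma> v k))"

text \<open>The term 1/n rounds off the square root at 0 and keeps the imbalance above n^-1/2, so
  division by it is harmless and its tangent line exists everywhere.\<close>

definition imbalance :: "nat \<Rightarrow> nat \<Rightarrow> (nat \<Rightarrow> nat) \<Rightarrow> real" where
  "imbalance q n \<sigma> = sqrt (energy q n \<sigma> + 1 / real n)"

lemma color_count_split:
  assumes "v \<in> {1..n}"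
  shows "color_count n \<sigma> k = card {w\<in>{1..n} - {v}. \<sigma> w = k} + (if \<sigma> v = k then 1 else 0)"
proof (cases "\<sigma> v = k")
  case True
  then have "{w\<in>{1..n}. \<sigma> w = k} = insert v {w\<in>{1..n} - {v}. \<sigma> w = k}" using assms by auto
  then show ?thesis using True by (simp add: color_count_def)
next
  case False
  then have "{w\<in>{1..n}. \<sigma> w = k} = {w\<in>{1..n} - {v}. \<sigma> w = k}" by auto
  then show ?thesis using False by (simp add: color_count_def)
qed

lemma local_dev_upd_same: "local_dev q n (\<sigma>(v := a)) v = local_dev q n \<sigma> v"
proof -
  have "{w\<in>{1..n} - {v}. (\<sigma>(v := a)) w = k} = {w\<in>{1..n} - {v}. \<sigma> w = k}" for k by auto
  then show ?thesis by (simp add: local_dev_def fun_eq_iff)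
qed

lemma local_dev_eq:
  assumes "v \<in> {1..n}"
  shows "local_dev q n \<sigma> v k = color_dev q n \<sigma> k - (if \<sigma> v = k then 1 else 0) / real n"
  using color_count_split[OF assms, of \<sigma> k]
  by (simp add: local_dev_def color_dev_def add_divide_distrib)

lemma color_dev_upd:
  assumes "v \<in> {1..n}"
  shows "color_dev q n (\<sigma>(v := a)) k =
    color_dev q n \<sigma> k + ((if k = a then 1 else 0) - (if k = \<sigma> v then 1 else 0)) / real n"
  using local_dev_eq[OF assms, of q \<sigma> k] local_dev_eq[OF assms, of q "\<sigma>(v := a)" k]
  by (auto simp: local_dev_upd_same add_divide_distrib diff_divide_distrib)

lemma local_dev_upd:
  assumes "v \<in> {1..n}" "u \<in> {1..n}" "u \<noteq> v"
  shows "local_dev q n (\<sigma>(v := a)) u k =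
    local_dev q n \<sigma> u k + ((if k = a then 1 else 0) - (if k = \<sigma> v then 1 else 0)) / real n"
  using assms by (simp add: local_dev_eq color_dev_upd)

lemma energy_upd:
  assumes "v \<in> {1..n}" "\<sigma> v \<in> {1..q}" "a \<in> {1..q}"
  shows "energy q n (\<sigma>(v := a)) = energy q n \<sigma> + 2 / real n * (color_dev q n \<sigma> a - color_dev q n \<sigma> (\<sigma> v))
    + (if a = \<sigma> v then 0 else 2) / (real n)\<^sup>2"
proof -
  let ?z = "color_dev q n \<sigma>" and ?i = "\<lambda>a k. if k = a then 1 else 0 :: real"
  have "energy q n (\<sigma>(v := a)) = (\<Sum>k=1..q. (?z k)\<^sup>2 + 2 / real n * (?z k * ?i a k - ?z k * ?i (\<sigma> v) k)
      + (?i a k - ?i (\<sigma> v) k)\<^sup>2 / (real n)\<^sup>2)"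
    unfolding energy_def color_dev_upd[OF assms(1)] using assms(1)
    by (intro sum.cong refl) (simp add: power2_eq_square field_simps add_divide_distrib)
  also have "\<dots> = energy q n \<sigma> + 2 / real n * (?z a - ?z (\<sigma> v)) + (\<Sum>k=1..q. (?i a k - ?i (\<sigma> v) k)\<^sup>2) / (real n)\<^sup>2"
    unfolding sum.distrib sum_distrib_left[symmetric] sum_divide_distrib[symmetric] sum_subtractf energy_def
    using assms by (simp add: mult_delta_right)
  also have "(\<Sum>k=1..q. (?i a k - ?i (\<sigma> v) k)\<^sup>2) = (if a = \<sigma> v then 0 else 2)"
  proof (cases "a = \<sigma> v")
    case False
    then have "(\<Sum>k=1..q. (?i a k - ?i (\<sigma> v) k)\<^sup>2) = (\<Sum>k=1..q. ?i a k + ?i (\<sigma> v) k)"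
      by (intro sum.cong) auto
    then show ?thesis using False assms by (simp add: sum.distrib)
  qed simp
  finally show ?thesis .
qed

lemma abs_color_dev_le_1:
  assumes "1 \<le> q"
  shows "\<bar>color_dev q n \<sigma> k\<bar> \<le> 1"
proof -
  have "color_count n \<sigma> k \<le> n"
    unfolding color_count_def using card_mono[of "{1..n}" "{v\<in>{1..n}. \<sigma> v = k}"] by (simp add: subset_iff)
  then have "real (color_count n \<sigma> k) / real n \<le> 1" by (cases "n = 0") auto
  moreover have "0 \<le> real (color_count n \<sigma> k) / real n" "0 \<le> 1 / real q" "1 / real q \<le> 1" using assms by auto
  ultimately show ?thesis unfolding color_dev_def by linarith
qed

lemma color_dev_range:
  "0 \<le> color_dev q n \<sigma> k + 1 / real q" "color_dev q n \<sigma> k + 1 / real q \<le> 1"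
proof -
  have "color_count n \<sigma> k \<le> n"
    unfolding color_count_def using card_mono[of "{1..n}" "{v\<in>{1..n}. \<sigma> v = k}"] by (simp add: subset_iff)
  then show "0 \<le> color_dev q n \<sigma> k + 1 / real q" "color_dev q n \<sigma> k + 1 / real q \<le> 1"
    by (cases "n = 0"; simp add: color_dev_def)+
qed

lemma color_dev_sq_le_energy: "k \<in> {1..q} \<Longrightarrow> (color_dev q n \<sigma> k)\<^sup>2 \<le> energy q n \<sigma>"
  unfolding energy_def by (rule member_le_sum) auto

lemma energy_le: "1 \<le> q \<Longrightarrow> energy q n \<sigma> \<le> real q"
proof -
  assume "1 \<le> q"
  then have "(color_dev q n \<sigma> k)\<^sup>2 \<le> 1" for k
    using power_mono[OF abs_color_dev_le_1, of q n \<sigma> k 2] by simp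
  then have "energy q n \<sigma> \<le> (\<Sum>k=1..q. 1)" unfolding energy_def by (intro sum_mono)
  then show ?thesis by simp
qed

lemma clip_mono: "x \<le> y \<Longrightarrow> clip \<rho> x \<le> clip \<rho> y"
  and clip_lip: "x \<le> y \<Longrightarrow> 0 \<le> \<rho> \<Longrightarrow> clip \<rho> y \<le> clip \<rho> x + (y - x)"
  and clip_bound: "0 \<le> \<rho> \<Longrightarrow> \<bar>clip \<rho> x\<bar> \<le> min \<rho> \<bar>x\<bar>"
  and clip_id: "\<bar>x\<bar> \<le> \<rho> \<Longrightarrow> clip \<rho> x = x"
  by (auto simp: clip_def max_def min_def)

lemma clip_dist: "0 \<le> \<rho> \<Longrightarrow> \<bar>clip \<rho> x - clip \<rho> y\<bar> \<le> \<bar>x - y\<bar>"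
  by (auto simp: clip_def max_def min_def)

lemma exp_minus_one_le: "exp x - 1 \<le> x * exp x" for x :: real
  using exp_diff_le[of x 0] by (simp add: mult.commute)

text \<open>The last assumption says \<open>C1 * \<rho>\<close> \<le> \<kappa>/4: inside the
  clipping range the nonlinearity of the softmax costs at most a quarter of the linear rate.\<close>

locale clipped_potts =
  fixes q n :: nat and b \<rho> :: real
  assumes q: "1 \<le> q" and n: "1 \<le> n" and b: "0 \<le> b" "b < real q"
    and \<rho>: "0 < \<rho>" "\<rho> \<le> 1" "2 * b * exp (2 * b) * \<rho> \<le> (1 - b / real q) / 4"
begin

definition \<kappa> where "\<kappa> = 1 - b / real q"
definition C1 where "C1 = 2 * b * exp (2 * b)"

abbreviation r where "r \<equiv> clipped_rule q b \<rho> n"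
abbreviation W where "W \<equiv> energy q n"
abbreviation \<phi> where "\<phi> \<equiv> imbalance q n"
abbreviation z where "z \<equiv> color_dev q n"

lemma \<kappa>_pos: "0 < \<kappa>" and \<kappa>_le: "\<kappa> \<le> 1"
  using b q by (auto simp: \<kappa>_def field_simps)

lemma C1_nonneg: "0 \<le> C1" using b by (simp add: C1_def)

lemma C1_\<rho>: "C1 * \<rho> \<le> \<kappa> / 4" using \<rho> by (simp add: C1_def \<kappa>_def)

sublocale update_chain q n r
  by unfold_locales (use q n b softmax_nonneg softmax_sum in \<open>auto simp: clipped_rule_def\<close>)

lemma exp_2b_le: "0 \<le> s \<Longrightarrow> s \<le> 1 \<Longrightarrow> exp (2 * b * s) \<le> 1 + C1 * s"
proof -
  assume s: "0 \<le> s" "s \<le> 1"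
  have "exp (2 * b * s) - 1 \<le> 2 * b * s * exp (2 * b * s)" by (rule exp_minus_one_le)
  also have "\<dots> \<le> 2 * b * s * exp (2 * b)"
    using b s by (intro mult_left_mono) (auto simp: mult_left_le)
  finally show ?thesis by (simp add: C1_def mult_ac)
qed

text \<open>The left-hand side is the constant of \<open>softmax_pair_diff\<close> at clipped
  fields. The remaining 3/4 \<kappa> becomes the decay rate of the imbalance.\<close>

lemma pmax_drift: "exp (2 * b * \<rho>) / q * b \<le> 1 - 3 / 4 * \<kappa>"
proof -
  have "exp (2 * b * \<rho>) / q * b = b / q * exp (2 * b * \<rho>)" by simp
  also have "\<dots> \<le> b / q * (1 + \<kappa> / 4)"
    using exp_2b_le[of \<rho>] \<rho> C1_\<rho> b by (intro mult_left_mono) auto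
  also have "\<dots> = b / q + b / q * (\<kappa> / 4)" by (simp add: algebra_simps)
  also have "\<dots> \<le> b / q + 1 * (\<kappa> / 4)"
    using b q \<kappa>_pos by (intro add_left_mono mult_right_mono) auto
  also have "\<dots> = 1 - 3 / 4 * \<kappa>"
  proof -
    have "b / q = 1 - \<kappa>" by (simp add: \<kappa>_def)
    then show ?thesis by simp
  qed
  finally show ?thesis .
qed

lemma \<phi>_sq: "(\<phi> \<sigma>)\<^sup>2 = W \<sigma> + 1 / n"
  using energy_nonneg[of q n \<sigma>] by (simp add: imbalance_def)

lemma \<phi>_ge: "1 / sqrt n \<le> \<phi> \<sigma>"
proof -
  have "sqrt (1 / n) \<le> \<phi> \<sigma>" unfolding imbalance_def using energy_nonneg by simp
  then show ?thesis by (simp add: real_sqrt_divide)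
qed

lemma \<phi>_pos: "0 < \<phi> \<sigma>"
  using \<phi>_ge[of \<sigma>] n less_le_trans[of 0 "1 / sqrt n"] by auto

lemma \<phi>_inverse_le: "1 / \<phi> \<sigma> \<le> sqrt n"
  using \<phi>_ge[of \<sigma>] \<phi>_pos[of \<sigma>] n by (simp add: field_simps)

lemma abs_z_le_\<phi>: "k \<in> {1..q} \<Longrightarrow> \<bar>z \<sigma> k\<bar> \<le> \<phi> \<sigma>"
  using color_dev_sq_le_energy[of k q n \<sigma>] \<phi>_sq[of \<sigma>] \<phi>_pos[of \<sigma>]
  by (intro abs_le_square_iff[THEN iffD2, of _ "\<phi> \<sigma>", simplified abs_of_pos[OF \<phi>_pos]]) (auto intro: order_trans)

lemma \<phi>_le: "\<phi> \<sigma> \<le> real q + 1"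
proof -
  have "(\<phi> \<sigma>)\<^sup>2 \<le> real q + 1" unfolding \<phi>_sq using energy_le[OF q, of n \<sigma>] n by (intro add_mono) auto
  also have "\<dots> \<le> (real q + 1)\<^sup>2" by (simp add: power2_eq_square)
  finally show ?thesis by (intro power2_le_imp_le[of "\<phi> \<sigma>"]) auto
qed

text \<open>As the deviations sum to zero, their mean under the rule is a double sum of products of
  differences, to which the pairwise Lipschitz bound of the softmax applies term by term. The error
  q/n comes from leaving the spin at \<open>v\<close> out of its own field.\<close>

lemma rule_mean_dev_le:
  assumes \<sigma>: "\<sigma> \<in> configs q n" and v: "v \<in> {1..n}"
  shows "(\<Sum>k=1..q. r \<sigma> v k * z \<sigma> k) \<le> (1 - 3 / 4 * \<kappa>) * W \<sigma> + q / n"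
proof -
  define lam where "lam = exp (2 * b * \<rho>) / q * b"
  have lam: "0 \<le> lam" "lam \<le> 1 - 3 / 4 * \<kappa>" using pmax_drift b by (auto simp: lam_def)
  then have lam1: "lam \<le> 1" using \<kappa>_pos by simp
  let ?p = "r \<sigma> v" and ?z = "z \<sigma>"
  have z0: "(\<Sum>k=1..q. ?z k) = 0" by (rule sum_color_dev[OF \<sigma> n q])
  have pair: "(\<Sum>k=1..q. \<Sum>l=1..q. (f k - f l) * (?z k - ?z l)) = 2 * q * (\<Sum>k=1..q. f k * ?z k)" for f :: "nat \<Rightarrow> real"
  proof -
    have "(\<Sum>k=1..q. \<Sum>l=1..q. (f k - f l) * (?z k - ?z l))
      = (\<Sum>k=1..q. \<Sum>l=1..q. f k * ?z k - f k * ?z l - f l * ?z k + f l * ?z l)"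
      by (simp add: algebra_simps)
    also have "\<dots> = 2 * q * (\<Sum>k=1..q. f k * ?z k)"
      by (simp add: sum.distrib sum_subtractf z0[simplified] flip: sum_distrib_left sum_distrib_right)
    finally show ?thesis .
  qed
  have "2 * q * (\<Sum>k=1..q. ?p k * ?z k) = (\<Sum>k=1..q. \<Sum>l=1..q. (?p k - ?p l) * (?z k - ?z l))"
    by (rule pair[symmetric])
  also have "\<dots> \<le> (\<Sum>k=1..q. \<Sum>l=1..q. lam * ((?z k - ?z l) * (?z k - ?z l)) + 1 / n)"
  proof (intro sum_mono)
    fix k l assume kl: "k \<in> {1..q}" "l \<in> {1..q}"
    let ?x = "local_dev q n \<sigma> v"
    have "\<bar>?p k - ?p l\<bar> \<le> lam * \<bar>clip \<rho> (?x k) - clip \<rho> (?x l)\<bar>"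
      unfolding clipped_rule_def lam_def using clip_bound[of \<rho>] \<rho> kl
      by (intro softmax_pair_diff q b) auto
    also have "\<dots> \<le> lam * (\<bar>?z k - ?z l\<bar> + 1 / n)"
    proof (rule mult_left_mono[OF _ lam(1)])
      have "\<bar>?x k - ?x l\<bar> \<le> \<bar>?z k - ?z l\<bar> + 1 / n"
      proof -
        have "0 \<le> 1 / real n" by simp
        then show ?thesis unfolding local_dev_eq[OF v]
          by (cases "\<sigma> v = k"; cases "\<sigma> v = l"; simp; linarith)
      qed
      then show "\<bar>clip \<rho> (?x k) - clip \<rho> (?x l)\<bar> \<le> \<bar>?z k - ?z l\<bar> + 1 / n"
        using clip_dist[of \<rho> "?x k" "?x l"] \<rho> by simp
    qed
    finally have p: "\<bar>?p k - ?p l\<bar> \<le> lam * (\<bar>?z k - ?z l\<bar> + 1 / n)" .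
    have z1: "\<bar>?z k - ?z l\<bar> \<le> 1"
      using color_dev_range[of q n \<sigma> k] color_dev_range[of q n \<sigma> l] by (simp add: abs_le_iff)
    have "(?p k - ?p l) * (?z k - ?z l) \<le> \<bar>?p k - ?p l\<bar> * \<bar>?z k - ?z l\<bar>"
      by (simp flip: abs_mult)
    also have "\<dots> \<le> lam * (\<bar>?z k - ?z l\<bar> + 1 / n) * \<bar>?z k - ?z l\<bar>"
      by (intro mult_right_mono p) auto
    also have "\<dots> = lam * ((?z k - ?z l) * (?z k - ?z l)) + lam * \<bar>?z k - ?z l\<bar> * (1 / n)"
      by (simp add: algebra_simps flip: abs_mult)
    also have "lam * \<bar>?z k - ?z l\<bar> * (1 / n) \<le> 1 * (1 / n)"
      using lam lam1 z1 by (intro mult_right_mono mult_le_one) auto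
    finally show "(?p k - ?p l) * (?z k - ?z l) \<le> lam * ((?z k - ?z l) * (?z k - ?z l)) + 1 / n" by simp
  qed
  also have "\<dots> = lam * (\<Sum>k=1..q. \<Sum>l=1..q. (?z k - ?z l) * (?z k - ?z l)) + q * q / n"
    by (simp add: sum.distrib sum_distrib_left)
  also have "\<dots> = 2 * q * (lam * W \<sigma> + q / (2 * n))"
    unfolding pair using q by (simp add: energy_def power2_eq_square algebra_simps)
  finally have "(\<Sum>k=1..q. ?p k * ?z k) \<le> lam * W \<sigma> + q / (2 * n)"
    using q by (subst (asm) mult_le_cancel_left_pos) auto
  also have "\<dots> \<le> (1 - 3 / 4 * \<kappa>) * W \<sigma> + q / n"
    using lam energy_nonneg[of q n \<sigma>] n by (intro add_mono mult_right_mono) (auto simp: field_simps)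
  finally show ?thesis .
qed

lemma P_energy_le:
  assumes \<sigma>: "\<sigma> \<in> configs q n"
  shows "P W \<sigma> \<le> (1 - 3 / 2 * \<kappa> / n) * W \<sigma> + (2 * q + 2) / (real n)\<^sup>2"
proof -
  have "P W \<sigma> = (\<Sum>v=1..n. \<Sum>k=1..q. r \<sigma> v k * W (\<sigma>(v := k))) / n"
    by (simp add: upd_op_def)
  also have "\<dots> \<le> (\<Sum>v=1..n. W \<sigma> + 2 / n * ((1 - 3 / 4 * \<kappa>) * W \<sigma> + q / n) - 2 / n * z \<sigma> (\<sigma> v) + 2 / (real n)\<^sup>2) / n"
  proof (intro divide_right_mono sum_mono)
    fix v assume v: "v \<in> {1..n}"
    have "(\<Sum>k=1..q. r \<sigma> v k * W (\<sigma>(v := k)))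
      \<le> (\<Sum>k=1..q. r \<sigma> v k * (W \<sigma> + 2 / n * (z \<sigma> k - z \<sigma> (\<sigma> v)) + 2 / (real n)\<^sup>2))"
      using configs_range[OF \<sigma> v] v
      by (intro sum_mono mult_left_mono rule_nonneg) (auto simp: energy_upd)
    also have "\<dots> = (\<Sum>k=1..q. (W \<sigma> - 2 / n * z \<sigma> (\<sigma> v) + 2 / (real n)\<^sup>2) * r \<sigma> v k + 2 / n * (r \<sigma> v k * z \<sigma> k))"
      by (intro sum.cong refl) (simp add: algebra_simps)
    also have "\<dots> = W \<sigma> - 2 / n * z \<sigma> (\<sigma> v) + 2 / (real n)\<^sup>2 + 2 / n * (\<Sum>k=1..q. r \<sigma> v k * z \<sigma> k)"
      by (simp only: sum.distrib sum_distrib_left[symmetric] rule_sum mult_1_right)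
    also have "\<dots> \<le> W \<sigma> - 2 / n * z \<sigma> (\<sigma> v) + 2 / (real n)\<^sup>2 + 2 / n * ((1 - 3 / 4 * \<kappa>) * W \<sigma> + q / n)"
      by (intro add_left_mono mult_left_mono rule_mean_dev_le[OF \<sigma> v]) auto
    finally show "(\<Sum>k=1..q. r \<sigma> v k * W (\<sigma>(v := k)))
      \<le> W \<sigma> + 2 / n * ((1 - 3 / 4 * \<kappa>) * W \<sigma> + q / n) - 2 / n * z \<sigma> (\<sigma> v) + 2 / (real n)\<^sup>2" by simp
  qed auto
  also have "\<dots> = W \<sigma> + 2 / n * ((1 - 3 / 4 * \<kappa>) * W \<sigma> + q / n) - 2 / n * W \<sigma> + 2 / (real n)\<^sup>2"
  proof -
    \<comment> \<open>The erased spin has colour k with probability \<open>z \<sigma> k\<close> +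
      1/q, and the part with 1/q averages to zero: erasure removes exactly
      \<open>W \<sigma>\<close>.\<close>
    have "(\<Sum>v=1..n. z \<sigma> (\<sigma> v)) = (\<Sum>k=1..q. n * (z \<sigma> k + 1 / q) * z \<sigma> k)"
      unfolding sum_by_color[OF \<sigma>] using n by (intro sum.cong refl) (simp add: color_dev_def)
    also have "\<dots> = n * W \<sigma> + n / q * (\<Sum>k=1..q. z \<sigma> k)"
      by (simp add: energy_def sum_distrib_left power2_eq_square algebra_simps sum.distrib)
    also have "\<dots> = n * W \<sigma>" using sum_color_dev[OF \<sigma> n q] by simp
    finally have "(\<Sum>v=1..n. 2 / n * z \<sigma> (\<sigma> v)) = 2 * W \<sigma>"
      unfolding sum_distrib_left[symmetric] using n by simp
    then show ?thesis
      unfolding sum.distrib sum_subtractf using n by (simp add: field_simps)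
  qed
  also have "\<dots> = (1 - 3 / 2 * \<kappa> / n) * W \<sigma> + (2 * q + 2) / (real n)\<^sup>2"
    using n by (simp add: field_simps power2_eq_square)
  finally show ?thesis .
qed

text \<open>Concavity of the square root, in a form that is affine in \<open>W \<tau>\<close>, so
  that the drift of the energy passes through the linear operator \<open>P\<close>.\<close>

lemma \<phi>_tangent: "\<phi> \<tau> \<le> \<phi> \<sigma> + (W \<tau> - W \<sigma>) / (2 * \<phi> \<sigma>)"
proof -
  have "0 \<le> (\<phi> \<tau> - \<phi> \<sigma>)\<^sup>2" by simp
  then have "2 * \<phi> \<sigma> * \<phi> \<tau> \<le> 2 * \<phi> \<sigma> * \<phi> \<sigma> + ((\<phi> \<tau>)\<^sup>2 - (\<phi> \<sigma>)\<^sup>2)" by (simp add: power2_eq_square algebra_simps)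
  then have "2 * \<phi> \<sigma> * \<phi> \<tau> \<le> 2 * \<phi> \<sigma> * (\<phi> \<sigma> + (W \<tau> - W \<sigma>) / (2 * \<phi> \<sigma>))"
    using \<phi>_pos[of \<sigma>] by (simp add: \<phi>_sq distrib_left)
  then show ?thesis using \<phi>_pos[of \<sigma>] by (subst (asm) mult_le_cancel_left_pos) auto
qed

text \<open>Dividing the energy drift by 2\<phi> halves its rate, and the n^-2 noise divided by
  \<phi> \<ge> n^-1/2 becomes n^-3/2.\<close>

lemma P_\<phi>_le:
  assumes \<sigma>: "\<sigma> \<in> configs q n"
  shows "P \<phi> \<sigma> \<le> (1 - 3 / 4 * \<kappa> / n) * \<phi> \<sigma> + (q + 2) / (n * sqrt n)"
proof -
  define f where "f = \<phi> \<sigma>"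
  have f: "0 < f" "1 / f \<le> sqrt n" using \<phi>_pos \<phi>_inverse_le by (auto simp: f_def)
  have "P \<phi> \<sigma> \<le> P (\<lambda>\<tau>. (f - W \<sigma> / (2 * f)) + 1 / (2 * f) * W \<tau>) \<sigma>"
  proof (rule P_mono[OF \<sigma>])
    fix \<tau>
    show "\<phi> \<tau> \<le> (f - W \<sigma> / (2 * f)) + 1 / (2 * f) * W \<tau>"
      using \<phi>_tangent[of \<tau> \<sigma>] by (simp add: f_def diff_divide_distrib)
  qed
  also have "\<dots> = f + (P W \<sigma> - W \<sigma>) / (2 * f)"
    unfolding P_add P_cmult P_const by (simp add: diff_divide_distrib)
  also have "\<dots> \<le> f + (((1 - 3 / 2 * \<kappa> / n) * W \<sigma> + (2 * q + 2) / (real n)\<^sup>2) - W \<sigma>) / (2 * f)"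
    using P_energy_le[OF \<sigma>] f by (intro add_left_mono divide_right_mono diff_right_mono) auto
  also have "W \<sigma> = f * f - 1 / n" using \<phi>_sq[of \<sigma>] by (simp add: f_def power2_eq_square)
  also have "f + (((1 - 3 / 2 * \<kappa> / n) * (f * f - 1 / n) + (2 * q + 2) / (real n)\<^sup>2) - (f * f - 1 / n)) / (2 * f)
      = (1 - 3 / 4 * \<kappa> / n) * f + (3 / 4 * \<kappa> + q + 1) / (real n)\<^sup>2 * (1 / f)"
    using n f by (simp add: field_simps power2_eq_square)
  also have "\<dots> \<le> (1 - 3 / 4 * \<kappa> / n) * f + (q + 2) / (real n)\<^sup>2 * sqrt n"
    using f \<kappa>_le \<kappa>_pos by (intro add_left_mono mult_mono divide_right_mono) auto
  also have "(q + 2) / (real n)\<^sup>2 * sqrt n = (q + 2) / (n * sqrt n)"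
    using n real_sqrt_mult_self[of "real n"] by (simp add: divide_simps power2_eq_square)
  finally show ?thesis by (simp add: f_def)
qed

lemma \<phi>_lip:
  assumes \<sigma>: "\<sigma> \<in> configs q n" and v: "v \<in> {1..n}" and k: "k \<in> {1..q}"
  shows "\<bar>\<phi> \<sigma> - \<phi> (\<sigma>(v := k))\<bar> \<le> 3 / n"
proof -
  have one: "\<phi> (\<sigma>(v := k)) - \<phi> \<sigma> \<le> 3 / n" if \<sigma>: "\<sigma> \<in> configs q n" and k: "k \<in> {1..q}" for \<sigma> k
  proof -
    note l = configs_range[OF \<sigma> v]
    have "W (\<sigma>(v := k)) - W \<sigma> \<le> 2 / n * (2 * \<phi> \<sigma>) + 2 / (real n)\<^sup>2"
    proof -
      have "z \<sigma> k - z \<sigma> (\<sigma> v) \<le> 2 * \<phi> \<sigma>"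
        using abs_z_le_\<phi>[OF k, of \<sigma>] abs_z_le_\<phi>[OF l, of \<sigma>] by (simp add: abs_le_iff)
      then have "2 / n * (z \<sigma> k - z \<sigma> (\<sigma> v)) \<le> 2 / n * (2 * \<phi> \<sigma>)" by (intro mult_left_mono) auto
      then show ?thesis using energy_upd[of v n \<sigma> q k, OF v l k] by auto
    qed
    then have "(W (\<sigma>(v := k)) - W \<sigma>) / (2 * \<phi> \<sigma>) \<le> (2 / n * (2 * \<phi> \<sigma>) + 2 / (real n)\<^sup>2) / (2 * \<phi> \<sigma>)"
      using \<phi>_pos[of \<sigma>] by (intro divide_right_mono) auto
    also have "\<dots> = 2 / n + 1 / (real n)\<^sup>2 * (1 / \<phi> \<sigma>)"
      using \<phi>_pos[of \<sigma>] by (simp add: add_divide_distrib)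
    also have "\<dots> \<le> 2 / n + 1 / (real n)\<^sup>2 * real n"
    proof -
      have "sqrt n \<le> n" using n by (simp add: real_le_lsqrt real_sqrt_le_iff sqrt_le_D real_sqrt_unique power2_eq_square)
      then show ?thesis using \<phi>_inverse_le[of \<sigma>] by (intro add_left_mono mult_left_mono) auto
    qed
    also have "\<dots> = 3 / n" using n by (simp add: power2_eq_square)
    finally show ?thesis using \<phi>_tangent[of "\<sigma>(v := k)" \<sigma>] by simp
  qed
  show ?thesis
    using one[OF \<sigma> k] one[OF configs_upd[OF \<sigma> v k] configs_range[OF \<sigma> v]] by (simp add: abs_le_iff)
qed

end

section \<open>Weighted contraction\<close>

context clipped_potts
begin

text \<open>The decrease of \<open>1 + K \<phi>\<close> along the drift compensates the loss of contraction, of relative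
  order \<open>\<phi>\<close>, away from balance. This yields the rate \<open>\<kappa> / n\<close> up to a summable error.\<close>

definition K where "K = 4 * C1 / \<kappa>"
definition wgt where "wgt \<sigma> = 1 + K * \<phi> \<sigma>"
definition E1 where "E1 = 2 * C1 + b * exp b * (1 + C1)"
text \<open>One summand for each error term of \<open>contraction_arith\<close>.\<close>

definition E where "E = K * real (q + 2) + 3 * K + 6 * K * (1 + C1) + E1 + 6 * K * E1"
definition rate where "rate = 1 - \<kappa> / n + E / (n * sqrt n)"

text \<open>A Lipschitz condition for a weighted Hamming path metric, stated on its edges; moves far
  from balance are allowed to count more.\<close>

definition lipw where
  "lipw g L \<longleftrightarrow> (\<forall>\<sigma>\<in>configs q n. \<forall>v\<in>{1..n}. \<forall>k\<in>{1..q}. \<bar>g \<sigma> - g (\<sigma>(v := k))\<bar> \<le> L * wgt \<sigma>)"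

lemma K_nonneg: "0 \<le> K" and E1_nonneg: "0 \<le> E1" and E_nonneg: "0 \<le> E"
proof -
  show K: "0 \<le> K" using C1_nonneg \<kappa>_pos by (simp add: K_def)
  show E1: "0 \<le> E1" using C1_nonneg b by (simp add: E1_def)
  show "0 \<le> E" using K E1 C1_nonneg by (simp add: E_def)
qed

lemma wgt_ge_1: "1 \<le> wgt \<sigma>"
  using K_nonneg \<phi>_pos[of \<sigma>] by (simp add: wgt_def)

lemma rate_nonneg: "0 \<le> rate"
proof -
  have "\<kappa> / n \<le> 1" using \<kappa>_le n by (simp add: divide_le_eq)
  moreover have "0 \<le> E / (n * sqrt n)" using E_nonneg by simp
  ultimately show ?thesis by (simp add: rate_def)
qed

lemma wgt_upd:
  assumes "\<sigma> \<in> configs q n" "v \<in> {1..n}" "k \<in> {1..q}"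
  shows "\<bar>wgt \<sigma> - wgt (\<sigma>(v := k))\<bar> \<le> 3 * K / n"
proof -
  have "\<bar>wgt \<sigma> - wgt (\<sigma>(v := k))\<bar> = K * \<bar>\<phi> \<sigma> - \<phi> (\<sigma>(v := k))\<bar>"
    using K_nonneg by (simp add: wgt_def abs_mult flip: right_diff_distrib)
  also have "\<dots> \<le> K * (3 / n)" using \<phi>_lip[OF assms] K_nonneg by (rule mult_left_mono)
  finally show ?thesis by (simp add: mult.commute)
qed

lemma P_wgt_le:
  assumes "\<sigma> \<in> configs q n"
  shows "P wgt \<sigma> \<le> wgt \<sigma> - K * (3 / 4 * \<kappa>) * \<phi> \<sigma> / n + K * (q + 2) / (n * sqrt n)"
proof -
  have "P wgt \<sigma> = 1 + K * P \<phi> \<sigma>"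
    unfolding wgt_def[abs_def] P_add P_cmult P_const ..
  also have "\<dots> \<le> 1 + K * ((1 - 3 / 4 * \<kappa> / n) * \<phi> \<sigma> + (q + 2) / (n * sqrt n))"
    using P_\<phi>_le[OF assms] K_nonneg by (intro add_left_mono mult_left_mono)
  finally show ?thesis by (simp add: wgt_def algebra_simps)
qed

text \<open>Recolouring \<open>v\<close> raises one field and lowers another by 1/n, which is the
  situation of \<open>softmax_perturb\<close>. Its factor is b/q at balance, grows by at most
  \<open>C1\<close> times the size of the fields, and leaves second-order terms in 1/n that go into
  \<open>E1\<close>.\<close>

lemma rule_perturb:
  assumes \<sigma>: "\<sigma> \<in> configs q n" and v: "v \<in> {1..n}" and u: "u \<in> {1..n}" "u \<noteq> v" and a: "a \<in> {1..q}"
    and G: "\<And>k l. k \<in> {1..q} \<Longrightarrow> l \<in> {1..q} \<Longrightarrow> \<bar>G k - G l\<bar> \<le> B"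
  shows "\<bar>\<Sum>k=1..q. (r \<sigma> u k - r (\<sigma>(v := a)) u k) * G k\<bar> \<le> (b / q + C1 * min \<rho> (\<phi> \<sigma>) + E1 / n) / n * B"
proof (cases "\<sigma> v = a")
  case True
  then have "\<sigma>(v := a) = \<sigma>" by auto
  moreover have "0 \<le> B" using G[OF a a] by simp
  moreover have "0 \<le> b / q + C1 * min \<rho> (\<phi> \<sigma>) + E1 / n"
    using b \<rho> C1_nonneg E1_nonneg \<phi>_pos[of \<sigma>] by simp
  ultimately show ?thesis by simp
next
  case False
  \<comment> \<open>One 1/n accounts for the spin at \<open>u\<close> missing from its own field,
    the other for the change at \<open>v\<close>.\<close>
  define s where "s = min \<rho> (\<phi> \<sigma> + 2 / n)"
  let ?x = "local_dev q n \<sigma> u" and ?x' = "local_dev q n (\<sigma>(v := a)) u"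
  have s: "0 \<le> s" "s \<le> 1" using \<rho> \<phi>_pos[of \<sigma>] by (auto simp: s_def)
  have x': "?x' k = ?x k + ((if k = a then 1 else 0) - (if k = \<sigma> v then 1 else 0)) / real n" for k
    by (rule local_dev_upd) (use u v in auto)
  have inv: "0 \<le> 1 / real n" by simp
  have x_bd: "\<bar>?x k\<bar> \<le> \<phi> \<sigma> + 1 / n" if "k \<in> {1..q}" for k
    using abs_z_le_\<phi>[OF that, of \<sigma>] inv unfolding local_dev_eq[OF u(1)]
    by (cases "\<sigma> u = k"; simp; linarith)
  have x'_bd: "\<bar>?x' k\<bar> \<le> \<phi> \<sigma> + 2 / n" if "k \<in> {1..q}" for k
  proof -
    have "\<bar>?x' k\<bar> \<le> \<bar>?x k\<bar> + 1 / n"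
      unfolding x' using inv by (cases "k = a"; cases "k = \<sigma> v"; simp; linarith)
    then show ?thesis using x_bd[OF that] by (simp add: field_simps)
  qed
  have clip_s: "\<bar>clip \<rho> t\<bar> \<le> s" if "\<bar>t\<bar> \<le> \<phi> \<sigma> + 2 / n" for t
    using clip_bound[of \<rho> t] \<rho> that by (auto simp: s_def)
  have le2: "\<phi> \<sigma> + 1 / n \<le> \<phi> \<sigma> + 2 / n" by (simp add: divide_right_mono)
  have "\<bar>\<Sum>k=1..q. (softmax q b (\<lambda>k. clip \<rho> (?x k)) k - softmax q b (\<lambda>k. clip \<rho> (?x' k)) k) * G k\<bar>
      \<le> exp (2 * b * s) / q * (exp (b * (1 / n)) - 1) * B"
  proof (rule softmax_perturb[where a = a and c = "\<sigma> v"])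
    show "\<bar>clip \<rho> (?x j)\<bar> \<le> s" if "j \<in> {1..q}" for j
      using x_bd[OF that] le2 by (intro clip_s) linarith
    show "\<bar>clip \<rho> (?x' j)\<bar> \<le> s" if "j \<in> {1..q}" for j
      using x'_bd[OF that] by (rule clip_s)
    show "\<sigma> v \<in> {1..q}" by (rule configs_range[OF \<sigma> v])
    show "clip \<rho> (?x' j) = clip \<rho> (?x j)" if "j \<noteq> a" "j \<noteq> \<sigma> v" for j
      using that by (simp add: x')
    show "clip \<rho> (?x a) \<le> clip \<rho> (?x' a)" using False by (intro clip_mono) (simp add: x')
    show "clip \<rho> (?x' a) \<le> clip \<rho> (?x a) + 1 / n"
      using clip_lip[of "?x a" "?x' a" \<rho>] False \<rho> by (simp add: x')
    show "clip \<rho> (?x' (\<sigma> v)) \<le> clip \<rho> (?x (\<sigma> v))" using False by (intro clip_mono) (simp add: x')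
    show "clip \<rho> (?x (\<sigma> v)) \<le> clip \<rho> (?x' (\<sigma> v)) + 1 / n"
      using clip_lip[of "?x' (\<sigma> v)" "?x (\<sigma> v)" \<rho>] False \<rho> by (simp add: x')
  qed (use q b a G in auto)
  also have "\<dots> \<le> (b / q + C1 * min \<rho> (\<phi> \<sigma>) + E1 / n) / n * B"
  proof (rule mult_right_mono)
    show "0 \<le> B" using G[OF a a] by simp
    define t where "t = b / n"
    have t: "0 \<le> t" "t \<le> b" using b n mult_left_mono[of 1 "real n" b] by (auto simp: t_def divide_le_eq)
    have bq: "b / q \<le> 1" using b q by simp
    have "exp t - 1 \<le> t * exp t" by (rule exp_minus_one_le)
    also have "\<dots> \<le> t * (1 + t * exp b)"
    proof (rule mult_left_mono[OF _ t(1)])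
      have "t * exp t \<le> t * exp b" using t by (intro mult_left_mono) auto
      then show "exp t \<le> 1 + t * exp b" using exp_minus_one_le[of t] by simp
    qed
    finally have e: "exp t - 1 \<le> t * (1 + t * exp b)" .
    have "exp (2 * b * s) / q * (exp t - 1) \<le> (1 + C1 * s) / q * (t * (1 + t * exp b))"
      using e exp_2b_le[OF s] t C1_nonneg s by (intro mult_mono divide_right_mono) auto
    also have "\<dots> = (b / q * (1 + C1 * s) + b / q * ((1 + C1 * s) * (b * exp b)) / n) / n"
      using n q by (simp add: t_def field_simps)
    also have "\<dots> \<le> (b / q + C1 * min \<rho> (\<phi> \<sigma>) + E1 / n) / n"
    proof (rule divide_right_mono)
      have "b / q * (C1 * s) \<le> 1 * (C1 * (min \<rho> (\<phi> \<sigma>) + 2 / n))"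
      proof (rule mult_mono[OF bq])
        have "0 \<le> 2 / real n" by simp
        then have "s \<le> min \<rho> (\<phi> \<sigma>) + 2 / n"
          unfolding s_def by (cases "\<rho> \<le> \<phi> \<sigma>"; cases "\<rho> \<le> \<phi> \<sigma> + 2 / n"; simp only: min_def if_True if_False; linarith)
        then show "C1 * s \<le> C1 * (min \<rho> (\<phi> \<sigma>) + 2 / n)" using C1_nonneg by (rule mult_left_mono)
      qed (use C1_nonneg s in auto)
      moreover have "b / q * ((1 + C1 * s) * (b * exp b)) / n \<le> 1 * ((1 + C1) * (b * exp b)) / n"
        using bq b C1_nonneg s by (intro divide_right_mono mult_mono add_left_mono mult_left_le) auto
      moreover have "E1 / n = C1 * (2 / n) + 1 * ((1 + C1) * (b * exp b)) / n"
        by (simp add: E1_def algebra_simps add_divide_distrib)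
      ultimately show "b / q * (1 + C1 * s) + b / q * ((1 + C1 * s) * (b * exp b)) / n \<le> b / q + C1 * min \<rho> (\<phi> \<sigma>) + E1 / n"
        by (simp add: algebra_simps)
    qed simp
    finally show "exp (2 * b * s) / q * (exp (b * (1 / n)) - 1) \<le> (b / q + C1 * min \<rho> (\<phi> \<sigma>) + E1 / n) / n"
      by (simp add: t_def)
  qed
  finally show ?thesis by (simp add: clipped_rule_def)
qed

text \<open>The bookkeeping of the path argument. With h = n^-1/2 every error is a constant times h
  w, and only the balance between the drift of the weight and the excess \<open>C1 * m * w\<close>
  needs the choice of \<open>K\<close>.\<close>

lemma contraction_arith:
  assumes m: "m = min \<rho> f" and f: "0 \<le> f" and w_def: "w = 1 + K * f"
  shows "n * (w - K * (3 / 4 * \<kappa>) * f / n + K * (q + 2) / (n * sqrt n)) - w + 3 * K / n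
      + (b / q + C1 * m + E1 / n) * (w + 6 * K / n) \<le> n * (rate * w)"
proof -
  define h where "h = 1 / sqrt n"
  have h: "0 \<le> h" "h \<le> 1" using n by (auto simp: h_def)
  have h2: "1 / n = h * h" using n by (simp add: h_def)
  have nh: "1 / n \<le> h" unfolding h2 using h by (simp add: mult_left_le)
  have m': "0 \<le> m" "m \<le> \<rho>" "m \<le> f" "m \<le> 1" using m f \<rho> by auto
  have w: "1 \<le> w" using K_nonneg f by (simp add: w_def)
  have hw: "h * 1 \<le> h * w" using w h(1) by (rule mult_left_mono)
  have n_hw: "1 / n \<le> h * w" using nh hw by simp
  define D where "D = K * (3 / 4 * \<kappa>) * f"
  \<comment> \<open>By the choice of \<open>K\<close> the drift \<open>D\<close> equals 3 C1 f. The
    excess is at most C1 f + (\<kappa>/4) K f = 2 C1 f, the second term because clipping keeps C1 m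
    below \<kappa>/4.\<close>
  have drift: "C1 * m * w \<le> D"
  proof -
    have K\<kappa>: "K * \<kappa> = 4 * C1" using \<kappa>_pos by (simp add: K_def)
    have "C1 * m * (K * f) \<le> \<kappa> / 4 * (K * f)"
    proof (rule mult_right_mono)
      have "C1 * m \<le> C1 * \<rho>" using m' C1_nonneg by (intro mult_left_mono) auto
      then show "C1 * m \<le> \<kappa> / 4" using C1_\<rho> by simp
    qed (use K_nonneg f in auto)
    also have "\<kappa> / 4 * (K * f) = (K * \<kappa>) / 4 * f" by simp
    also have "\<dots> = C1 * f" unfolding K\<kappa> by simp
    finally have 1: "C1 * m * (K * f) \<le> C1 * f" .
    have 2: "C1 * m \<le> C1 * f" using m' C1_nonneg by (intro mult_left_mono) auto
    have "D = 3 / 4 * (K * \<kappa>) * f" by (simp add: D_def)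
    also have "\<dots> = 3 * (C1 * f)" unfolding K\<kappa> by simp
    finally have 3: "D = 3 * (C1 * f)" .
    have 4: "0 \<le> C1 * f" using C1_nonneg f by simp
    have "C1 * m * w = C1 * m + C1 * m * (K * f)" by (simp add: w_def distrib_left)
    then show ?thesis using 1 2 3 4 by linarith
  qed
  have F2: "(b / q + C1 * m) * (6 * K / n) \<le> 6 * K * (1 + C1) * (h * w)"
  proof -
    have "b / q + C1 * m \<le> 1 + C1"
      using b q m' C1_nonneg by (intro add_mono mult_left_le) auto
    then have "(b / q + C1 * m) * (6 * K * (1 / n)) \<le> (1 + C1) * (6 * K * (h * w))"
      using n_hw C1_nonneg K_nonneg by (intro mult_mono mult_left_mono) auto
    then show ?thesis by (simp add: mult_ac)
  qed
  have F3: "E1 / n * w \<le> E1 * (h * w)"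
  proof -
    have "E1 * ((1 / n) * w) \<le> E1 * (h * w)"
      using nh w E1_nonneg by (intro mult_right_mono mult_left_mono) auto
    then show ?thesis by simp
  qed
  have F4: "E1 / n * (6 * K / n) \<le> 6 * K * E1 * (h * w)"
  proof -
    have "(1 / n) * (1 / n) \<le> (h * w) * 1" using n_hw n h w by (intro mult_mono) auto
    then have "6 * K * E1 * ((1 / n) * (1 / n)) \<le> 6 * K * E1 * (h * w)"
      using K_nonneg E1_nonneg by (intro mult_left_mono) auto
    then show ?thesis by (simp add: mult_ac)
  qed
  have F5: "3 * K / n \<le> 3 * K * (h * w)"
    using mult_left_mono[OF n_hw, of "3 * K"] K_nonneg by simp
  have F6: "K * (q + 2) * h \<le> K * (q + 2) * (h * w)"
    using hw K_nonneg by (intro mult_left_mono) auto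
  have G: "n * (rate * w) = n * w - \<kappa> * w + E * (h * w)"
    using n by (simp add: rate_def h_def field_simps)
  have H: "n * (w - D / n + K * (q + 2) / (n * sqrt n)) = n * w - D + K * (q + 2) * h"
    using n by (simp add: h_def field_simps)
  have E: "E * (h * w) = K * (q + 2) * (h * w) + 3 * K * (h * w)
      + 6 * K * (1 + C1) * (h * w) + E1 * (h * w) + 6 * K * E1 * (h * w)"
    unfolding E_def by (simp only: distrib_right)
  have bq: "b / q * w = w - \<kappa> * w" by (simp add: \<kappa>_def left_diff_distrib)
  have X: "(b / q + C1 * m + E1 / n) * (w + 6 * K / n)
      = b / q * w + C1 * m * w + E1 / n * w + (b / q + C1 * m) * (6 * K / n) + E1 / n * (6 * K / n)"
    by (simp only: distrib_left distrib_right add.assoc add.commute add.left_commute)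
  show ?thesis
    unfolding X G D_def[symmetric] H E bq using drift F2 F3 F4 F5 F6 by linarith
qed

text \<open>Path coupling in dual form. When a site other than \<open>v\<close> is updated, the
  common part of the two colour laws keeps the discrepancy at \<open>v\<close>, weighted by the
  updated configuration, and the remaining mass pays the oscillation of \<open>g\<close> at the
  updated site. An update of \<open>v\<close> removes the discrepancy, which supplies the gain
  1/n.\<close>

theorem lipw_P:
  assumes g: "lipw g L" and L: "0 \<le> L"
  shows "lipw (P g) (rate * L)"
  unfolding lipw_def
proof (intro ballI)
  fix \<sigma> v a assume \<sigma>: "\<sigma> \<in> configs q n" and v: "v \<in> {1..n}" and a: "a \<in> {1..q}"
  let ?\<tau> = "\<sigma>(v := a)"
  let ?m = "min \<rho> (\<phi> \<sigma>)"
  define TV where "TV = (b / q + C1 * ?m + E1 / n) / n"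
  \<comment> \<open>The configurations involved are two recolourings away from
    \<open>\<sigma>\<close>, each changing the weight by at most 3K/n.\<close>
  define B where "B = L * (wgt \<sigma> + 6 * K / n)"
  define T where "T = (\<lambda>u. (\<Sum>k=1..q. r \<sigma> u k * g (\<sigma>(u := k))) - (\<Sum>k=1..q. r ?\<tau> u k * g (?\<tau>(u := k))))"
  have \<tau>: "?\<tau> \<in> configs q n" by (rule configs_upd[OF \<sigma> v a])
  have TV0: "0 \<le> TV" using b \<rho> C1_nonneg E1_nonneg \<phi>_pos[of \<sigma>] by (simp add: TV_def)
  have B0: "0 \<le> B" using L K_nonneg wgt_ge_1[of \<sigma>] by (simp add: B_def)
  \<comment> \<open>The rule at \<open>v\<close> does not see the spin at \<open>v\<close>, so after
    an update there both configurations have the same law.\<close>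
  have Tv: "T v = 0" by (simp add: T_def clipped_rule_def local_dev_upd_same)
  have Tu: "\<bar>T u\<bar> \<le> L * (\<Sum>k=1..q. r \<sigma> u k * wgt (\<sigma>(u := k))) + TV * B" if u: "u \<in> {1..n}" "u \<noteq> v" for u
  proof -
    have eq: "T u = (\<Sum>k=1..q. r \<sigma> u k * (g (\<sigma>(u := k)) - g (\<sigma>(u := k, v := a))))
        + (\<Sum>k=1..q. (r \<sigma> u k - r ?\<tau> u k) * g (?\<tau>(u := k)))"
      unfolding T_def sum_subtractf[symmetric] sum.distrib[symmetric] fun_upd_twist[OF u(2)]
      by (simp add: algebra_simps)
    have "\<bar>T u\<bar> \<le> \<bar>\<Sum>k=1..q. r \<sigma> u k * (g (\<sigma>(u := k)) - g (\<sigma>(u := k, v := a)))\<bar>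
        + \<bar>\<Sum>k=1..q. (r \<sigma> u k - r ?\<tau> u k) * g (?\<tau>(u := k))\<bar>"
      unfolding eq by (rule abs_triangle_ineq)
    also have "\<dots> \<le> L * (\<Sum>k=1..q. r \<sigma> u k * wgt (\<sigma>(u := k))) + TV * B"
    proof (rule add_mono)
      have "\<bar>\<Sum>k=1..q. r \<sigma> u k * (g (\<sigma>(u := k)) - g (\<sigma>(u := k, v := a)))\<bar>
        \<le> (\<Sum>k=1..q. \<bar>r \<sigma> u k * (g (\<sigma>(u := k)) - g (\<sigma>(u := k, v := a)))\<bar>)"
        by (rule sum_abs)
      also have "\<dots> \<le> (\<Sum>k=1..q. r \<sigma> u k * (L * wgt (\<sigma>(u := k))))"
      proof (rule sum_mono)
        fix k assume k: "k \<in> {1..q}"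
        have "\<bar>g (\<sigma>(u := k)) - g (\<sigma>(u := k, v := a))\<bar> \<le> L * wgt (\<sigma>(u := k))"
          using g configs_upd[OF \<sigma> u(1) k] v a unfolding lipw_def by blast
        then show "\<bar>r \<sigma> u k * (g (\<sigma>(u := k)) - g (\<sigma>(u := k, v := a)))\<bar> \<le> r \<sigma> u k * (L * wgt (\<sigma>(u := k)))"
          by (simp add: abs_mult rule_nonneg mult_left_mono)
      qed
      finally show "\<bar>\<Sum>k=1..q. r \<sigma> u k * (g (\<sigma>(u := k)) - g (\<sigma>(u := k, v := a)))\<bar>
        \<le> L * (\<Sum>k=1..q. r \<sigma> u k * wgt (\<sigma>(u := k)))" by (simp add: sum_distrib_left mult_ac)
      show "\<bar>\<Sum>k=1..q. (r \<sigma> u k - r ?\<tau> u k) * g (?\<tau>(u := k))\<bar> \<le> TV * B"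
        unfolding TV_def
      proof (rule rule_perturb[OF \<sigma> v u a])
        fix k l assume k: "k \<in> {1..q}" and l: "l \<in> {1..q}"
        have c: "?\<tau>(u := k) \<in> configs q n" by (rule configs_upd[OF \<tau> u(1) k])
        have "\<bar>g (?\<tau>(u := k)) - g ((?\<tau>(u := k))(u := l))\<bar> \<le> L * wgt (?\<tau>(u := k))"
          using g c u(1) l unfolding lipw_def by blast
        also have "\<dots> \<le> B"
          unfolding B_def using wgt_upd[OF \<sigma> v a] wgt_upd[OF \<tau> u(1) k] L
          by (intro mult_left_mono) (auto simp: abs_le_iff)
        finally show "\<bar>g (?\<tau>(u := k)) - g (?\<tau>(u := l))\<bar> \<le> B" by simp
      qed
    qed
    finally show ?thesis .
  qed
  have "n * \<bar>P g \<sigma> - P g ?\<tau>\<bar> = \<bar>\<Sum>u=1..n. T u\<bar>"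
    using n by (simp add: upd_op_def T_def sum_subtractf flip: diff_divide_distrib)
  also have "\<dots> \<le> (\<Sum>u\<in>{1..n}-{v}. \<bar>T u\<bar>)"
    using v Tv by (simp add: sum.remove[of _ v] sum_abs)
  also have "\<dots> \<le> (\<Sum>u\<in>{1..n}-{v}. L * (\<Sum>k=1..q. r \<sigma> u k * wgt (\<sigma>(u := k))) + TV * B)"
    using Tu by (intro sum_mono) auto
  also have "\<dots> = L * (\<Sum>u\<in>{1..n}-{v}. \<Sum>k=1..q. r \<sigma> u k * wgt (\<sigma>(u := k))) + real (card ({1..n}-{v})) * (TV * B)"
    by (simp add: sum.distrib sum_distrib_left)
  also have "\<dots> \<le> L * (n * P wgt \<sigma> - (wgt \<sigma> - 3 * K / n)) + n * (TV * B)"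
  proof (intro add_mono mult_left_mono L mult_right_mono)
    have "(\<Sum>u\<in>{1..n}-{v}. \<Sum>k=1..q. r \<sigma> u k * wgt (\<sigma>(u := k)))
        = n * P wgt \<sigma> - (\<Sum>k=1..q. r \<sigma> v k * wgt (\<sigma>(v := k)))"
      using n v by (simp add: upd_op_def sum.remove[of _ v])
    moreover have "(\<Sum>k=1..q. r \<sigma> v k * (wgt \<sigma> - 3 * K / n)) \<le> (\<Sum>k=1..q. r \<sigma> v k * wgt (\<sigma>(v := k)))"
      using wgt_upd[OF \<sigma> v] by (intro sum_mono mult_left_mono rule_nonneg) (force simp: abs_le_iff)
    moreover have "(\<Sum>k=1..q. r \<sigma> v k * (wgt \<sigma> - 3 * K / n)) = wgt \<sigma> - 3 * K / n"
      by (simp only: sum_distrib_right[symmetric] rule_sum mult_1)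
    ultimately show "(\<Sum>u\<in>{1..n}-{v}. \<Sum>k=1..q. r \<sigma> u k * wgt (\<sigma>(u := k))) \<le> n * P wgt \<sigma> - (wgt \<sigma> - 3 * K / n)"
      by linarith
    show "real (card ({1..n}-{v})) \<le> real n" using card_mono[of "{1..n}" "{1..n}-{v}"] by auto
  qed (use TV0 B0 in auto)
  also have "\<dots> = L * (n * P wgt \<sigma> - wgt \<sigma> + 3 * K / n + (b / q + C1 * ?m + E1 / n) * (wgt \<sigma> + 6 * K / n))"
  proof -
    have alg: "L * (A - (w - t)) + S * (L * y) = L * (A - w + t + S * y)" for A w t S y :: real
      by (simp add: algebra_simps)
    have nTV: "n * (TV * B) = (b / q + C1 * ?m + E1 / n) * B" using n by (simp add: TV_def)
    show ?thesis unfolding nTV unfolding B_def by (rule alg)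
  qed
  also have "\<dots> \<le> L * (n * (rate * wgt \<sigma>))"
  proof (rule mult_left_mono[OF _ L])
    have "n * P wgt \<sigma> \<le> n * (wgt \<sigma> - K * (3 / 4 * \<kappa>) * \<phi> \<sigma> / n + K * (q + 2) / (n * sqrt n))"
      by (intro mult_left_mono P_wgt_le[OF \<sigma>]) auto
    then show "n * P wgt \<sigma> - wgt \<sigma> + 3 * K / n + (b / q + C1 * ?m + E1 / n) * (wgt \<sigma> + 6 * K / n) \<le> n * (rate * wgt \<sigma>)"
      using contraction_arith[OF refl, of "\<phi> \<sigma>" "wgt \<sigma>"] \<phi>_pos[of \<sigma>] wgt_def[of \<sigma>] by linarith
  qed
  also have "\<dots> = n * (rate * L * wgt \<sigma>)" by simp
  finally show "\<bar>P g \<sigma> - P g ?\<tau>\<bar> \<le> rate * L * wgt \<sigma>"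
    using n by (subst (asm) mult_le_cancel_left_pos) auto
qed

lemma lipw_iter:
  assumes "lipw g L" "0 \<le> L"
  shows "lipw ((P ^^ t) g) (rate ^ t * L)"
proof (induction t)
  case (Suc t)
  then show ?case using lipw_P[of "(P ^^ t) g" "rate ^ t * L"] assms(2) rate_nonneg by (simp add: mult.assoc)
qed (use assms in simp)

lemma wgt_le: "wgt \<sigma> \<le> 1 + K * (real q + 1)"
  unfolding wgt_def using \<phi>_le[of \<sigma>] K_nonneg by (intro add_left_mono mult_left_mono)

text \<open>Two configurations are joined by a path that recolours the vertices \<open>1, \<dots>, n\<close> in turn.\<close>

lemma lipw_oscillation:
  assumes g: "lipw g L" "0 \<le> L" and \<sigma>: "\<sigma> \<in> configs q n" and \<tau>: "\<tau> \<in> configs q n"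
  shows "\<bar>g \<sigma> - g \<tau>\<bar> \<le> n * (L * (1 + K * (real q + 1)))"
proof -
  define p where "p = (\<lambda>i v. if v \<in> {1..i} then \<tau> v else \<sigma> v)"
  have p: "p i \<in> configs q n" if "i \<le> n" for i
    using \<sigma> \<tau> that by (auto simp: p_def configs_def PiE_def extensional_def Pi_def)
  have bound: "i \<le> n \<Longrightarrow> \<bar>g \<sigma> - g (p i)\<bar> \<le> i * (L * (1 + K * (real q + 1)))" for i
  proof (induction i)
    case 0
    have "p 0 = \<sigma>" by (auto simp: p_def)
    then show ?case by simp
  next
    case (Suc i)
    have "p (Suc i) = (p i)(Suc i := \<tau> (Suc i))" by (auto simp: p_def fun_eq_iff)
    moreover have "\<bar>g (p i) - g ((p i)(Suc i := \<tau> (Suc i)))\<bar> \<le> L * wgt (p i)"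
      using g(1) p[of i] Suc.prems configs_range[OF \<tau>, of "Suc i"] unfolding lipw_def by auto
    moreover have "L * wgt (p i) \<le> L * (1 + K * (real q + 1))"
      by (intro mult_left_mono wgt_le g(2))
    ultimately have "\<bar>g (p i) - g (p (Suc i))\<bar> \<le> L * (1 + K * (real q + 1))" by simp
    with Suc show ?case by (simp add: algebra_simps)
  qed
  have "p n = \<tau>" using \<sigma> \<tau> by (auto simp: p_def fun_eq_iff configs_def PiE_def extensional_def)
  then show ?thesis using bound[of n] by simp
qed

end

section \<open>Smoothing by uniform resampling\<close>

definition resample :: "nat \<Rightarrow> nat \<Rightarrow> ((nat \<Rightarrow> nat) \<Rightarrow> real) \<Rightarrow> (nat \<Rightarrow> nat) \<Rightarrow> real" where
  "resample q v f \<sigma> = (\<Sum>k=1..q. f (\<sigma>(v := k))) / real q"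

text \<open>Well defined as a fold because resamplings commute and are idempotent. After any number
  of uniform steps only the set of distinct sites hit matters.\<close>

definition resample_set :: "nat \<Rightarrow> nat set \<Rightarrow> ((nat \<Rightarrow> nat) \<Rightarrow> real) \<Rightarrow> (nat \<Rightarrow> nat) \<Rightarrow> real" where
  "resample_set q U f = Finite_Set.fold (resample q) f U"

definition uniform_rule :: "nat \<Rightarrow> (nat \<Rightarrow> nat) \<Rightarrow> nat \<Rightarrow> nat \<Rightarrow> real" where
  "uniform_rule q \<sigma> v k = 1 / real q"

definition swap_invariant :: "nat set \<Rightarrow> ((nat \<Rightarrow> nat) \<Rightarrow> real) \<Rightarrow> bool" where
  "swap_invariant I f \<longleftrightarrow> (\<forall>\<sigma>. \<forall>v\<in>I. \<forall>w\<in>I. f (\<sigma>(v := \<sigma> w, w := \<sigma> v)) = f \<sigma>)"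

lemma upd_op_uniform: "upd_op q n (uniform_rule q) f \<sigma> = (\<Sum>v=1..n. resample q v f \<sigma>) / real n"
  by (simp add: upd_op_def uniform_rule_def resample_def sum_divide_distrib)

lemma update_chain_uniform: "1 \<le> n \<Longrightarrow> 1 \<le> q \<Longrightarrow> update_chain q n (uniform_rule q)"
  by unfold_locales (auto simp: uniform_rule_def)

context
  fixes q :: nat
  assumes q: "1 \<le> q"
begin

lemma resample_commute: "resample q u (resample q v f) = resample q v (resample q u f)"
proof (cases "u = v")
  case False
  have "(\<Sum>k=1..q. \<Sum>l=1..q. f (\<sigma>(u := k, v := l))) = (\<Sum>l=1..q. \<Sum>k=1..q. f (\<sigma>(v := l, u := k)))" for \<sigma>
    by (subst sum.swap) (simp add: fun_upd_twist[OF False])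
  then show ?thesis by (simp add: resample_def fun_eq_iff flip: sum_divide_distrib)
qed simp

lemma resample_idem: "resample q v (resample q v f) = resample q v f"
  using q by (simp add: resample_def fun_eq_iff)

interpretation res: comp_fun_idem "resample q"
  by unfold_locales (auto simp: fun_eq_iff o_def resample_commute[of _ _] resample_idem)

lemma resample_set_empty [simp]: "resample_set q {} f = f"
  by (simp add: resample_set_def)

lemma resample_set_insert:
  "finite U \<Longrightarrow> resample_set q (insert u U) f = resample q u (resample_set q U f)"
  by (simp add: resample_set_def)

lemma resample_set_insert2:
  "finite U \<Longrightarrow> resample_set q (insert u U) f = resample_set q U (resample q u f)"
  using res.fold_fun_left_comm[of U u f] by (simp add: resample_set_insert) (simp add: resample_set_def)

lemma resample_set_absorb:
  "finite U \<Longrightarrow> u \<in> U \<Longrightarrow> resample_set q U (resample q u f) = resample_set q U f"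
  using resample_set_insert2[of U u f] by (simp add: insert_absorb)

lemma resample_upd: "resample q v f (\<sigma>(v := a)) = resample q v f \<sigma>"
  by (simp add: resample_def)

lemma resample_set_upd_in:
  assumes "finite U" "v \<in> U"
  shows "resample_set q U f (\<sigma>(v := a)) = resample_set q U f \<sigma>"
proof -
  have "resample_set q U f = resample q v (resample_set q U f)"
    using assms resample_set_insert[of U v f] by (simp add: insert_absorb)
  then show ?thesis by (metis resample_upd)
qed

lemma resample_set_upd_notin:
  assumes "finite U" "v \<notin> U"
  shows "resample_set q U f (\<sigma>(v := a)) = resample_set q U (\<lambda>\<sigma>. f (\<sigma>(v := a))) \<sigma>"
  using assms
proof (induction U arbitrary: \<sigma> rule: finite_induct)
  case (insert u U)
  then have vu: "v \<noteq> u" and vU: "v \<notin> U" by auto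
  have "resample_set q U f (\<sigma>(v := a, u := k)) = resample_set q U (\<lambda>\<sigma>. f (\<sigma>(v := a))) (\<sigma>(u := k))" for k
    unfolding fun_upd_twist[OF vu] by (rule insert.IH[OF vU])
  then show ?case
    unfolding resample_set_insert[OF insert.hyps(1)] resample_def by (simp only:)
qed simp

lemma resample_set_const [simp]: "finite U \<Longrightarrow> resample_set q U (\<lambda>_. c) = (\<lambda>_. c)"
  by (induction U rule: finite_induct) (use q in \<open>auto simp: resample_set_insert resample_def\<close>)

lemma resample_set_add:
  "finite U \<Longrightarrow> resample_set q U (\<lambda>\<sigma>. f \<sigma> + g \<sigma>) \<sigma> = resample_set q U f \<sigma> + resample_set q U g \<sigma>"
  by (induction U arbitrary: \<sigma> rule: finite_induct)
    (auto simp: resample_set_insert resample_def sum.distrib add_divide_distrib)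

lemma resample_set_cmult:
  "finite U \<Longrightarrow> resample_set q U (\<lambda>\<sigma>. c * f \<sigma>) \<sigma> = c * resample_set q U f \<sigma>"
  by (induction U arbitrary: \<sigma> rule: finite_induct)
    (auto simp: resample_set_insert resample_def simp flip: sum_distrib_left)

lemma resample_set_diff:
  "finite U \<Longrightarrow> resample_set q U (\<lambda>\<sigma>. f \<sigma> - g \<sigma>) \<sigma> = resample_set q U f \<sigma> - resample_set q U g \<sigma>"
  using resample_set_add[of U f "\<lambda>\<sigma>. (- 1) * g \<sigma>"] resample_set_cmult[of U "- 1" g] by simp

lemma resample_set_sum:
  assumes "finite U" "finite J"
  shows "resample_set q U (\<lambda>\<sigma>. \<Sum>w\<in>J. f w \<sigma>) \<sigma> = (\<Sum>w\<in>J. resample_set q U (f w) \<sigma>)"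
  using assms(2) by (induction J rule: finite_induct) (auto simp: resample_set_add assms(1))

lemma resample_set_mono:
  assumes "finite U" "\<And>\<sigma>. f \<sigma> \<le> g \<sigma>"
  shows "resample_set q U f \<sigma> \<le> resample_set q U g \<sigma>"
  using assms(1)
  by (induction U arbitrary: \<sigma> rule: finite_induct)
    (auto simp: resample_set_insert resample_def assms(2) intro!: divide_right_mono sum_mono)

lemma resample_set_abs_le:
  assumes "finite U" "\<And>\<sigma>. \<bar>f \<sigma>\<bar> \<le> g \<sigma>"
  shows "\<bar>resample_set q U f \<sigma>\<bar> \<le> resample_set q U g \<sigma>"
proof -
  have le: "f \<sigma> \<le> g \<sigma>" "(- 1) * f \<sigma> \<le> g \<sigma>" for \<sigma> using assms(2)[of \<sigma>] by auto
  have "resample_set q U f \<sigma> \<le> resample_set q U g \<sigma>"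
    by (rule resample_set_mono[OF assms(1) le(1)])
  moreover have "resample_set q U (\<lambda>\<sigma>. (- 1) * f \<sigma>) \<sigma> \<le> resample_set q U g \<sigma>"
    by (rule resample_set_mono[OF assms(1) le(2)])
  ultimately show ?thesis using resample_set_cmult[OF assms(1), of "- 1" f] by (simp add: abs_le_iff)
qed

text \<open>The set operator absorbs extra resamplings of \<open>v\<close> and \<open>w\<close>,
  which make the pair of spins a product of equal laws and hence exchangeable.\<close>

lemma resample_set_swap:
  assumes "finite U" "v \<in> U" "w \<in> U" "v \<noteq> w"
  shows "resample_set q U (\<lambda>\<sigma>. g (\<sigma>(v := \<sigma> w, w := \<sigma> v))) = resample_set q U g"
proof -
  let ?g = "\<lambda>\<sigma>. g (\<sigma>(v := \<sigma> w, w := \<sigma> v))"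
  have "resample q v (resample q w ?g) \<sigma> = resample q v (resample q w g) \<sigma>" for \<sigma>
  proof -
    have "(\<Sum>k=1..q. \<Sum>l=1..q. ?g (\<sigma>(v := k, w := l))) = (\<Sum>k=1..q. \<Sum>l=1..q. g (\<sigma>(v := l, w := k)))"
    proof (intro sum.cong refl)
      fix k l
      have "(\<sigma>(v := k, w := l))(v := (\<sigma>(v := k, w := l)) w, w := (\<sigma>(v := k, w := l)) v) = \<sigma>(v := l, w := k)"
        using assms(4) by auto
      then show "?g (\<sigma>(v := k, w := l)) = g (\<sigma>(v := l, w := k))" by simp
    qed
    also have "\<dots> = (\<Sum>k=1..q. \<Sum>l=1..q. g (\<sigma>(v := k, w := l)))" by (rule sum.swap)
    finally show ?thesis by (simp add: resample_def flip: sum_divide_distrib)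
  qed
  then have eq: "resample q v (resample q w ?g) = resample q v (resample q w g)" by blast
  have key: "resample_set q U (resample q v (resample q w h)) = resample_set q U h" for h
    by (simp only: resample_set_absorb[OF assms(1,2)] resample_set_absorb[OF assms(1,3)])
  show ?thesis by (rule trans[OF key[of ?g, symmetric, unfolded eq] key])
qed

definition color_sign :: "nat \<Rightarrow> nat \<Rightarrow> nat \<Rightarrow> (nat \<Rightarrow> nat) \<Rightarrow> real" where
  "color_sign a c w \<sigma> = (if \<sigma> w = a then 1 else 0) - (if \<sigma> w = c then 1 else 0)"

text \<open>Resampled signs at distinct sites are independent and centred, each with variance 2/q,
  so their sum has standard deviation of square-root order.\<close>

lemma color_sign_second_moment:
  assumes U: "finite U" and w: "w \<in> U" "w' \<in> U" and ac: "a \<in> {1..q}" "c \<in> {1..q}" "a \<noteq> c"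
  shows "resample_set q U (\<lambda>\<sigma>. color_sign a c w \<sigma> * color_sign a c w' \<sigma>) = (\<lambda>_. if w = w' then 2 / q else 0)"
proof -
  let ?g = "\<lambda>\<sigma>. color_sign a c w \<sigma> * color_sign a c w' \<sigma>"
  have "resample q w ?g = (\<lambda>_. if w = w' then 2 / q else 0)"
  proof (rule ext)
    fix \<sigma>
    show "resample q w ?g \<sigma> = (if w = w' then 2 / q else 0)"
    proof (cases "w = w'")
      case True
      have "(\<Sum>k=1..q. ?g (\<sigma>(w := k))) = (\<Sum>k=1..q. (if k = a then 1 else 0) + (if k = c then 1 else 0))"
        using True ac by (intro sum.cong) (auto simp: color_sign_def)
      also have "\<dots> = 2" using ac by (simp add: sum.distrib)
      finally show ?thesis using True by (simp add: resample_def)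
    next
      case False
      have "(\<Sum>k=1..q. ?g (\<sigma>(w := k)))
          = (\<Sum>k=1..q. (if k = a then 1 else 0) - (if k = c then 1 else 0)) * color_sign a c w' \<sigma>"
        unfolding sum_distrib_right using False by (intro sum.cong) (auto simp: color_sign_def)
      also have "\<dots> = 0" using ac by (simp add: sum_subtractf)
      finally show ?thesis using False by (simp add: resample_def)
    qed
  qed
  then show ?thesis using resample_set_absorb[OF U w(1), of ?g] U by simp
qed

text \<open>Exchangeability inside \<open>I\<close> replaces the single spin at \<open>v\<close> by the average over all resampled
  spins of \<open>I\<close>, whose fluctuations are of the order of the square root of their number.\<close>

lemma resample_set_gradient:
  fixes t :: real
  assumes U: "finite U" and v: "v \<in> I" and ac: "a \<in> {1..q}" "c \<in> {1..q}"
    and f: "\<And>\<sigma>. \<bar>f \<sigma>\<bar> \<le> 1" "swap_invariant I f" and t: "0 < t"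
  shows "\<bar>resample_set q U f (\<sigma>(v := a)) - resample_set q U f (\<sigma>(v := c))\<bar>
     \<le> 1 / t + q * t / (2 * (real (card (U \<inter> I)) + 1))"
proof (cases "v \<in> U \<or> a = c")
  case True
  then have "resample_set q U f (\<sigma>(v := a)) = resample_set q U f (\<sigma>(v := c))"
    using resample_set_upd_in[OF U] by auto
  moreover have "0 \<le> 1 / t + q * t / (2 * (real (card (U \<inter> I)) + 1))"
    using t by (intro add_nonneg_nonneg divide_nonneg_nonneg) auto
  ultimately show ?thesis by simp
next
  case False
  then have vU: "v \<notin> U" and ac': "a \<noteq> c" by auto
  let ?U = "insert v U"
  let ?s = "color_sign a c"
  define J where "J = ?U \<inter> I"
  have U': "finite ?U" and J: "finite J" "J \<subseteq> ?U" "v \<in> J" using U v by (auto simp: J_def)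
  have cardJ: "card J = card (U \<inter> I) + 1" using U vU v by (simp add: J_def Int_insert_left)
  define S where "S = (\<lambda>\<sigma>. \<Sum>w\<in>J. ?s w \<sigma>)"
  define X where "X = resample_set q ?U (\<lambda>\<sigma>. f \<sigma> * ?s v \<sigma>) \<sigma>"
  \<comment> \<open>Once \<open>v\<close> is resampled as well, comparing colours \<open>a\<close>
    and \<open>c\<close> at \<open>v\<close> amounts to correlating \<open>f\<close> with the sign
    at \<open>v\<close>.\<close>
  have grad: "resample_set q U f (\<sigma>(v := a)) - resample_set q U f (\<sigma>(v := c)) = q * X"
  proof -
    have "f (\<sigma>(v := a)) - f (\<sigma>(v := c)) = q * resample q v (\<lambda>\<sigma>. f \<sigma> * ?s v \<sigma>) \<sigma>" for \<sigma>
    proof -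
      have "(\<Sum>k=1..q. f (\<sigma>(v := k)) * ?s v (\<sigma>(v := k)))
          = (\<Sum>k=1..q. (if k = a then f (\<sigma>(v := k)) else 0) - (if k = c then f (\<sigma>(v := k)) else 0))"
        using ac' by (intro sum.cong) (auto simp: color_sign_def)
      also have "\<dots> = f (\<sigma>(v := a)) - f (\<sigma>(v := c))" using ac by (simp add: sum_subtractf)
      finally show ?thesis using q by (simp add: resample_def)
    qed
    then have "resample_set q U f (\<sigma>(v := a)) - resample_set q U f (\<sigma>(v := c))
        = resample_set q U (\<lambda>\<sigma>. q * resample q v (\<lambda>\<sigma>. f \<sigma> * ?s v \<sigma>) \<sigma>) \<sigma>"
      by (simp add: resample_set_upd_notin[OF U vU] flip: resample_set_diff[OF U])
    then show ?thesis
      by (simp add: resample_set_cmult[OF U] X_def resample_set_insert2[OF U])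
  qed
  have exch: "resample_set q ?U (\<lambda>\<sigma>. f \<sigma> * ?s w \<sigma>) = resample_set q ?U (\<lambda>\<sigma>. f \<sigma> * ?s v \<sigma>)" if "w \<in> J" for w
  proof (cases "w = v")
    case False
    have "f \<sigma> * ?s w \<sigma> = f (\<sigma>(v := \<sigma> w, w := \<sigma> v)) * ?s v (\<sigma>(v := \<sigma> w, w := \<sigma> v))" for \<sigma>
      using f(2) that v False by (simp add: swap_invariant_def J_def color_sign_def)
    then show ?thesis
      using resample_set_swap[OF U', of v w "\<lambda>\<sigma>. f \<sigma> * ?s v \<sigma>"] that False J by auto
  qed simp
  have "card J * X = resample_set q ?U (\<lambda>\<sigma>. f \<sigma> * S \<sigma>) \<sigma>"
  proof -
    have "resample_set q ?U (\<lambda>\<sigma>. f \<sigma> * S \<sigma>) \<sigma> = (\<Sum>w\<in>J. resample_set q ?U (\<lambda>\<sigma>. f \<sigma> * ?s w \<sigma>) \<sigma>)"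
      unfolding S_def sum_distrib_left by (rule resample_set_sum[OF U' J(1)])
    also have "\<dots> = (\<Sum>w\<in>J. X)" using exch by (intro sum.cong) (auto simp: X_def)
    finally show ?thesis by simp
  qed
  then have "card J * \<bar>X\<bar> = \<bar>resample_set q ?U (\<lambda>\<sigma>. f \<sigma> * S \<sigma>) \<sigma>\<bar>"
    by (metis abs_mult abs_of_nat)
  also have "\<bar>resample_set q ?U (\<lambda>\<sigma>. f \<sigma> * S \<sigma>) \<sigma>\<bar>
      \<le> resample_set q ?U (\<lambda>\<sigma>. 1 / (2 * t) * (S \<sigma> * S \<sigma>) + t / 2) \<sigma>"
  proof (rule resample_set_abs_le[OF U'])
    fix \<sigma>
    \<comment> \<open>The arithmetic-geometric inequality with a free \<open>t\<close> replaces
      Cauchy-Schwarz: the resulting bound is affine in the reciprocal number of resampled sites and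
      can be averaged over that random number.\<close>
    have "0 \<le> (\<bar>S \<sigma>\<bar> - t)\<^sup>2" by simp
    then have "\<bar>S \<sigma>\<bar> \<le> 1 / (2 * t) * (S \<sigma> * S \<sigma>) + t / 2"
      using t by (simp add: field_simps power2_eq_square)
    moreover have "\<bar>f \<sigma> * S \<sigma>\<bar> \<le> \<bar>S \<sigma>\<bar>"
      using f(1)[of \<sigma>] by (simp add: abs_mult mult_left_le_one_le)
    ultimately show "\<bar>f \<sigma> * S \<sigma>\<bar> \<le> 1 / (2 * t) * (S \<sigma> * S \<sigma>) + t / 2" by linarith
  qed
  also have "\<dots> = 1 / (2 * t) * (card J * (2 / q)) + t / 2"
  proof -
    have "resample_set q ?U (\<lambda>\<sigma>. S \<sigma> * S \<sigma>) \<sigma> = (\<Sum>w\<in>J. \<Sum>w'\<in>J. resample_set q ?U (\<lambda>\<sigma>. ?s w \<sigma> * ?s w' \<sigma>) \<sigma>)"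
      unfolding S_def sum_product by (simp add: resample_set_sum[OF U' J(1)])
    also have "\<dots> = (\<Sum>w\<in>J. \<Sum>w'\<in>J. if w = w' then 2 / q else 0)"
      using J ac ac' by (intro sum.cong refl) (subst color_sign_second_moment[OF U'], auto)
    also have "\<dots> = card J * (2 / q)" using J(1) by simp
    finally show ?thesis
      by (simp only: resample_set_add[OF U'] resample_set_cmult[OF U'] resample_set_const[OF U'])
  qed
  finally have "card J * \<bar>X\<bar> \<le> card J / (q * t) + t / 2" by (simp add: mult.commute)
  then have "\<bar>X\<bar> \<le> (card J / (q * t) + t / 2) / card J"
    using cardJ by (simp add: field_simps)
  then have "q * \<bar>X\<bar> \<le> q * ((card J / (q * t) + t / 2) / card J)" by (intro mult_left_mono) auto
  also have "\<dots> = 1 / t + q * t / (2 * card J)"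
  proof -
    have "0 < real (card J)" using cardJ by simp
    then show ?thesis using q t by (simp add: field_simps)
  qed
  finally show ?thesis
    unfolding grad by (simp add: abs_mult cardJ add.commute)
qed

text \<open>The right-hand side is a supersolution of the recursion for the mean of \<open>1 / (1 + M)\<close>, where \<open>M\<close>
  is the number of distinct sites of \<open>I\<close> resampled after \<open>j\<close> steps.\<close>

lemma resample_iter_gradient:
  fixes t :: real
  assumes n: "1 \<le> n" and I: "I \<subseteq> {1..n}" and v: "v \<in> I" and ac: "a \<in> {1..q}" "c \<in> {1..q}"
    and f: "\<And>\<sigma>. \<bar>f \<sigma>\<bar> \<le> 1" "swap_invariant I f" and t: "0 < t" and U: "U \<subseteq> {1..n}"
  defines "N \<equiv> real (card I)"
  shows "\<bar>(upd_op q n (uniform_rule q) ^^ j) (resample_set q U f) (\<sigma>(v := a))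
        - (upd_op q n (uniform_rule q) ^^ j) (resample_set q U f) (\<sigma>(v := c))\<bar>
     \<le> 1 / t + q * t / 2 * (1 / (real (card (U \<inter> I)) + 1 + N / (4 * n) * j) + j / (n * N))"
  using U
proof (induction j arbitrary: U)
  case 0
  have U: "finite U" using 0 finite_subset by blast
  have rhs: "1 / t + q * t / 2 * (1 / (real (card (U \<inter> I)) + 1 + N / (4 * real n) * real 0) + real 0 / (real n * N))
      = 1 / t + q * t / (2 * (real (card (U \<inter> I)) + 1))" by simp
  show ?case unfolding rhs funpow_0 by (rule resample_set_gradient[OF U v ac f t])
next
  case (Suc j)
  interpret R: update_chain q n "uniform_rule q" by (rule update_chain_uniform[OF n q])
  let ?R = "upd_op q n (uniform_rule q)"
  have U: "finite U" using Suc.prems finite_subset by blast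
  have finI: "finite I" using I finite_subset by blast
  have N: "0 < N" "N \<le> n"
    using v finI card_mono[OF _ I] by (auto simp: N_def card_gt_0_iff)
  define c' where "c' = N / (4 * real n)"
  define M where "M = real (card (U \<inter> I)) + 1"
  define x where "x = M + c' * j"
  have c': "0 \<le> c'" "0 < c'" using N n by (auto simp: c'_def)
  have x1: "1 \<le> x" "M \<le> x" using c' by (auto simp: x_def M_def)
  define H where "H = (\<lambda>m::real. 1 / (m + c' * j) + j / (n * N))"
  have step: "?R (resample_set q U f) = (\<lambda>\<sigma>. 1 / n * (\<Sum>u=1..n. resample_set q (insert u U) f \<sigma>))"
    by (simp add: fun_eq_iff upd_op_uniform resample_set_insert[OF U])
  have iter_sum: "(?R ^^ j) (\<lambda>\<sigma>. \<Sum>u\<in>J. h u \<sigma>) \<sigma> = (\<Sum>u\<in>J. (?R ^^ j) (h u) \<sigma>)" if "finite J" for J and h :: "nat \<Rightarrow> (nat \<Rightarrow> nat) \<Rightarrow> real" and \<sigma>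
    using that by (induction J rule: finite_induct) (auto simp: R.iter_add)
  have expand: "(?R ^^ Suc j) (resample_set q U f) \<sigma> = 1 / n * (\<Sum>u=1..n. (?R ^^ j) (resample_set q (insert u U) f) \<sigma>)" for \<sigma>
    unfolding funpow_Suc_right o_def step R.iter_cmult iter_sum[OF finite_atLeastAtMost] ..
  let ?d = "\<lambda>u. (?R ^^ j) (resample_set q (insert u U) f) (\<sigma>(v := a)) - (?R ^^ j) (resample_set q (insert u U) f) (\<sigma>(v := c))"
  have "\<bar>(?R ^^ Suc j) (resample_set q U f) (\<sigma>(v := a)) - (?R ^^ Suc j) (resample_set q U f) (\<sigma>(v := c))\<bar>
      = 1 / n * \<bar>\<Sum>u=1..n. ?d u\<bar>"
    unfolding expand sum_subtractf right_diff_distrib[symmetric] abs_mult by simp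
  also have "\<dots> \<le> 1 / n * (\<Sum>u=1..n. 1 / t + q * t / 2 * (if u \<in> I - U then H (M + 1) else H M))"
  proof (intro mult_left_mono order_trans[OF sum_abs] sum_mono)
    fix u assume u: "u \<in> {1..n}"
    have card_eq: "real (card (insert u U \<inter> I)) + 1 = (if u \<in> I - U then M + 1 else M)"
      using U by (auto simp: M_def Int_insert_left insert_absorb)
    have "\<bar>?d u\<bar> \<le> 1 / t + q * t / 2 * H (real (card (insert u U \<inter> I)) + 1)"
      unfolding H_def c'_def by (rule Suc.IH) (use u Suc.prems in auto)
    then show "\<bar>?d u\<bar> \<le> 1 / t + q * t / 2 * (if u \<in> I - U then H (M + 1) else H M)"
      unfolding card_eq by (simp only: if_distrib[of H])
  qed auto
  also have "\<dots> = 1 / t + q * t / 2 * (1 / n * (\<Sum>u=1..n. if u \<in> I - U then H (M + 1) else H M))"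
    unfolding sum.distrib sum_distrib_left[symmetric] using n by (simp add: distrib_left)
  also have "1 / n * (\<Sum>u=1..n. if u \<in> I - U then H (M + 1) else H M) \<le> 1 / (x + c') + Suc j / (n * N)"
  proof -
    have cardIU: "real (card (I - U)) = N - M + 1"
    proof -
      have "card (I - U) = card I - card (U \<inter> I)" using finI U by (simp add: card_Diff_subset_Int Int_commute)
      moreover have "card (U \<inter> I) \<le> card I" using finI by (intro card_mono) auto
      ultimately show ?thesis by (simp add: N_def M_def of_nat_diff)
    qed
    have "(\<Sum>u=1..n. if u \<in> I - U then H (M + 1) else H M) = (\<Sum>u=1..n. H M - (if u \<in> I - U then H M - H (M + 1) else 0))"
      by (intro sum.cong) auto
    also have "\<dots> = n * H M - card (I - U) * (H M - H (M + 1))"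
    proof -
      have "{1..n} \<inter> {u \<in> I. u \<notin> U} = I - U" using I by auto
      then show ?thesis by (simp add: sum_subtractf sum.If_cases)
    qed
    finally have "1 / n * (\<Sum>u=1..n. if u \<in> I - U then H (M + 1) else H M) = H M - (N - M + 1) / n * (1 / x - 1 / (x + 1))"
      using n by (simp add: cardIU H_def x_def right_diff_distrib add_ac)
    \<comment> \<open>While at most half of \<open>I\<close> has been hit, a new site comes up with
      probability at least 2c', and the factor 2 makes up for x + 1 against x + c' since x \<ge> 1.
      Afterwards x > N/2, and the whole decrement is at most the correction 1/(nN).\<close>
    moreover have "1 / x - 1 / (x + c') \<le> (N - M + 1) / n * (1 / x - 1 / (x + 1)) + 1 / (n * N)"
    proof (cases "2 * M \<le> N")
      case True
      have "1 / x - 1 / (x + c') = c' / (x * (x + c'))" using x1 c' by (simp add: field_simps)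
      also have "\<dots> \<le> 2 * c' / (x * (x + 1))"
      proof -
        have "c' * (x * (x + 1)) \<le> 2 * c' * (x * (x + c'))"
        proof -
          have "c' * x * (x + 1) \<le> c' * x * (2 * (x + c'))" using x1 c' by (intro mult_left_mono) auto
          then show ?thesis by (simp add: algebra_simps)
        qed
        then show ?thesis using x1 c' by (simp add: divide_le_eq le_divide_eq mult.commute)
      qed
      also have "\<dots> = 2 * c' * (1 / x - 1 / (x + 1))" using x1 by (simp add: field_simps)
      also have "\<dots> \<le> (N - M + 1) / n * (1 / x - 1 / (x + 1))"
      proof (rule mult_right_mono)
        show "2 * c' \<le> (N - M + 1) / n" using True n by (simp add: c'_def field_simps)
        show "0 \<le> 1 / x - 1 / (x + 1)" using x1 by (simp add: field_simps)
      qed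
      also have "\<dots> \<le> \<dots> + 1 / (n * N)" using N by simp
      finally show ?thesis .
    next
      case False
      have "1 / x - 1 / (x + c') = c' / (x * (x + c'))" using x1 c' by (simp add: field_simps)
      also have "\<dots> \<le> c' / (N / 2 * (N / 2))"
        using False x1 c' N by (intro divide_left_mono mult_mono mult_pos_pos) auto
      also have "\<dots> = 1 / (n * N)" using N n by (simp add: c'_def field_simps)
      also have "\<dots> \<le> (N - M + 1) / n * (1 / x - 1 / (x + 1)) + 1 / (n * N)"
      proof -
        have "0 \<le> (N - M + 1) / n" unfolding cardIU[symmetric] by simp
        moreover have "0 \<le> 1 / x - 1 / (x + 1)" using x1 by (simp add: field_simps)
        ultimately have "0 \<le> (N - M + 1) / n * (1 / x - 1 / (x + 1))" by (rule mult_nonneg_nonneg)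
        then show ?thesis by linarith
      qed
      finally show ?thesis .
    qed
    moreover have "H M = 1 / x + j / (n * N)" by (simp add: H_def x_def)
    ultimately show ?thesis by (simp add: add_divide_distrib)
  qed
  also have "x + c' = real (card (U \<inter> I)) + 1 + N / (4 * n) * Suc j"
    by (simp add: x_def M_def c'_def algebra_simps add_divide_distrib)
  finally show ?case using t by (simp add: mult_left_mono)
qed

text \<open>The choice t = sqrt (j + 1) balances the two terms. The correction j/(nN) stays of order
  1/(j + 1) because j \<le> n and \<open>I\<close> contains a positive fraction of the
  vertices.\<close>

lemma uniform_smoothing:
  fixes \<gamma> :: real
  assumes n: "1 \<le> n" and I: "I \<subseteq> {1..n}" and \<gamma>: "0 < \<gamma>" "\<gamma> * n \<le> card I" and v: "v \<in> I"
    and ac: "a \<in> {1..q}" "c \<in> {1..q}" and f: "\<And>\<sigma>. \<bar>f \<sigma>\<bar> \<le> 1" "swap_invariant I f" and j: "j \<le> n"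
  shows "\<bar>(upd_op q n (uniform_rule q) ^^ j) f (\<sigma>(v := a)) - (upd_op q n (uniform_rule q) ^^ j) f (\<sigma>(v := c))\<bar>
     \<le> (1 + 3 * q / \<gamma>) / sqrt (real j + 1)"
proof -
  define N where "N = real (card I)"
  define s where "s = real j + 1"
  define t where "t = sqrt s"
  have s: "1 \<le> s" by (simp add: s_def)
  have t: "0 < t" "t * t = s" using s by (auto simp: t_def)
  have "card I \<le> card {1..n}" by (rule card_mono[OF _ I]) simp
  then have N: "\<gamma> * n \<le> N" "N \<le> n" using \<gamma>(2) by (auto simp: N_def)
  have "0 < \<gamma> * n" using \<gamma> n by simp
  then have N0: "0 < N" using N by linarith
  have \<gamma>1: "\<gamma> \<le> 1"
  proof -
    have "\<gamma> * real n \<le> 1 * real n" using N by simp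
    then show ?thesis using n by (subst (asm) mult_le_cancel_right_pos) auto
  qed
  have "1 / (1 + N / (4 * n) * j) \<le> 4 / (\<gamma> * s)"
  proof -
    have "\<gamma> * s / 4 \<le> 1 + N / (4 * n) * j"
    proof -
      have "\<gamma> / 4 * j \<le> N / (4 * n) * j" using N n by (intro mult_right_mono) (auto simp: field_simps)
      then show ?thesis using \<gamma>1 by (simp add: s_def algebra_simps)
    qed
    moreover have "0 < \<gamma> * s / 4" using \<gamma> s by simp
    ultimately have "1 / (1 + N / (4 * n) * j) \<le> 1 / (\<gamma> * s / 4)" by (intro divide_left_mono) auto
    then show ?thesis by simp
  qed
  moreover have "j / (n * N) \<le> 2 / (\<gamma> * s)"
  proof -
    have "real j * s \<le> real n * (2 * real n)" using j n by (intro mult_mono) (auto simp: s_def)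
    then have "real j * s * \<gamma> \<le> real n * (2 * real n) * \<gamma>" using \<gamma> by (intro mult_right_mono) auto
    also have "\<dots> \<le> 2 * (n * N)" using mult_left_mono[OF N(1), of "2 * n"] by (simp add: mult_ac)
    finally show ?thesis using \<gamma> s N0 n by (simp add: field_simps)
  qed
  ultimately have G: "1 / (1 + N / (4 * n) * j) + j / (n * N) \<le> 6 / (\<gamma> * s)" by (simp add: field_simps)
  have "\<bar>(upd_op q n (uniform_rule q) ^^ j) f (\<sigma>(v := a)) - (upd_op q n (uniform_rule q) ^^ j) f (\<sigma>(v := c))\<bar>
     \<le> 1 / t + q * t / 2 * (1 / (1 + N / (4 * n) * j) + j / (n * N))"
    using resample_iter_gradient[OF n I v ac f t(1), of "{}" j \<sigma>] by (simp add: N_def)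
  also have "\<dots> \<le> 1 / t + q * t / 2 * (6 / (\<gamma> * s))"
    using G t by (intro add_left_mono mult_left_mono) auto
  also have "\<dots> = (1 + 3 * q / \<gamma>) / t"
    using t \<gamma> by (simp add: t(2)[symmetric] field_simps)
  finally show ?thesis by (simp add: t_def s_def)
qed

end

section \<open>Total variation distance on a finite set\<close>

lemma tv_dist_ge: "\<bar>measure_pmf.prob p A - measure_pmf.prob p' A\<bar> \<le> tv_dist p p'"
proof -
  have "\<bar>measure_pmf.prob p A - measure_pmf.prob p' A\<bar> \<le> 1" for A
    using measure_pmf.prob_le_1[of p A] measure_pmf.prob_le_1[of p' A]
      measure_nonneg[of "measure_pmf p" A] measure_nonneg[of "measure_pmf p'" A] by linarith
  then have "bdd_above (range (\<lambda>A. \<bar>measure_pmf.prob p A - measure_pmf.prob p' A\<bar>))"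
    by (intro bdd_aboveI[of _ 1]) auto
  then show ?thesis unfolding tv_dist_def by (rule cSUP_upper[OF UNIV_I])
qed

text \<open>The maximising event is made explicit because every symmetry shared by the two laws is
  then a symmetry of the event.\<close>

lemma tv_dist_le_positive_set:
  assumes fin: "finite F" and supp: "set_pmf p \<subseteq> F" "set_pmf p' \<subseteq> F"
  defines "B \<equiv> {x. pmf p' x < pmf p x}"
  shows "tv_dist p p' \<le> measure_pmf.prob p B - measure_pmf.prob p' B"
proof -
  have prob: "measure_pmf.prob p A = (\<Sum>x\<in>F. if x \<in> A then pmf p x else 0)" if "set_pmf p \<subseteq> F" for p :: "'a pmf" and A
  proof -
    have "measure_pmf.prob p A = measure_pmf.prob p (F \<inter> A)"
      using that by (metis Int_absorb1 Int_assoc Int_commute measure_Int_set_pmf)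
    also have "\<dots> = (\<Sum>x\<in>F \<inter> A. pmf p x)" using fin by (intro measure_measure_pmf_finite) auto
    also have "\<dots> = (\<Sum>x\<in>F. if x \<in> A then pmf p x else 0)" by (simp add: fin sum.inter_restrict)
    finally show ?thesis .
  qed
  have le: "measure_pmf.prob p A - measure_pmf.prob p' A \<le> measure_pmf.prob p B - measure_pmf.prob p' B" for A
    unfolding prob[OF supp(1)] prob[OF supp(2)] sum_subtractf[symmetric]
    by (intro sum_mono) (auto simp: B_def)
  show ?thesis unfolding tv_dist_def
  proof (rule cSUP_least)
    fix A :: "'a set"
    have "measure_pmf.prob p (- A) = 1 - measure_pmf.prob p A" for p :: "'a pmf"
      using measure_pmf.prob_compl[of A p] by (simp add: Compl_eq_Diff_UNIV)
    then show "\<bar>measure_pmf.prob p A - measure_pmf.prob p' A\<bar> \<le> measure_pmf.prob p B - measure_pmf.prob p' B"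
      using le[of A] le[of "- A"] by (simp add: abs_le_iff)
  qed auto
qed

section \<open>The Glauber dynamics as an update operator\<close>

definition spin_swap :: "nat \<Rightarrow> nat \<Rightarrow> (nat \<Rightarrow> nat) \<Rightarrow> nat \<Rightarrow> nat" where
  "spin_swap v w \<sigma> = \<sigma>(v := \<sigma> w, w := \<sigma> v)"

lemma spin_swap_transpose: "spin_swap v w \<sigma> x = \<sigma> (Transposition.transpose v w x)"
  by (auto simp: spin_swap_def Transposition.transpose_def)

lemma spin_swap_twice: "spin_swap v w (spin_swap v w \<sigma>) = \<sigma>"
  by (auto simp: spin_swap_def)

text \<open>The excluded set \<open>U\<close> is empty for colour counts and a single vertex for
  local fields.\<close>

lemma card_spin_swap:
  assumes "v \<in> {1..n}" "w \<in> {1..n}"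
  shows "card {x\<in>{1..n} - Transposition.transpose v w ` U. spin_swap v w \<sigma> x = k} = card {x\<in>{1..n} - U. \<sigma> x = k}"
proof -
  let ?t = "Transposition.transpose v w"
  have t: "?t x \<in> {1..n} \<longleftrightarrow> x \<in> {1..n}" for x
    using assms by (auto simp: Transposition.transpose_def)
  have "{x\<in>{1..n} - ?t ` U. spin_swap v w \<sigma> x = k} = ?t ` {x\<in>{1..n} - U. \<sigma> x = k}"
  proof (intro equalityI subsetI)
    fix x assume x: "x \<in> {x\<in>{1..n} - ?t ` U. spin_swap v w \<sigma> x = k}"
    then have "?t x \<in> {x\<in>{1..n} - U. \<sigma> x = k}"
      using t[of x] by (auto simp: spin_swap_transpose) (metis image_eqI transpose_involutory)
    then show "x \<in> ?t ` {x\<in>{1..n} - U. \<sigma> x = k}" by (metis image_eqI transpose_involutory)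
  next
    fix x assume "x \<in> ?t ` {x\<in>{1..n} - U. \<sigma> x = k}"
    then obtain y where y: "y \<in> {1..n}" "y \<notin> U" "\<sigma> y = k" "x = ?t y" by auto
    then have "x \<notin> ?t ` U" by (metis (no_types, lifting) image_iff transpose_involutory)
    then show "x \<in> {x\<in>{1..n} - ?t ` U. spin_swap v w \<sigma> x = k}"
      using y t[of y] by (simp add: spin_swap_transpose)
  qed
  then show ?thesis by (simp add: card_image)
qed

lemma energy_spin_swap: "v \<in> {1..n} \<Longrightarrow> w \<in> {1..n} \<Longrightarrow> energy q n (spin_swap v w \<sigma>) = energy q n \<sigma>"
  using card_spin_swap[of v n w "{}" \<sigma>] by (simp add: energy_def color_dev_def color_count_def)

lemma configs_spin_swap:
  "v \<in> {1..n} \<Longrightarrow> w \<in> {1..n} \<Longrightarrow> spin_swap v w \<sigma> \<in> configs q n \<longleftrightarrow> \<sigma> \<in> configs q n"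
proof -
  have "spin_swap v w \<sigma> \<in> configs q n" if "v \<in> {1..n}" "w \<in> {1..n}" "\<sigma> \<in> configs q n" for \<sigma>
    using that by (auto simp: configs_def PiE_def extensional_def Pi_def spin_swap_def)
  then show "v \<in> {1..n} \<Longrightarrow> w \<in> {1..n} \<Longrightarrow> ?thesis" by (metis spin_swap_twice)
qed

locale potts_chain =
  fixes q n :: nat and \<beta> :: real
  assumes q: "1 \<le> q" and n: "1 \<le> n" and \<beta>: "0 \<le> \<beta>"
begin

abbreviation g where "g \<equiv> glauber_rule q (2 * \<beta>) n"

sublocale G: update_chain q n g
  by unfold_locales (use q n \<beta> softmax_nonneg softmax_sum in \<open>auto simp: glauber_rule_def\<close>)

text \<open>The colour \<open>k\<close> occurs only in the last factor; the first one cancels in the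
  conditional law of the spin at \<open>u\<close>, which leaves the softmax.\<close>

lemma weight_upd:
  assumes "\<sigma> \<in> configs q n" "u \<in> {1..n}" "k \<in> {1..q}"
  shows "potts_weight \<beta> n (\<sigma>(u := k)) = exp (\<beta> * (n * (energy q n \<sigma> + 1 / q) - 2 * color_dev q n \<sigma> (\<sigma> u) + 2 / n))
    * exp (2 * \<beta> * local_dev q n \<sigma> u k)"
proof -
  note W = energy_upd[of u n \<sigma> q k, OF assms(2) configs_range[OF assms(1,2)] assms(3)]
  have "\<beta> * n * (energy q n (\<sigma>(u := k)) + 1 / q)
      = \<beta> * (n * (energy q n \<sigma> + 1 / q) - 2 * color_dev q n \<sigma> (\<sigma> u) + 2 / n) + 2 * \<beta> * local_dev q n \<sigma> u k"
    unfolding W local_dev_eq[OF assms(2)] using n by (simp add: power2_eq_square) (simp add: field_simps)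
  then show ?thesis
    unfolding potts_weight_energy[OF configs_upd[OF assms] n q] by (simp flip: exp_add)
qed

lemma glauber_rule_weight:
  assumes "\<sigma> \<in> configs q n" "u \<in> {1..n}" "k \<in> {1..q}"
  shows "g \<sigma> u k = potts_weight \<beta> n (\<sigma>(u := k)) / (\<Sum>j=1..q. potts_weight \<beta> n (\<sigma>(u := j)))"
  using assms by (simp add: weight_upd glauber_rule_def softmax_def flip: sum_distrib_left)

lemma pmf_color_cond:
  assumes \<sigma>: "\<sigma> \<in> configs q n" and u: "u \<in> {1..n}"
  shows "set_pmf (color_cond q \<beta> n \<sigma> u) \<subseteq> {1..q}"
    and "k \<in> {1..q} \<Longrightarrow> pmf (color_cond q \<beta> n \<sigma> u) k = g \<sigma> u k"
proof -
  let ?\<mu> = "potts q \<beta> n"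
  define C where "C = {\<tau>. \<forall>w\<in>{1..n} - {u}. \<tau> w = \<sigma> w}"
  have ne: "set_pmf ?\<mu> \<inter> C \<noteq> {}" unfolding C_def by (rule potts_cond_nonempty[OF q \<sigma>])
  have inter: "configs q n \<inter> C = (\<lambda>j. \<sigma>(u := j)) ` {1..q}"
  proof (intro equalityI subsetI)
    fix \<tau> assume \<tau>: "\<tau> \<in> configs q n \<inter> C"
    have "\<tau> x = (\<sigma>(u := \<tau> u)) x" for x
      using \<tau> \<sigma> by (cases "x \<in> {1..n}") (auto simp: C_def configs_def PiE_def extensional_def)
    then have "\<tau> = \<sigma>(u := \<tau> u)" by blast
    then show "\<tau> \<in> (\<lambda>j. \<sigma>(u := j)) ` {1..q}" using configs_range[of \<tau> q n u] \<tau> u by blast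
  qed (use configs_upd[OF \<sigma> u] in \<open>auto simp: C_def split: if_splits\<close>)
  have inj: "inj_on (\<lambda>j. \<sigma>(u := j)) {1..q}" by (auto simp: inj_on_def fun_eq_iff)
  have set_cond: "set_pmf (cond_pmf ?\<mu> C) = (\<lambda>j. \<sigma>(u := j)) ` {1..q}"
    using ne inter by (simp add: set_pmf_potts[OF q])
  show "set_pmf (color_cond q \<beta> n \<sigma> u) \<subseteq> {1..q}"
    unfolding color_cond_def C_def[symmetric] by (auto simp: set_cond)
  assume k: "k \<in> {1..q}"
  have C: "measure_pmf.prob ?\<mu> C = (\<Sum>j=1..q. potts_weight \<beta> n (\<sigma>(u := j))) / potts_Z q \<beta> n"
  proof -
    have "measure_pmf.prob ?\<mu> C = measure_pmf.prob ?\<mu> (configs q n \<inter> C)"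
      by (metis Int_commute measure_Int_set_pmf set_pmf_potts[OF q])
    also have "\<dots> = (\<Sum>j=1..q. potts_weight \<beta> n (\<sigma>(u := j)) / potts_Z q \<beta> n)"
    proof -
      have "(\<lambda>j. \<sigma>(u := j)) ` {1..q} \<subseteq> configs q n" using inter by blast
      then show ?thesis unfolding inter by (simp only: potts_prob_sum[OF q] sum.reindex[OF inj] o_def)
    qed
    finally show ?thesis by (simp add: sum_divide_distrib)
  qed
  have "pmf (color_cond q \<beta> n \<sigma> u) k = measure_pmf.prob (cond_pmf ?\<mu> C) ((\<lambda>\<tau>. \<tau> u) -` {k})"
    unfolding color_cond_def C_def[symmetric] by (rule pmf_map)
  also have "\<dots> = measure_pmf.prob (cond_pmf ?\<mu> C) {\<sigma>(u := k)}"
  proof -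
    have "(\<lambda>\<tau>. \<tau> u) -` {k} \<inter> set_pmf (cond_pmf ?\<mu> C) = {\<sigma>(u := k)} \<inter> set_pmf (cond_pmf ?\<mu> C)"
      using k by (auto simp: set_cond)
    then show ?thesis by (metis measure_Int_set_pmf)
  qed
  also have "\<dots> = pmf ?\<mu> (\<sigma>(u := k)) / measure_pmf.prob ?\<mu> C"
    using ne by (subst measure_pmf_single, subst pmf_cond) (auto simp: C_def)
  also have "\<dots> = g \<sigma> u k"
    unfolding C glauber_rule_weight[OF \<sigma> u k] pmf_potts[OF q]
    using configs_upd[OF \<sigma> u k] potts_Z_pos[OF q, of \<beta> n] by simp
  finally show "pmf (color_cond q \<beta> n \<sigma> u) k = g \<sigma> u k" .
qed

lemma set_pmf_glauber_step:
  assumes "\<sigma> \<in> configs q n"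
  shows "set_pmf (glauber_step q \<beta> n \<sigma>) \<subseteq> configs q n"
proof -
  have "set_pmf (pmf_of_set {1..n}) = {1..n}" using n by (intro set_pmf_of_set) auto
  then show ?thesis
    unfolding glauber_step_def set_bind_pmf set_map_pmf
    using pmf_color_cond(1)[OF assms] configs_upd[OF assms] by blast
qed

lemma expectation_glauber_step:
  assumes \<sigma>: "\<sigma> \<in> configs q n"
  shows "measure_pmf.expectation (glauber_step q \<beta> n \<sigma>) f = G.P f \<sigma>"
proof -
  have V: "set_pmf (pmf_of_set {1..n}) = {1..n}" using n by (intro set_pmf_of_set) auto
  have fin: "finite (set_pmf (color_cond q \<beta> n \<sigma> u))" if "u \<in> {1..n}" for u
    using pmf_color_cond(1)[OF \<sigma> that] finite_subset by blast
  have "measure_pmf.expectation (glauber_step q \<beta> n \<sigma>) f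
      = (\<Sum>u=1..n. pmf (pmf_of_set {1..n}) u *\<^sub>R measure_pmf.expectation (map_pmf (\<lambda>k. \<sigma>(u := k)) (color_cond q \<beta> n \<sigma> u)) f)"
    unfolding glauber_step_def using V fin by (intro pmf_expectation_bind) auto
  also have "\<dots> = (\<Sum>u=1..n. 1 / n * (\<Sum>k=1..q. g \<sigma> u k * f (\<sigma>(u := k))))"
  proof (intro sum.cong refl)
    fix u assume u: "u \<in> {1..n}"
    have "measure_pmf.expectation (map_pmf (\<lambda>k. \<sigma>(u := k)) (color_cond q \<beta> n \<sigma> u)) f
        = (\<Sum>k=1..q. f (\<sigma>(u := k)) * pmf (color_cond q \<beta> n \<sigma> u) k)"
      unfolding integral_map_pmf using pmf_color_cond(1)[OF \<sigma> u]
      by (intro integral_measure_pmf_real) auto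
    moreover have "pmf (pmf_of_set {1..n}) u = 1 / n" using n u by (subst pmf_of_set) auto
    ultimately show "pmf (pmf_of_set {1..n}) u *\<^sub>R measure_pmf.expectation (map_pmf (\<lambda>k. \<sigma>(u := k)) (color_cond q \<beta> n \<sigma> u)) f
        = 1 / n * (\<Sum>k=1..q. g \<sigma> u k * f (\<sigma>(u := k)))"
      using pmf_color_cond(2)[OF \<sigma> u] by (simp add: mult.commute)
  qed
  also have "\<dots> = G.P f \<sigma>" by (simp add: upd_op_def sum_divide_distrib)
  finally show ?thesis .
qed

lemma set_pmf_glauber_law: "\<sigma> \<in> configs q n \<Longrightarrow> set_pmf (glauber_law q \<beta> n \<sigma> t) \<subseteq> configs q n"
  by (induction t) (use set_pmf_glauber_step in \<open>auto simp: set_bind_pmf\<close>)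

lemma expectation_glauber_law:
  assumes \<sigma>: "\<sigma> \<in> configs q n"
  shows "measure_pmf.expectation (glauber_law q \<beta> n \<sigma> t) f = (G.P ^^ t) f \<sigma>"
proof (induction t arbitrary: f)
  case (Suc t)
  have fin: "finite (set_pmf (glauber_step q \<beta> n \<tau>))" if "\<tau> \<in> configs q n" for \<tau>
    using set_pmf_glauber_step[OF that] finite_configs finite_subset by blast
  have "measure_pmf.expectation (glauber_law q \<beta> n \<sigma> (Suc t)) f
      = (\<Sum>\<tau>\<in>configs q n. pmf (glauber_law q \<beta> n \<sigma> t) \<tau> *\<^sub>R measure_pmf.expectation (glauber_step q \<beta> n \<tau>) f)"
    unfolding glauber_law.simps using fin set_pmf_glauber_law[OF \<sigma>]
    by (intro pmf_expectation_bind finite_configs) auto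
  also have "\<dots> = (\<Sum>\<tau>\<in>configs q n. G.P f \<tau> * pmf (glauber_law q \<beta> n \<sigma> t) \<tau>)"
    by (intro sum.cong refl) (simp add: expectation_glauber_step)
  also have "\<dots> = measure_pmf.expectation (glauber_law q \<beta> n \<sigma> t) (G.P f)"
    using set_pmf_glauber_law[OF \<sigma>, of t] by (intro integral_measure_pmf_real[symmetric] finite_configs) auto
  also have "\<dots> = (G.P ^^ Suc t) f \<sigma>" unfolding Suc by (simp add: funpow_swap1)
  finally show ?case .
qed (use \<sigma> in simp)

lemma prob_glauber_law:
  assumes "\<sigma> \<in> configs q n"
  shows "measure_pmf.prob (glauber_law q \<beta> n \<sigma> t) A = (G.P ^^ t) (indicator A) \<sigma>"
  using expectation_glauber_law[OF assms, of t "indicator A"] by simp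

section \<open>Gibbs averages and their invariance\<close>

definition gibbs where "gibbs f = (\<Sum>\<sigma>\<in>configs q n. potts_weight \<beta> n \<sigma> / potts_Z q \<beta> n * f \<sigma>)"

lemma prob_potts: "measure_pmf.prob (potts q \<beta> n) A = gibbs (indicator A)"
proof -
  have "measure_pmf.prob (potts q \<beta> n) A = measure_pmf.prob (potts q \<beta> n) (configs q n \<inter> A)"
    by (metis Int_commute measure_Int_set_pmf set_pmf_potts[OF q])
  also have "\<dots> = gibbs (indicator A)"
    by (subst potts_prob_sum[OF q])
      (auto simp: gibbs_def indicator_def finite_configs sum.inter_restrict if_distrib intro!: sum.cong)
  finally show ?thesis .
qed

lemma gibbs_mono: "(\<And>\<sigma>. \<sigma> \<in> configs q n \<Longrightarrow> f \<sigma> \<le> h \<sigma>) \<Longrightarrow> gibbs f \<le> gibbs h"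
  unfolding gibbs_def using potts_weight_pos[of \<beta> n] potts_Z_pos[OF q, of \<beta> n]
  by (intro sum_mono mult_left_mono divide_nonneg_pos) (auto intro: less_imp_le)

lemma gibbs_const: "gibbs (\<lambda>_. c) = c"
proof -
  have "gibbs (\<lambda>_. c) = (\<Sum>\<sigma>\<in>configs q n. potts_weight \<beta> n \<sigma>) / potts_Z q \<beta> n * c"
    by (simp add: gibbs_def sum_distrib_right sum_divide_distrib)
  then show ?thesis using potts_Z_pos[OF q, of \<beta> n] by (simp flip: potts_Z_def)
qed

lemma gibbs_add: "gibbs (\<lambda>\<sigma>. f \<sigma> + h \<sigma>) = gibbs f + gibbs h"
  by (simp add: gibbs_def distrib_left sum.distrib)

lemma gibbs_cmult: "gibbs (\<lambda>\<sigma>. c * f \<sigma>) = c * gibbs f"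
  by (simp add: gibbs_def sum_distrib_left mult.left_commute)

text \<open>Detailed balance of the heat bath: exchanging (\<sigma>, k) with
  (\<open>\<sigma>(u := k)\<close>, \<open>\<sigma> u\<close>) is an involution that keeps the
  product of the two weights and the normalisation \<open>D\<close>, which does not depend on the
  spin at \<open>u\<close>.\<close>

lemma gibbs_P: "gibbs (G.P f) = gibbs f"
proof -
  define w where "w = potts_weight \<beta> n"
  have one: "(\<Sum>\<sigma>\<in>configs q n. w \<sigma> * (\<Sum>k=1..q. g \<sigma> u k * f (\<sigma>(u := k)))) = (\<Sum>\<sigma>\<in>configs q n. w \<sigma> * f \<sigma>)"
    if u: "u \<in> {1..n}" for u
  proof -
    define D where "D = (\<lambda>\<sigma>. \<Sum>j=1..q. w (\<sigma>(u := j)))"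
    have D: "0 < D \<sigma>" for \<sigma> unfolding D_def w_def using q by (intro sum_pos potts_weight_pos) auto
    have D_upd: "D (\<sigma>(u := k)) = D \<sigma>" for \<sigma> k by (simp add: D_def)
    have "(\<Sum>\<sigma>\<in>configs q n. w \<sigma> * (\<Sum>k=1..q. g \<sigma> u k * f (\<sigma>(u := k))))
        = (\<Sum>(\<sigma>, k)\<in>configs q n \<times> {1..q}. w \<sigma> * w (\<sigma>(u := k)) * f (\<sigma>(u := k)) / D \<sigma>)"
      unfolding sum.cartesian_product[symmetric] sum_distrib_left
      using u by (intro sum.cong refl) (simp add: glauber_rule_weight D_def w_def)
    also have "\<dots> = (\<Sum>(\<sigma>, k)\<in>configs q n \<times> {1..q}. w \<sigma> * w (\<sigma>(u := k)) * f \<sigma> / D \<sigma>)"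
      by (rule sum.reindex_bij_witness[of _ "\<lambda>(\<sigma>, k). (\<sigma>(u := k), \<sigma> u)" "\<lambda>(\<sigma>, k). (\<sigma>(u := k), \<sigma> u)"])
        (use u configs_upd configs_range in \<open>auto simp: D_upd mult.commute\<close>)
    also have "\<dots> = (\<Sum>\<sigma>\<in>configs q n. w \<sigma> * f \<sigma> * (D \<sigma> / D \<sigma>))"
      unfolding sum.cartesian_product[symmetric] D_def[of] sum_divide_distrib sum_distrib_left
      by (intro sum.cong refl) simp
    also have "\<dots> = (\<Sum>\<sigma>\<in>configs q n. w \<sigma> * f \<sigma>)"
      using D by (intro sum.cong refl) (simp add: less_imp_neq[symmetric])
    finally show ?thesis .
  qed
  have "gibbs (G.P f) = (\<Sum>\<sigma>\<in>configs q n. \<Sum>u=1..n. w \<sigma> * (\<Sum>k=1..q. g \<sigma> u k * f (\<sigma>(u := k)))) / (n * potts_Z q \<beta> n)"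
    by (simp add: gibbs_def upd_op_def w_def sum_divide_distrib sum_distrib_left mult_ac)
  also have "\<dots> = (\<Sum>u=1..n. \<Sum>\<sigma>\<in>configs q n. w \<sigma> * f \<sigma>) / (n * potts_Z q \<beta> n)"
    by (subst sum.swap) (intro arg_cong2[where f = "(/)"] sum.cong refl one)
  also have "\<dots> = gibbs f"
    using n by (simp add: gibbs_def w_def sum_divide_distrib)
  finally show ?thesis .
qed

lemma gibbs_iter: "gibbs ((G.P ^^ t) f) = gibbs f"
  by (induction t) (auto simp: gibbs_P)

section \<open>Exchange symmetry of the vertices\<close>

lemma P_spin_swap:
  assumes vw: "v \<in> {1..n}" "w \<in> {1..n}"
  shows "G.P (\<lambda>\<sigma>. f (spin_swap v w \<sigma>)) \<sigma> = G.P f (spin_swap v w \<sigma>)"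
proof -
  let ?t = "Transposition.transpose v w"
  have t: "?t u \<in> {1..n} \<longleftrightarrow> u \<in> {1..n}" for u using vw by (auto simp: Transposition.transpose_def)
  have upd: "spin_swap v w (\<sigma>(u := k)) = (spin_swap v w \<sigma>)(?t u := k)" for u k
  proof (rule ext)
    fix x
    have "?t x = u \<longleftrightarrow> x = ?t u" by (metis transpose_involutory)
    then show "spin_swap v w (\<sigma>(u := k)) x = ((spin_swap v w \<sigma>)(?t u := k)) x"
      by (simp add: spin_swap_transpose)
  qed
  have rule: "g (spin_swap v w \<sigma>) (?t u) k = g \<sigma> u k" for u k
  proof -
    have "card {x\<in>{1..n} - {?t u}. spin_swap v w \<sigma> x = j} = card {x\<in>{1..n} - {u}. \<sigma> x = j}" for j
      using card_spin_swap[OF vw, of "{u}" \<sigma> j] by (simp only: image_insert image_empty)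
    then have "local_dev q n (spin_swap v w \<sigma>) (?t u) = local_dev q n \<sigma> u"
      unfolding local_dev_def by (intro ext) (simp only:)
    then show ?thesis by (simp only: glauber_rule_def)
  qed
  have "(\<Sum>u=1..n. \<Sum>k=1..q. g \<sigma> u k * f (spin_swap v w (\<sigma>(u := k))))
      = (\<Sum>u=1..n. \<Sum>k=1..q. g (spin_swap v w \<sigma>) u k * f ((spin_swap v w \<sigma>)(u := k)))"
  proof -
    have bij: "bij_betw ?t {1..n} {1..n}"
      by (rule bij_betwI[of _ _ _ ?t]) (use t in auto)
    define F where "F = (\<lambda>u. \<Sum>k=1..q. g (spin_swap v w \<sigma>) u k * f ((spin_swap v w \<sigma>)(u := k)))"
    have "(\<Sum>k=1..q. g \<sigma> u k * f (spin_swap v w (\<sigma>(u := k)))) = F (?t u)" for u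
      by (simp only: F_def upd rule)
    then show ?thesis using sum.reindex_bij_betw[OF bij, of F] by (simp only: F_def)
  qed
  then show ?thesis by (simp add: upd_op_def)
qed

lemma iter_spin_swap:
  assumes vw: "v \<in> {1..n}" "w \<in> {1..n}"
  shows "(G.P ^^ t) (\<lambda>\<sigma>. f (spin_swap v w \<sigma>)) \<sigma> = (G.P ^^ t) f (spin_swap v w \<sigma>)"
proof (induction t arbitrary: \<sigma>)
  case (Suc t)
  then have "(G.P ^^ t) (\<lambda>\<sigma>. f (spin_swap v w \<sigma>)) = (\<lambda>\<sigma>. (G.P ^^ t) f (spin_swap v w \<sigma>))" by blast
  then show ?case by (simp add: P_spin_swap[OF vw])
qed simp

text \<open>A swap inside a colour class fixes the starting configuration, so equivariance of the
  dynamics becomes invariance of its law.\<close>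

lemma pmf_glauber_law_spin_swap:
  assumes \<sigma>: "\<sigma> \<in> configs q n" and vw: "v \<in> {1..n}" "w \<in> {1..n}" "\<sigma> v = \<sigma> w"
  shows "pmf (glauber_law q \<beta> n \<sigma> t) (spin_swap v w \<tau>) = pmf (glauber_law q \<beta> n \<sigma> t) \<tau>"
proof -
  have pmf: "pmf (glauber_law q \<beta> n \<sigma> t) \<tau> = (G.P ^^ t) (indicator {\<tau>}) \<sigma>" for \<tau>
    using prob_glauber_law[OF \<sigma>, of t "{\<tau>}"] by (simp add: measure_pmf_single)
  have "indicator {spin_swap v w \<tau>} \<sigma> = (indicator {\<tau>} (spin_swap v w \<sigma>) :: real)" for \<sigma>
    by (auto simp: indicator_def spin_swap_twice)
  then have "(G.P ^^ t) (indicator {spin_swap v w \<tau>}) \<sigma> = (G.P ^^ t) (\<lambda>\<sigma>. indicator {\<tau>} (spin_swap v w \<sigma>)) \<sigma>"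
    by (intro arg_cong[where f = "\<lambda>h. (G.P ^^ t) h \<sigma>"]) (simp add: fun_eq_iff)
  also have "\<dots> = (G.P ^^ t) (indicator {\<tau>}) (spin_swap v w \<sigma>)" by (rule iter_spin_swap[OF vw(1,2)])
  also have "spin_swap v w \<sigma> = \<sigma>" using vw by (auto simp: spin_swap_def)
  finally show ?thesis by (simp add: pmf)
qed

lemma pmf_potts_spin_swap:
  assumes vw: "v \<in> {1..n}" "w \<in> {1..n}"
  shows "pmf (potts q \<beta> n) (spin_swap v w \<tau>) = pmf (potts q \<beta> n) \<tau>"
  using configs_spin_swap[OF vw, of \<tau> q] energy_spin_swap[OF vw, of q \<tau>]
  by (simp add: pmf_potts[OF q] potts_weight_energy[OF _ n q])

text \<open>The maximising event of the total variation distance is invariant under permutations inside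
  the initial colour classes.\<close>

lemma tv_dist_glauber_le:
  assumes \<sigma>: "\<sigma> \<in> configs q n"
    and bound: "\<And>f. (\<And>\<tau>. 0 \<le> f \<tau> \<and> f \<tau> \<le> 1) \<Longrightarrow>
      (\<And>c. swap_invariant {v\<in>{1..n}. \<sigma> v = c} f) \<Longrightarrow> (G.P ^^ t) f \<sigma> - gibbs f \<le> e"
  shows "tv_dist (glauber_law q \<beta> n \<sigma> t) (potts q \<beta> n) \<le> e"
proof -
  let ?p = "glauber_law q \<beta> n \<sigma> t" and ?p' = "potts q \<beta> n"
  define B where "B = {x. pmf ?p' x < pmf ?p x}"
  have "tv_dist ?p ?p' \<le> measure_pmf.prob ?p B - measure_pmf.prob ?p' B"
    unfolding B_def using set_pmf_glauber_law[OF \<sigma>]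
    by (intro tv_dist_le_positive_set[OF finite_configs]) (auto simp: set_pmf_potts[OF q])
  also have "\<dots> = (G.P ^^ t) (indicator B) \<sigma> - gibbs (indicator B)"
    by (simp add: prob_glauber_law[OF \<sigma>] prob_potts)
  also have "\<dots> \<le> e"
  proof (rule bound)
    fix c
    have "indicator B (spin_swap v w \<tau>) = (indicator B \<tau> :: real)"
      if "v \<in> {1..n}" "w \<in> {1..n}" "\<sigma> v = c" "\<sigma> w = c" for v w \<tau>
      using that by (simp add: B_def indicator_def pmf_glauber_law_spin_swap[OF \<sigma>] pmf_potts_spin_swap)
    then show "swap_invariant {v\<in>{1..n}. \<sigma> v = c} (indicator B)"
      by (auto simp: swap_invariant_def spin_swap_def)
  qed (auto simp: indicator_def)
  finally show ?thesis .
qed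

end

section \<open>Comparison of the two dynamics\<close>

lemma exp_le_quadratic: "exp x \<le> 1 + x + 3 * x\<^sup>2" if "\<bar>x\<bar> \<le> 1" for x :: real
proof -
  have "x * (exp x - 1) \<le> 3 * x\<^sup>2"
  proof (cases "0 \<le> x")
    case True
    have "exp x - 1 \<le> x * exp x" by (rule exp_minus_one_le)
    also have "\<dots> \<le> x * 3"
    proof (rule mult_left_mono[OF _ True])
      have "exp x \<le> exp 1" using that by simp
      then show "exp x \<le> 3" using exp_le by linarith
    qed
    finally have "x * (exp x - 1) \<le> x * (x * 3)" using True by (rule mult_left_mono)
    then show ?thesis by (simp add: power2_eq_square mult_ac)
  next
    case False
    have "(- x) * (1 - exp x) \<le> (- x) * (- x)"
      by (intro mult_left_mono) (use False exp_ge_add_one_self[of x] in linarith)+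
    moreover have "(- x) * (1 - exp x) = x * (exp x - 1)" by (simp add: algebra_simps)
    moreover have "(- x) * (- x) = x\<^sup>2" "0 \<le> x\<^sup>2" by (auto simp: power2_eq_square)
    ultimately show ?thesis by linarith
  qed
  then show ?thesis using exp_minus_one_le[of x] by (simp add: algebra_simps)
qed

text \<open>\<rho> \<le> 1/q keeps every colour class of a starting configuration at size n/(2q) or
  more, as the smoothing requires. 2 \<le> \<rho>n makes the single spin left out of a local field
  negligible against the clipping level.\<close>

locale potts_mixing = clipped_potts q n "2 * \<beta>" \<rho> for q n \<beta> \<rho> +
  assumes \<rho>_q: "\<rho> \<le> 1 / real q" and n_\<rho>: "2 \<le> \<rho> * real n"
begin

sublocale chain: potts_chain q n \<beta>
  by unfold_locales (use q n b in auto)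

abbreviation Gl where "Gl \<equiv> upd_op q n (glauber_rule q (2 * \<beta>) n)"

text \<open>At this level all deviations are at most \<rho>/2, and leaving out one spin adds at most
  another \<rho>/2, so clipping is inactive wherever \<open>bad\<close> vanishes.\<close>

definition bad where "bad \<sigma> = (if \<rho>\<^sup>2 / 4 < W \<sigma> then 1 else 0 :: real)"

lemma P_eq_Gl:
  assumes "bad \<sigma> = 0"
  shows "P f \<sigma> = Gl f \<sigma>"
proof -
  have W: "W \<sigma> \<le> (\<rho> / 2)\<^sup>2" using assms by (simp add: bad_def power_divide split: if_splits)
  have small: "\<bar>local_dev q n \<sigma> v k\<bar> \<le> \<rho>" if "v \<in> {1..n}" "k \<in> {1..q}" for v k
  proof -
    have "(z \<sigma> k)\<^sup>2 \<le> (\<rho> / 2)\<^sup>2" using color_dev_sq_le_energy[OF that(2)] W by (rule order_trans)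
    then have "\<bar>z \<sigma> k\<bar> \<le> \<rho> / 2" using power2_le_iff_abs_le[of "\<rho> / 2" "z \<sigma> k"] \<rho>(1) by simp
    moreover have "1 / n \<le> \<rho> / 2" using n_\<rho> n by (simp add: field_simps)
    moreover have "0 \<le> 1 / real n" by simp
    ultimately show ?thesis unfolding local_dev_eq[OF that(1)]
      by (cases "\<sigma> v = k"; simp; linarith)
  qed
  have "clipped_rule q (2 * \<beta>) \<rho> n \<sigma> v k = glauber_rule q (2 * \<beta>) n \<sigma> v k" if "v \<in> {1..n}" "k \<in> {1..q}" for v k
  proof -
    have "(\<Sum>j=1..q. exp (2 * \<beta> * clip \<rho> (local_dev q n \<sigma> v j))) = (\<Sum>j=1..q. exp (2 * \<beta> * local_dev q n \<sigma> v j))"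
      using small[OF that(1)] by (intro sum.cong refl) (simp add: clip_id)
    then show ?thesis using small[OF that] by (simp add: clipped_rule_def glauber_rule_def softmax_def clip_id)
  qed
  then show ?thesis by (simp add: upd_op_def)
qed

lemma one_step_comparison:
  assumes \<sigma>: "\<sigma> \<in> configs q n" and h: "\<And>\<tau>. \<tau> \<in> configs q n \<Longrightarrow> 0 \<le> h \<tau> \<and> h \<tau> \<le> 1"
  shows "\<bar>P h \<sigma> - Gl h \<sigma>\<bar> \<le> bad \<sigma>"
proof (cases "bad \<sigma> = 0")
  case True
  then show ?thesis using P_eq_Gl by simp
next
  case False
  then have "bad \<sigma> = 1" by (simp add: bad_def split: if_splits)
  moreover have "0 \<le> P h \<sigma>" "P h \<sigma> \<le> 1" "0 \<le> Gl h \<sigma>" "Gl h \<sigma> \<le> 1"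
    using P_mono[OF \<sigma>, of "\<lambda>_. 0" h] P_mono[OF \<sigma>, of h "\<lambda>_. 1"]
      chain.G.P_mono[OF \<sigma>, of "\<lambda>_. 0" h] chain.G.P_mono[OF \<sigma>, of h "\<lambda>_. 1"] h by auto
  ultimately show ?thesis by linarith
qed

lemma iter_unit_interval:
  assumes "update_chain q n s" "\<sigma> \<in> configs q n" "\<And>\<tau>. \<tau> \<in> configs q n \<Longrightarrow> 0 \<le> h \<tau> \<and> h \<tau> \<le> 1"
  shows "0 \<le> (upd_op q n s ^^ t) h \<sigma> \<and> (upd_op q n s ^^ t) h \<sigma> \<le> 1"
proof -
  interpret S: update_chain q n s by fact
  show ?thesis
    using S.iter_mono[OF assms(2), of "\<lambda>_. 0" h t] S.iter_mono[OF assms(2), of h "\<lambda>_. 1" t] assms(3) by auto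
qed

text \<open>Duhamel with the clipped chain in front: exits from the good region are counted along
  the clipped dynamics, for which the drift of the energy is known everywhere.\<close>

lemma iter_comparison:
  assumes \<sigma>: "\<sigma> \<in> configs q n" and f: "\<And>\<tau>. \<tau> \<in> configs q n \<Longrightarrow> 0 \<le> f \<tau> \<and> f \<tau> \<le> 1"
  shows "\<bar>(P ^^ t) f \<sigma> - (Gl ^^ t) f \<sigma>\<bar> \<le> (\<Sum>j<t. (P ^^ j) bad \<sigma>)"
  unfolding duhamel[OF update_chain_axioms chain.G.update_chain_axioms]
proof (intro order_trans[OF sum_abs] sum_mono)
  fix j
  show "\<bar>(P ^^ j) (\<lambda>\<sigma>. P ((Gl ^^ (t - 1 - j)) f) \<sigma> - Gl ((Gl ^^ (t - 1 - j)) f) \<sigma>) \<sigma>\<bar> \<le> (P ^^ j) bad \<sigma>"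
    by (intro iter_abs_le[OF \<sigma>] one_step_comparison iter_unit_interval chain.G.update_chain_axioms f)
qed

text \<open>Here the true dynamics stands in front. It preserves the Gibbs measure, so each step
  costs one Gibbs mass of the bad region.\<close>

lemma gibbs_comparison:
  assumes f: "\<And>\<tau>. \<tau> \<in> configs q n \<Longrightarrow> 0 \<le> f \<tau> \<and> f \<tau> \<le> 1"
  shows "\<bar>chain.gibbs ((P ^^ t) f) - chain.gibbs f\<bar> \<le> t * chain.gibbs bad"
proof -
  let ?d = "\<lambda>j \<sigma>. Gl ((P ^^ (t - 1 - j)) f) \<sigma> - P ((P ^^ (t - 1 - j)) f) \<sigma>"
  have gibbs_sum: "chain.gibbs (\<lambda>\<sigma>. \<Sum>j\<in>J. h j \<sigma>) = (\<Sum>j\<in>J. chain.gibbs (h j))" if "finite J" for J and h :: "nat \<Rightarrow> (nat \<Rightarrow> nat) \<Rightarrow> real"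
    using that by (induction J rule: finite_induct) (auto simp: chain.gibbs_add chain.gibbs_const)
  have "(\<lambda>\<sigma>. (Gl ^^ t) f \<sigma> - (P ^^ t) f \<sigma>) = (\<lambda>\<sigma>. \<Sum>j<t. (Gl ^^ j) (?d j) \<sigma>)"
    by (intro ext duhamel[OF chain.G.update_chain_axioms update_chain_axioms])
  then have "chain.gibbs (\<lambda>\<sigma>. (Gl ^^ t) f \<sigma> - (P ^^ t) f \<sigma>) = (\<Sum>j<t. chain.gibbs (?d j))"
    by (simp add: gibbs_sum chain.gibbs_iter)
  moreover have "chain.gibbs (\<lambda>\<sigma>. (Gl ^^ t) f \<sigma> - (P ^^ t) f \<sigma>) = chain.gibbs f - chain.gibbs ((P ^^ t) f)"
    using chain.gibbs_add[of "(Gl ^^ t) f" "\<lambda>\<sigma>. (- 1) * (P ^^ t) f \<sigma>"] chain.gibbs_cmult[of "- 1" "(P ^^ t) f"]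
    by (simp add: chain.gibbs_iter)
  moreover have "\<bar>\<Sum>j<t. chain.gibbs (?d j)\<bar> \<le> (\<Sum>j<t. chain.gibbs bad)"
  proof (intro order_trans[OF sum_abs] sum_mono)
    fix j
    have d: "\<bar>?d j \<sigma>\<bar> \<le> bad \<sigma>" if "\<sigma> \<in> configs q n" for \<sigma>
      using one_step_comparison[OF that iter_unit_interval[OF update_chain_axioms _ f]]
      by (simp add: abs_minus_commute)
    have "chain.gibbs (?d j) \<le> chain.gibbs bad"
      by (rule chain.gibbs_mono) (use d in \<open>force simp: abs_le_iff\<close>)
    moreover have "chain.gibbs (\<lambda>\<sigma>. (- 1) * ?d j \<sigma>) \<le> chain.gibbs bad"
      by (rule chain.gibbs_mono) (use d in \<open>force simp: abs_le_iff\<close>)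
    ultimately show "\<bar>chain.gibbs (?d j)\<bar> \<le> chain.gibbs bad"
      unfolding chain.gibbs_cmult by (simp add: abs_le_iff)
  qed
  ultimately show ?thesis by (simp add: abs_minus_commute)
qed

text \<open>\<open>exp (\<theta> n W)\<close> grows by a factor \<open>1 + O(1/n)\<close> per step, so that a walk started near balance
  leaves the unclipped region before time \<open>O(n log n)\<close> with exponentially small probability.\<close>

lemma P_exp_energy_le:
  fixes \<theta> :: real
  defines "\<theta> \<equiv> \<kappa> / 64"
  assumes \<sigma>: "\<sigma> \<in> configs q n"
  shows "P (\<lambda>\<tau>. exp (\<theta> * n * W \<tau>)) \<sigma> \<le> (1 + (2 * q + 26) / n) * exp (\<theta> * n * W \<sigma>)"
proof -
  define X where "X = (\<lambda>\<tau>. n * (W \<tau> - W \<sigma>))"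
  have \<theta>: "0 < \<theta>" "\<theta> \<le> 1 / 64" using \<kappa>_pos \<kappa>_le by (auto simp: \<theta>_def)
  have up: "exp (\<theta> * X \<tau>) \<le> (1 + 96 * \<theta>\<^sup>2 * W \<sigma> + 24 * \<theta>\<^sup>2 / n) + \<theta> * X \<tau>" if \<tau>: "\<exists>v\<in>{1..n}. \<exists>k\<in>{1..q}. \<tau> = \<sigma>(v := k)" for \<tau>
  proof -
    obtain v k where v: "v \<in> {1..n}" and k: "k \<in> {1..q}" and "\<tau> = \<sigma>(v := k)" using \<tau> by blast
    note l = configs_range[OF \<sigma> v]
    define e where "e = (if k = \<sigma> v then 0 else 2) / real n"
    define d where "d = 2 * (z \<sigma> k - z \<sigma> (\<sigma> v))"
    have X: "X \<tau> = d + e"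
      unfolding X_def \<open>\<tau> = \<sigma>(v := k)\<close> energy_upd[of v n \<sigma> q k, OF v l k] e_def d_def using n
      by (simp add: power2_eq_square distrib_left)
    have e: "0 \<le> e" "e \<le> 2 / n" "e \<le> 2" using n by (auto simp: e_def field_simps)
    have "\<bar>z \<sigma> k - z \<sigma> (\<sigma> v)\<bar> \<le> 1"
      using color_dev_range[of q n \<sigma> k] color_dev_range[of q n \<sigma> "\<sigma> v"] by (simp add: abs_le_iff)
    then have "\<bar>X \<tau>\<bar> \<le> 4" unfolding X d_def using e by (simp add: abs_le_iff)
    then have "\<bar>\<theta> * X \<tau>\<bar> \<le> 1 / 64 * 4" unfolding abs_mult using \<theta> by (intro mult_mono) auto
    then have ex: "exp (\<theta> * X \<tau>) \<le> 1 + \<theta> * X \<tau> + 3 * (\<theta> * X \<tau>)\<^sup>2" by (intro exp_le_quadratic) simp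
    have "(X \<tau>)\<^sup>2 \<le> 2 * d\<^sup>2 + 2 * e\<^sup>2"
      unfolding X using sum_squares_bound[of d e] by (simp add: power2_sum)
    moreover have "d\<^sup>2 \<le> 8 * ((z \<sigma> k)\<^sup>2 + (z \<sigma> (\<sigma> v))\<^sup>2)"
    proof -
      have "0 \<le> (z \<sigma> k + z \<sigma> (\<sigma> v))\<^sup>2" by simp
      then show ?thesis by (simp add: d_def power2_eq_square algebra_simps)
    qed
    moreover have "(z \<sigma> k)\<^sup>2 \<le> W \<sigma>" "(z \<sigma> (\<sigma> v))\<^sup>2 \<le> W \<sigma>"
      using color_dev_sq_le_energy k l by blast+
    moreover have "e\<^sup>2 \<le> 4 / n"
    proof -
      have "e * e \<le> 2 / n * 2" using e by (intro mult_mono) auto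
      then show ?thesis by (simp add: power2_eq_square)
    qed
    ultimately have "(X \<tau>)\<^sup>2 \<le> 32 * W \<sigma> + 8 / n" by simp
    then have "3 * \<theta>\<^sup>2 * (X \<tau>)\<^sup>2 \<le> 3 * \<theta>\<^sup>2 * (32 * W \<sigma> + 8 / n)" by (intro mult_left_mono) auto
    then show ?thesis using ex by (simp add: power_mult_distrib algebra_simps)
  qed
  have "P (\<lambda>\<tau>. exp (\<theta> * X \<tau>)) \<sigma> \<le> P (\<lambda>\<tau>. (1 + 96 * \<theta>\<^sup>2 * W \<sigma> + 24 * \<theta>\<^sup>2 / n) + \<theta> * X \<tau>) \<sigma>"
    unfolding upd_op_def
  proof (intro divide_right_mono sum_mono mult_left_mono rule_nonneg)
    fix v k assume "v \<in> {1..n}" "k \<in> {1..q}"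
    then show "exp (\<theta> * X (\<sigma>(v := k))) \<le> (1 + 96 * \<theta>\<^sup>2 * W \<sigma> + 24 * \<theta>\<^sup>2 / n) + \<theta> * X (\<sigma>(v := k))"
      by (intro up) blast
  qed auto
  also have "\<dots> = (1 + 96 * \<theta>\<^sup>2 * W \<sigma> + 24 * \<theta>\<^sup>2 / n) + \<theta> * (n * (P W \<sigma> - W \<sigma>))"
    unfolding X_def P_add P_cmult P_const P_diff ..
  also have "\<dots> \<le> (1 + 96 * \<theta>\<^sup>2 * W \<sigma> + 24 * \<theta>\<^sup>2 / n) + \<theta> * (- (3 / 2) * \<kappa> * W \<sigma> + (2 * q + 2) / n)"
  proof (intro add_left_mono mult_left_mono)
    have "n * (P W \<sigma> - W \<sigma>) \<le> n * ((1 - 3 / 2 * \<kappa> / n) * W \<sigma> + (2 * q + 2) / (real n)\<^sup>2 - W \<sigma>)"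
      using P_energy_le[OF \<sigma>] by (intro mult_left_mono) auto
    also have "\<dots> = - (3 / 2) * \<kappa> * W \<sigma> + (2 * q + 2) / n"
      using n by (simp add: field_simps power2_eq_square)
    finally show "n * (P W \<sigma> - W \<sigma>) \<le> - (3 / 2) * \<kappa> * W \<sigma> + (2 * q + 2) / n" .
  qed (use \<theta> in auto)
  also have "\<dots> = 1 + (24 * \<theta>\<^sup>2 + \<theta> * (2 * q + 2)) / n"
  proof -
    \<comment> \<open>\<theta> = \<kappa>/64 makes the second-order term of the exponential cancel
      the energy drift exactly.\<close>
    have "96 * \<theta>\<^sup>2 * W \<sigma> = \<theta> * (3 / 2 * \<kappa> * W \<sigma>)" by (simp add: \<theta>_def power2_eq_square)
    then show ?thesis by (simp only:) (simp add: algebra_simps add_divide_distrib)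
  qed
  also have "\<dots> \<le> 1 + (2 * q + 26) / n"
  proof -
    have "\<theta>\<^sup>2 \<le> 1" using \<theta> by (simp add: power_le_one)
    then have "24 * \<theta>\<^sup>2 + \<theta> * real (2 * q + 2) \<le> 24 * 1 + 1 * real (2 * q + 2)"
      using \<theta> by (intro add_mono mult_left_mono mult_right_mono) auto
    then have "24 * \<theta>\<^sup>2 + \<theta> * real (2 * q + 2) \<le> real (2 * q + 26)" by simp
    then show ?thesis by (intro add_left_mono divide_right_mono) auto
  qed
  finally have main: "P (\<lambda>\<tau>. exp (\<theta> * X \<tau>)) \<sigma> \<le> 1 + (2 * q + 26) / n" .
  have "P (\<lambda>\<tau>. exp (\<theta> * n * W \<tau>)) \<sigma> = P (\<lambda>\<tau>. exp (\<theta> * n * W \<sigma>) * exp (\<theta> * X \<tau>)) \<sigma>"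
    by (simp add: X_def algebra_simps flip: exp_add)
  also have "\<dots> = exp (\<theta> * n * W \<sigma>) * P (\<lambda>\<tau>. exp (\<theta> * X \<tau>)) \<sigma>" by (rule P_cmult)
  also have "\<dots> \<le> exp (\<theta> * n * W \<sigma>) * (1 + (2 * q + 26) / n)" by (intro mult_left_mono main) auto
  finally show ?thesis by (simp add: mult.commute)
qed

text \<open>Markov's inequality for the exponential of the energy. The start lies below \<rho>^2/8
  and the exit level is \<rho>^2/4, so the exponent is \<kappa>/64 times \<rho>^2/8.\<close>

lemma iter_bad_le:
  assumes \<sigma>: "\<sigma> \<in> configs q n" and W: "W \<sigma> \<le> \<rho>\<^sup>2 / 8"
  shows "(P ^^ t) bad \<sigma> \<le> exp ((2 * q + 26) * t / n - \<kappa> * \<rho>\<^sup>2 / 512 * n)"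
proof -
  define \<theta> where "\<theta> = \<kappa> / 64"
  have \<theta>: "0 < \<theta>" using \<kappa>_pos by (simp add: \<theta>_def)
  let ?F = "\<lambda>\<tau>. exp (\<theta> * n * W \<tau>)"
  have "(P ^^ t) bad \<sigma> \<le> (P ^^ t) (\<lambda>\<tau>. exp (- \<theta> * n * (\<rho>\<^sup>2 / 4)) * ?F \<tau>) \<sigma>"
  proof (rule iter_mono[OF \<sigma>])
    fix \<tau>
    have "1 \<le> exp (- \<theta> * n * (\<rho>\<^sup>2 / 4)) * ?F \<tau>" if "\<rho>\<^sup>2 / 4 < W \<tau>"
    proof -
      have "\<theta> * n * (\<rho>\<^sup>2 / 4) \<le> \<theta> * n * W \<tau>" using that \<theta> by (intro mult_left_mono) auto
      then show ?thesis by (simp flip: exp_add)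
    qed
    then show "bad \<tau> \<le> exp (- \<theta> * n * (\<rho>\<^sup>2 / 4)) * ?F \<tau>" by (auto simp: bad_def)
  qed
  also have "\<dots> = exp (- \<theta> * n * (\<rho>\<^sup>2 / 4)) * (P ^^ t) ?F \<sigma>" by (rule iter_cmult)
  also have "\<dots> \<le> exp (- \<theta> * n * (\<rho>\<^sup>2 / 4)) * (exp ((2 * q + 26) * t / n) * exp (\<theta> * n * (\<rho>\<^sup>2 / 8)))"
  proof (rule mult_left_mono)
    have "(P ^^ t) ?F \<sigma> \<le> (1 + (2 * q + 26) / n) ^ t * ?F \<sigma>"
      by (rule iter_geometric_le[OF \<sigma>]) (use P_exp_energy_le in \<open>auto simp: \<theta>_def\<close>)
    also have "\<dots> \<le> exp ((2 * q + 26) * t / n) * exp (\<theta> * n * (\<rho>\<^sup>2 / 8))"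
    proof (rule mult_mono)
      have "(1 + (2 * q + 26) / n) ^ t \<le> exp ((2 * q + 26) / n) ^ t"
        by (intro power_mono exp_ge_add_one_self) auto
      then show "(1 + (2 * q + 26) / n) ^ t \<le> exp ((2 * q + 26) * t / n)"
        by (simp add: mult.commute flip: exp_of_nat_mult)
      show "?F \<sigma> \<le> exp (\<theta> * n * (\<rho>\<^sup>2 / 8))" using W \<theta> by (simp add: mult_left_mono)
    qed auto
    finally show "(P ^^ t) ?F \<sigma> \<le> exp ((2 * q + 26) * t / n) * exp (\<theta> * n * (\<rho>\<^sup>2 / 8))" .
  qed auto
  also have "\<dots> = exp ((2 * q + 26) * t / n - \<kappa> * \<rho>\<^sup>2 / 512 * n)"
    by (simp add: \<theta>_def flip: exp_add)
  finally show ?thesis .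
qed

definition exit_bound :: "real \<Rightarrow> real" where
  "exit_bound (T :: real) = T * exp (real (2 * q + 26) * T / real n - \<kappa> * \<rho>\<^sup>2 / 512 * n)"

lemma sum_iter_bad_le:
  fixes T :: real
  assumes \<sigma>: "\<sigma> \<in> configs q n" and W: "W \<sigma> \<le> \<rho>\<^sup>2 / 8" and T: "real t \<le> T"
  shows "(\<Sum>j<t. (P ^^ j) bad \<sigma>) \<le> exit_bound T"
proof -
  have "(\<Sum>j<t. (P ^^ j) bad \<sigma>) \<le> (\<Sum>j<t. exp (real (2 * q + 26) * T / real n - \<kappa> * \<rho>\<^sup>2 / 512 * n))"
  proof (rule sum_mono)
    fix j assume "j \<in> {..<t}"
    then have "real (2 * q + 26) * real j / real n \<le> real (2 * q + 26) * T / real n"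
      using T by (intro divide_right_mono mult_left_mono) auto
    then show "(P ^^ j) bad \<sigma> \<le> exp (real (2 * q + 26) * T / real n - \<kappa> * \<rho>\<^sup>2 / 512 * n)"
      using iter_bad_le[OF \<sigma> W, of j] by (simp add: order_trans)
  qed
  also have "\<dots> \<le> exit_bound T"
    using T by (simp add: exit_bound_def)
  finally show ?thesis .
qed

section \<open>Upper bound on the distance to equilibrium\<close>

lemma lipw_\<phi>: "lipw \<phi> (3 / n)"
  unfolding lipw_def
proof (intro ballI)
  fix \<sigma> v k assume "\<sigma> \<in> configs q n" "v \<in> {1..n}" "k \<in> {1..q}"
  then have "\<bar>\<phi> \<sigma> - \<phi> (\<sigma>(v := k))\<bar> \<le> 3 / n * 1" using \<phi>_lip by simp
  also have "\<dots> \<le> 3 / n * wgt \<sigma>" using wgt_ge_1 by (intro mult_left_mono) auto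
  finally show "\<bar>\<phi> \<sigma> - \<phi> (\<sigma>(v := k))\<bar> \<le> 3 / n * wgt \<sigma>" .
qed

text \<open>The drift of the imbalance alone has only the rate 3/4 \<kappa>. The oscillation of its
  iterates decays at the sharp rate, so an arbitrary start is compared with a reference
  \<open>\<tau>\<close>, later a balanced one, for which the weaker drift maintains the level
  n^-1/2.\<close>

lemma iter_\<phi>_le:
  assumes \<sigma>: "\<sigma> \<in> configs q n" and \<tau>: "\<tau> \<in> configs q n"
  shows "(P ^^ t) \<phi> \<sigma> \<le> 3 * rate ^ t * (1 + K * (real q + 1)) + \<phi> \<tau> + 2 * (q + 2) / (\<kappa> * sqrt n)"
proof -
  have "\<bar>(P ^^ t) \<phi> \<sigma> - (P ^^ t) \<phi> \<tau>\<bar> \<le> n * (rate ^ t * (3 / n) * (1 + K * (real q + 1)))"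
    by (rule lipw_oscillation[OF lipw_iter[OF lipw_\<phi>] _ \<sigma> \<tau>]) (use rate_nonneg in auto)
  also have "\<dots> = 3 * rate ^ t * (1 + K * (real q + 1))" using n by simp
  finally have 1: "(P ^^ t) \<phi> \<sigma> \<le> 3 * rate ^ t * (1 + K * (real q + 1)) + (P ^^ t) \<phi> \<tau>" by (simp add: abs_le_iff)
  define a where "a = 1 - 3 / 4 * \<kappa> / n"
  have a: "0 \<le> a" "a < 1"
  proof -
    have "3 / 4 * \<kappa> / n \<le> 1" using \<kappa>_le n by (simp add: divide_le_eq)
    moreover have "0 < 3 / 4 * \<kappa> / n" using \<kappa>_pos n by simp
    ultimately show "0 \<le> a" "a < 1" by (auto simp: a_def)
  qed
  have "(P ^^ t) \<phi> \<tau> \<le> a ^ t * \<phi> \<tau> + (q + 2) / (n * sqrt n) / (1 - a)"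
    by (rule iter_affine_le[OF \<tau> a]) (use P_\<phi>_le in \<open>auto simp: a_def\<close>)
  also have "\<dots> \<le> 1 * \<phi> \<tau> + 2 * (q + 2) / (\<kappa> * sqrt n)"
  proof (rule add_mono)
    show "a ^ t * \<phi> \<tau> \<le> 1 * \<phi> \<tau>"
      using a \<phi>_pos[of \<tau>] by (intro mult_right_mono power_le_one) auto
    have "(q + 2) / (n * sqrt n) / (1 - a) = 4 / 3 * ((q + 2) / (\<kappa> * sqrt n))"
      using n \<kappa>_pos by (simp add: a_def field_simps)
    also have "\<dots> \<le> 2 * ((q + 2) / (\<kappa> * sqrt n))" using \<kappa>_pos by (intro mult_right_mono) auto
    finally show "(q + 2) / (n * sqrt n) / (1 - a) \<le> 2 * (q + 2) / (\<kappa> * sqrt n)" by simp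
  qed
  finally show ?thesis using 1 by simp
qed

text \<open>Both rules have total mass 1, so only differences of \<open>h\<close> count, and the
  colour law differs from the uniform one by an amount linear in the imbalance. Gradient and
  imbalance thus multiply.\<close>

lemma P_uniform_diff:
  assumes \<sigma>: "\<sigma> \<in> configs q n"
    and h: "\<And>v k. v \<in> {1..n} \<Longrightarrow> k \<in> {1..q} \<Longrightarrow> \<bar>h \<sigma> - h (\<sigma>(v := k))\<bar> \<le> B"
  shows "\<bar>P h \<sigma> - upd_op q n (uniform_rule q) h \<sigma>\<bar> \<le> 2 * C1 * B * \<phi> \<sigma>"
proof -
  have B0: "0 \<le> B" using h[of 1 1] q n abs_ge_zero[of "h \<sigma> - h (\<sigma>(1 := 1))"] by auto
  have inner: "\<bar>\<Sum>k=1..q. (r \<sigma> v k - 1 / q) * h (\<sigma>(v := k))\<bar> \<le> 2 * C1 * B * \<phi> \<sigma>" if v: "v \<in> {1..n}" for v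
  proof -
    have "(\<Sum>k=1..q. (r \<sigma> v k - 1 / q) * h (\<sigma>(v := k))) = (\<Sum>k=1..q. (r \<sigma> v k - 1 / q) * (h (\<sigma>(v := k)) - h \<sigma>))"
    proof -
      have "(\<Sum>k=1..q. (r \<sigma> v k - 1 / q) * h \<sigma>) = ((\<Sum>k=1..q. r \<sigma> v k) - 1) * h \<sigma>"
        unfolding sum_distrib_right[symmetric] sum_subtractf using q by simp
      then show ?thesis by (simp only: rule_sum right_diff_distrib sum_subtractf) simp
    qed
    also have "\<bar>\<dots>\<bar> \<le> (\<Sum>k=1..q. 2 * C1 * \<phi> \<sigma> / q * B)"
    proof (intro order_trans[OF sum_abs] sum_mono)
      fix k assume k: "k \<in> {1..q}"
      define s where "s = min \<rho> (2 * \<phi> \<sigma>)"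
      have s: "0 \<le> s" "s \<le> 1" using \<rho> \<phi>_pos[of \<sigma>] by (auto simp: s_def)
      have n_\<phi>: "1 / n \<le> \<phi> \<sigma>"
      proof -
        have "sqrt 1 \<le> sqrt n" using n by (intro real_sqrt_le_mono) auto
        then have "1 / n \<le> 1 / sqrt n"
          using n real_sqrt_mult_self[of "real n"] mult_left_mono[of 1 "sqrt n" "sqrt n"]
          by (intro divide_left_mono) auto
        then show ?thesis using \<phi>_ge[of \<sigma>] by simp
      qed
      have "\<bar>clip \<rho> (local_dev q n \<sigma> v j)\<bar> \<le> s" if j: "j \<in> {1..q}" for j
      proof -
        have "0 \<le> 1 / real n" by simp
        then have "\<bar>local_dev q n \<sigma> v j\<bar> \<le> 2 * \<phi> \<sigma>"
          using abs_z_le_\<phi>[OF j, of \<sigma>] n_\<phi> unfolding local_dev_eq[OF v]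
          by (cases "\<sigma> v = j"; simp; linarith)
        then show ?thesis using clip_bound[of \<rho> "local_dev q n \<sigma> v j"] \<rho> by (auto simp: s_def)
      qed
      then have "\<bar>r \<sigma> v k - 1 / q\<bar> \<le> (exp (2 * (2 * \<beta>) * s) - 1) / q"
        unfolding clipped_rule_def using k by (intro softmax_uniform_diff q b) auto
      also have "\<dots> \<le> 2 * C1 * \<phi> \<sigma> / q"
      proof (rule divide_right_mono)
        have "exp (2 * (2 * \<beta>) * s) - 1 \<le> C1 * s" using exp_2b_le[OF s] by simp
        also have "\<dots> \<le> C1 * (2 * \<phi> \<sigma>)" using C1_nonneg by (intro mult_left_mono) (auto simp: s_def)
        finally show "exp (2 * (2 * \<beta>) * s) - 1 \<le> 2 * C1 * \<phi> \<sigma>" by simp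
      qed auto
      finally have "\<bar>r \<sigma> v k - 1 / q\<bar> \<le> 2 * C1 * \<phi> \<sigma> / q" .
      then show "\<bar>(r \<sigma> v k - 1 / q) * (h (\<sigma>(v := k)) - h \<sigma>)\<bar> \<le> 2 * C1 * \<phi> \<sigma> / q * B"
        unfolding abs_mult using h[OF v k] C1_nonneg \<phi>_pos[of \<sigma>]
        by (intro mult_mono) (auto simp: abs_minus_commute)
    qed
    also have "\<dots> = 2 * C1 * B * \<phi> \<sigma>" using q by simp
    finally show ?thesis .
  qed
  have "P h \<sigma> - upd_op q n (uniform_rule q) h \<sigma> = (\<Sum>v=1..n. \<Sum>k=1..q. (r \<sigma> v k - 1 / q) * h (\<sigma>(v := k))) / n"
    by (simp add: upd_op_def uniform_rule_def left_diff_distrib sum_subtractf diff_divide_distrib)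
  also have "\<bar>\<dots>\<bar> \<le> (\<Sum>v=1..n. 2 * C1 * B * \<phi> \<sigma>) / n"
    unfolding abs_divide abs_of_nat
  proof (rule divide_right_mono)
    show "\<bar>\<Sum>v=1..n. \<Sum>k=1..q. (r \<sigma> v k - 1 / q) * h (\<sigma>(v := k))\<bar> \<le> (\<Sum>v=1..n. 2 * C1 * B * \<phi> \<sigma>)"
      by (rule order_trans[OF sum_abs sum_mono[OF inner]])
  qed simp
  also have "\<dots> = 2 * C1 * B * \<phi> \<sigma>" using n by simp
  finally show ?thesis .
qed

lemma sum_inverse_sqrt_le: "(\<Sum>i<m. 1 / sqrt (real i + 1)) \<le> 2 * sqrt m"
proof (induction m)
  case (Suc m)
  have "sqrt m * sqrt (real m + 1) \<le> m + 1 / 2"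
  proof -
    have "0 \<le> (sqrt m - sqrt (real m + 1))\<^sup>2" by simp
    then show ?thesis by (simp add: power2_eq_square algebra_simps)
  qed
  then have "(2 * sqrt m + 1 / sqrt (real m + 1)) * sqrt (real m + 1) \<le> 2 * sqrt (real m + 1) * sqrt (real m + 1)"
    by (simp add: algebra_simps)
  then have "2 * sqrt m + 1 / sqrt (real m + 1) \<le> 2 * sqrt (real m + 1)"
    by (subst (asm) mult_le_cancel_right_pos) (auto intro: real_sqrt_gt_zero)
  then show ?case using Suc by (simp add: add.commute)
qed simp

text \<open>The numerator 1 + 3q/\<gamma> of \<open>uniform_smoothing\<close> at \<gamma> =
  1/(2q).\<close>

definition smooth_const where "smooth_const = 1 + 6 * (real q * real q)"

lemma color_class_size:
  assumes \<sigma>: "\<sigma> \<in> configs q n" and W: "W \<sigma> \<le> \<rho>\<^sup>2 / 8" and c: "c \<in> {1..q}"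
  shows "1 / (2 * real q) * n \<le> card {v\<in>{1..n}. \<sigma> v = c}"
proof -
  have "(z \<sigma> c)\<^sup>2 \<le> \<rho>\<^sup>2 / 8" using color_dev_sq_le_energy[OF c] W by (rule order_trans)
  also have "\<dots> \<le> (1 / (2 * real q))\<^sup>2"
  proof -
    have "\<rho>\<^sup>2 \<le> (1 / real q)\<^sup>2" using \<rho>_q \<rho>(1) by (intro power_mono) auto
    moreover have "(1 / (2 * real q))\<^sup>2 = (1 / real q)\<^sup>2 / 4" by (simp add: power_divide power_mult_distrib)
    moreover have "0 \<le> (1 / real q)\<^sup>2" by simp
    ultimately show ?thesis by linarith
  qed
  finally have "\<bar>z \<sigma> c\<bar> \<le> 1 / (2 * real q)"
    using power2_le_iff_abs_le[of "1 / (2 * real q)" "z \<sigma> c"] by simp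
  then have "1 / (2 * real q) \<le> color_count n \<sigma> c / n"
    by (simp add: color_dev_def abs_le_iff field_simps)
  then show ?thesis using n by (simp add: color_count_def field_simps)
qed

lemma uniform_iter_gradient:
  assumes \<sigma>: "\<sigma> \<in> configs q n" and W: "W \<sigma> \<le> \<rho>\<^sup>2 / 8"
    and f: "\<And>\<tau>. 0 \<le> f \<tau> \<and> f \<tau> \<le> 1" "\<And>c. swap_invariant {v\<in>{1..n}. \<sigma> v = c} f" and j: "j \<le> n"
    and \<tau>: "\<tau> \<in> configs q n" "v \<in> {1..n}" "k \<in> {1..q}"
  shows "\<bar>(upd_op q n (uniform_rule q) ^^ j) f \<tau> - (upd_op q n (uniform_rule q) ^^ j) f (\<tau>(v := k))\<bar>
    \<le> smooth_const / sqrt (real j + 1)"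
proof -
  have "\<bar>(upd_op q n (uniform_rule q) ^^ j) f (\<tau>(v := \<tau> v)) - (upd_op q n (uniform_rule q) ^^ j) f (\<tau>(v := k))\<bar>
      \<le> (1 + 3 * q / (1 / (2 * real q))) / sqrt (real j + 1)"
    \<comment> \<open>The class used is that of \<open>v\<close> in the initial configuration
      \<open>\<sigma>\<close>, where the class sizes and the symmetry of \<open>f\<close> are known,
      not in \<open>\<tau>\<close>.\<close>
    using color_class_size[OF \<sigma> W configs_range[OF \<sigma> \<tau>(2)]] f \<tau> q configs_range[OF \<tau>(1,2)]
    by (intro uniform_smoothing[where I = "{u\<in>{1..n}. \<sigma> u = \<sigma> v}"] n j) (auto simp: abs_le_iff intro: order_trans)
  then show ?thesis by (simp add: smooth_const_def)
qed

text \<open>The last \<open>m\<close> steps are exchanged for uniform recolouring, at the cost of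
  the imbalance A / sqrt n times the summed gradients, of order sqrt m, once for each of the two
  starts. What is left has gradient of order (m + 1)^-1/2, which the first \<open>t\<close> steps
  contract.\<close>

lemma oscillation_le:
  assumes \<sigma>: "\<sigma> \<in> configs q n" and W: "W \<sigma> \<le> \<rho>\<^sup>2 / 8"
    and f: "\<And>\<tau>. 0 \<le> f \<tau> \<and> f \<tau> \<le> 1" "\<And>c. swap_invariant {v\<in>{1..n}. \<sigma> v = c} f"
    and m: "m \<le> n" and A: "\<And>\<tau> j. \<tau> \<in> configs q n \<Longrightarrow> t \<le> j \<Longrightarrow> (P ^^ j) \<phi> \<tau> \<le> A / sqrt n"
    and \<tau>: "\<tau> \<in> configs q n" "\<tau>' \<in> configs q n"
  shows "(P ^^ (t + m)) f \<tau> - (P ^^ (t + m)) f \<tau>'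
     \<le> 8 * C1 * smooth_const * A * sqrt (m / n) + n * rate ^ t * smooth_const / sqrt (real m + 1) * (1 + K * (real q + 1))"
proof -
  let ?R = "upd_op q n (uniform_rule q)"
  have R: "update_chain q n (uniform_rule q)" by (rule update_chain_uniform[OF n q])
  note grad = uniform_iter_gradient[OF \<sigma> W f]
  have S0: "0 \<le> smooth_const" by (simp add: smooth_const_def)
  have A0: "0 \<le> A"
  proof -
    have "0 \<le> (P ^^ t) \<phi> \<sigma>" using iter_mono[OF \<sigma>, of "\<lambda>_. 0" \<phi> t] less_imp_le[OF \<phi>_pos] by simp
    also have "\<dots> \<le> A / sqrt n" by (rule A[OF \<sigma>]) simp
    finally show ?thesis using n by (simp add: zero_le_divide_iff)
  qed
  have near: "\<bar>(P ^^ (t + m)) f \<tau> - (P ^^ t) ((?R ^^ m) f) \<tau>\<bar> \<le> 4 * C1 * smooth_const * A * sqrt (m / n)"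
    if \<tau>: "\<tau> \<in> configs q n" for \<tau>
  proof -
    let ?d = "\<lambda>j \<tau>. P ((?R ^^ (m - 1 - j)) f) \<tau> - ?R ((?R ^^ (m - 1 - j)) f) \<tau>"
    have iter_sum: "(P ^^ t) (\<lambda>\<sigma>. \<Sum>j\<in>J. h j \<sigma>) \<tau> = (\<Sum>j\<in>J. (P ^^ t) (h j) \<tau>)" if "finite J" for J and h :: "nat \<Rightarrow> (nat \<Rightarrow> nat) \<Rightarrow> real" and \<tau>
      using that by (induction J rule: finite_induct) (auto simp: iter_add)
    have "(P ^^ (t + m)) f \<tau> - (P ^^ t) ((?R ^^ m) f) \<tau> = (P ^^ t) (\<lambda>\<tau>. (P ^^ m) f \<tau> - (?R ^^ m) f \<tau>) \<tau>"
      by (simp add: iter_diff funpow_add)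
    also have "(\<lambda>\<tau>. (P ^^ m) f \<tau> - (?R ^^ m) f \<tau>) = (\<lambda>\<tau>. \<Sum>j<m. (P ^^ j) (?d j) \<tau>)"
      by (intro ext duhamel[OF update_chain_axioms R])
    also have "(P ^^ t) (\<lambda>\<tau>. \<Sum>j<m. (P ^^ j) (?d j) \<tau>) \<tau> = (\<Sum>j<m. (P ^^ (t + j)) (?d j) \<tau>)"
      by (simp add: iter_sum funpow_add)
    finally have eq: "(P ^^ (t + m)) f \<tau> - (P ^^ t) ((?R ^^ m) f) \<tau> = (\<Sum>j<m. (P ^^ (t + j)) (?d j) \<tau>)" .
    have "\<bar>(P ^^ (t + m)) f \<tau> - (P ^^ t) ((?R ^^ m) f) \<tau>\<bar>
        \<le> (\<Sum>j<m. 2 * C1 * smooth_const * (A / sqrt n) * (1 / sqrt (real (m - Suc j) + 1)))"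
      unfolding eq
    proof (intro order_trans[OF sum_abs] sum_mono)
      fix j assume j: "j \<in> {..<m}"
      define B where "B = smooth_const / sqrt (real (m - 1 - j) + 1)"
      have B0: "0 \<le> B" using S0 by (simp add: B_def)
      have "\<bar>(P ^^ (t + j)) (?d j) \<tau>\<bar> \<le> (P ^^ (t + j)) (\<lambda>\<tau>. 2 * C1 * B * \<phi> \<tau>) \<tau>"
      proof (rule iter_abs_le[OF \<tau>], rule P_uniform_diff)
        fix \<tau>' v k assume "\<tau>' \<in> configs q n" "v \<in> {1..n}" "k \<in> {1..q}"
        then show "\<bar>(?R ^^ (m - 1 - j)) f \<tau>' - (?R ^^ (m - 1 - j)) f (\<tau>'(v := k))\<bar> \<le> B"
          unfolding B_def using m by (intro grad) auto
      qed
      also have "\<dots> = 2 * C1 * B * (P ^^ (t + j)) \<phi> \<tau>" by (rule iter_cmult)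
      also have "\<dots> \<le> 2 * C1 * B * (A / sqrt n)"
        using A[OF \<tau>, of "t + j"] C1_nonneg B0 by (intro mult_left_mono) auto
      finally show "\<bar>(P ^^ (t + j)) (?d j) \<tau>\<bar> \<le> 2 * C1 * smooth_const * (A / sqrt n) * (1 / sqrt (real (m - Suc j) + 1))"
        by (simp add: B_def mult_ac)
    qed
    also have "\<dots> = 2 * C1 * smooth_const * (A / sqrt n) * (\<Sum>j<m. 1 / sqrt (real j + 1))"
      unfolding sum_distrib_left[symmetric]
      by (subst sum.nat_diff_reindex[of "\<lambda>j. 1 / sqrt (real j + 1)" m]) simp
    also have "\<dots> \<le> 2 * C1 * smooth_const * (A / sqrt n) * (2 * sqrt m)"
      using C1_nonneg S0 A0 by (intro mult_left_mono sum_inverse_sqrt_le) auto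
    also have "\<dots> = 4 * C1 * smooth_const * A * sqrt (m / n)" by (simp add: real_sqrt_divide)
    finally show ?thesis .
  qed
  have "\<bar>(P ^^ t) ((?R ^^ m) f) \<tau> - (P ^^ t) ((?R ^^ m) f) \<tau>'\<bar>
      \<le> n * (rate ^ t * (smooth_const / sqrt (real m + 1)) * (1 + K * (real q + 1)))"
  proof (rule lipw_oscillation[OF lipw_iter _ \<tau>])
    show "lipw ((?R ^^ m) f) (smooth_const / sqrt (real m + 1))"
      unfolding lipw_def
    proof (intro ballI)
      fix \<tau> v k assume "\<tau> \<in> configs q n" "v \<in> {1..n}" "k \<in> {1..q}"
      then have "\<bar>(?R ^^ m) f \<tau> - (?R ^^ m) f (\<tau>(v := k))\<bar> \<le> smooth_const / sqrt (real m + 1) * 1"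
        using grad[OF m] by simp
      also have "\<dots> \<le> smooth_const / sqrt (real m + 1) * wgt \<tau>"
        using wgt_ge_1 S0 by (intro mult_left_mono) auto
      finally show "\<bar>(?R ^^ m) f \<tau> - (?R ^^ m) f (\<tau>(v := k))\<bar> \<le> smooth_const / sqrt (real m + 1) * wgt \<tau>" .
    qed
  qed (use S0 rate_nonneg in auto)
  then show ?thesis using near[OF \<tau>(1)] near[OF \<tau>(2)] by (simp add: abs_le_iff mult_ac)
qed

text \<open>The Gibbs measure is not stationary for the clipped chain. Hence three comparisons: true
  to clipped from \<open>\<sigma>\<close>, clipped from \<open>\<sigma>\<close> to clipped from a
  Gibbs start by the oscillation bound, and back to the Gibbs measure at the cost of its bad
  mass.\<close>

theorem tv_upper:
  fixes T :: real
  assumes \<sigma>: "\<sigma> \<in> configs q n" and W: "W \<sigma> \<le> \<rho>\<^sup>2 / 8" and m: "m \<le> n"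
    and A: "\<And>\<tau> j. \<tau> \<in> configs q n \<Longrightarrow> t \<le> j \<Longrightarrow> (P ^^ j) \<phi> \<tau> \<le> A / sqrt n"
    and T: "real (t + m) \<le> T"
  shows "tv_dist (glauber_law q \<beta> n \<sigma> (t + m)) (potts q \<beta> n)
     \<le> 8 * C1 * smooth_const * A * sqrt (m / n) + n * rate ^ t * smooth_const / sqrt (real m + 1) * (1 + K * (real q + 1))
       + exit_bound T + T * chain.gibbs bad"
proof (rule chain.tv_dist_glauber_le[OF \<sigma>])
  fix f :: "(nat \<Rightarrow> nat) \<Rightarrow> real"
  assume f: "\<And>\<tau>. 0 \<le> f \<tau> \<and> f \<tau> \<le> 1" "\<And>c. swap_invariant {v\<in>{1..n}. \<sigma> v = c} f"
  let ?s = "t + m"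
  define osc where "osc = 8 * C1 * smooth_const * A * sqrt (m / n) + n * rate ^ t * smooth_const / sqrt (real m + 1) * (1 + K * (real q + 1))"
  have "(Gl ^^ ?s) f \<sigma> \<le> (P ^^ ?s) f \<sigma> + exit_bound T"
    using iter_comparison[OF \<sigma>, of f ?s] f sum_iter_bad_le[OF \<sigma> W T] by (simp add: abs_le_iff)
  moreover have "chain.gibbs ((P ^^ ?s) f) - T * chain.gibbs bad \<le> chain.gibbs f"
  proof -
    have "0 \<le> chain.gibbs bad" using chain.gibbs_mono[of "\<lambda>_. 0" bad] chain.gibbs_const[of 0] by (simp add: bad_def)
    then have "real ?s * chain.gibbs bad \<le> T * chain.gibbs bad" using T by (intro mult_right_mono) auto
    then show ?thesis using gibbs_comparison[of f ?s] f by (simp add: abs_le_iff)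
  qed
  moreover have "(P ^^ ?s) f \<sigma> - osc \<le> chain.gibbs ((P ^^ ?s) f)"
  proof -
    have "chain.gibbs (\<lambda>_. (P ^^ ?s) f \<sigma> - osc) \<le> chain.gibbs ((P ^^ ?s) f)"
    proof (rule chain.gibbs_mono)
      fix \<tau> assume \<tau>: "\<tau> \<in> configs q n"
      show "(P ^^ ?s) f \<sigma> - osc \<le> (P ^^ ?s) f \<tau>"
        using oscillation_le[OF \<sigma> W f m A \<sigma> \<tau>, of t] unfolding osc_def by simp
    qed
    then show ?thesis by (simp only: chain.gibbs_const)
  qed
  ultimately show "(Gl ^^ ?s) f \<sigma> - chain.gibbs f \<le> 8 * C1 * smooth_const * A * sqrt (m / n)
     + n * rate ^ t * smooth_const / sqrt (real m + 1) * (1 + K * (real q + 1)) + exit_bound T + T * chain.gibbs bad"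
    unfolding osc_def[symmetric] by linarith
qed

end

section \<open>Lower bound on the distance to equilibrium\<close>

context potts_mixing
begin

text \<open>13 pays for the quadratic error of the linearised softmax and for the omitted spin;
  8/\<rho>^2 makes the linear bound trivial once clipping is active.\<close>

definition C3 where "C3 = 13 + 8 / \<rho>\<^sup>2"
definition C4 where "C4 = C3 + 2 * C3 / \<kappa> * (2 * real q + 2)"
definition C5 where "C5 = 2 * (1 + K * (real q + 1))\<^sup>2 / \<kappa>"

lemma C3_nonneg: "0 \<le> C3" by (simp add: C3_def)

lemma one_in: "1 \<in> {1..q}" using q by simp

text \<open>For a lower bound the numerator only needs exp x \<ge> 1 + x, and in the upper bound for
  the denominator the first-order terms cancel because deviations sum to zero.\<close>

lemma rule_linear_lower:
  assumes \<sigma>: "\<sigma> \<in> configs q n" and v: "v \<in> {1..n}"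
  shows "1 / q + 2 * \<beta> / q * z \<sigma> 1 - C3 * (W \<sigma> + 1 / n) \<le> r \<sigma> v 1"
proof (cases "\<forall>k\<in>{1..q}. \<bar>local_dev q n \<sigma> v k\<bar> \<le> \<rho>")
  case True
  define B where "B = 2 * \<beta>"
  have B: "0 \<le> B" "B / q \<le> 1" using b q by (auto simp: B_def)
  define x where "x = local_dev q n \<sigma> v"
  have x: "x k = z \<sigma> k - (if \<sigma> v = k then 1 else 0) / n" for k
    unfolding x_def by (rule local_dev_eq[OF v])
  have Bx: "\<bar>B * x k\<bar> \<le> 1" if "k \<in> {1..q}" for k
  proof -
    have "\<bar>B * x k\<bar> \<le> B * \<rho>" using True that B by (simp add: abs_mult x_def mult_left_mono)
    also have "\<dots> \<le> 1"
    proof -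
      have "2 * B * 1 * \<rho> \<le> 2 * B * exp (2 * B) * \<rho>" using B \<rho> by (intro mult_right_mono mult_left_mono) auto
      also have "\<dots> \<le> 1" using C1_\<rho> \<kappa>_le by (simp add: C1_def B_def)
      finally show ?thesis using B \<rho> by simp
    qed
    finally show ?thesis .
  qed
  define D where "D = (\<Sum>j=1..q. exp (B * x j))"
  have D0: "0 < D" unfolding D_def using q by (intro sum_pos) auto
  define e where "e = 6 * B\<^sup>2 * (W \<sigma> + 1 / n)"
  have e0: "0 \<le> e" using energy_nonneg[of q n \<sigma>] by (simp add: e_def)
  have D_le: "D \<le> q + e"
  proof -
    have "D \<le> (\<Sum>j=1..q. 1 + B * x j + 3 * (B * x j)\<^sup>2)"
      unfolding D_def using Bx by (intro sum_mono exp_le_quadratic) auto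
    also have "\<dots> \<le> (\<Sum>j=1..q. 1 + B * z \<sigma> j + 6 * B\<^sup>2 * ((z \<sigma> j)\<^sup>2 + (if j = \<sigma> v then 1 / n else 0)))"
    proof (intro sum_mono add_mono order_refl)
      fix j
      show "B * x j \<le> B * z \<sigma> j" using B by (intro mult_left_mono) (auto simp: x)
      have "(x j)\<^sup>2 \<le> 2 * ((z \<sigma> j)\<^sup>2 + (if j = \<sigma> v then 1 / n else 0))"
      proof -
        define d where "d = (if \<sigma> v = j then 1 else 0) / real n"
        have "0 \<le> (z \<sigma> j + d)\<^sup>2" by simp
        then have "(z \<sigma> j - d)\<^sup>2 \<le> 2 * (z \<sigma> j)\<^sup>2 + 2 * d\<^sup>2" by (simp add: power2_eq_square algebra_simps)
        moreover have "d\<^sup>2 \<le> (if j = \<sigma> v then 1 / n else 0)"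
          using n by (auto simp: d_def power2_eq_square field_simps)
        ultimately show ?thesis unfolding x d_def[symmetric] by (simp add: distrib_left)
      qed
      then have "3 * B\<^sup>2 * (x j)\<^sup>2 \<le> 3 * B\<^sup>2 * (2 * ((z \<sigma> j)\<^sup>2 + (if j = \<sigma> v then 1 / n else 0)))"
        by (intro mult_left_mono) auto
      moreover have "3 * c * (2 * t) = 6 * c * t" for c t :: real by simp
      ultimately show "3 * (B * x j)\<^sup>2 \<le> 6 * B\<^sup>2 * ((z \<sigma> j)\<^sup>2 + (if j = \<sigma> v then 1 / n else 0))"
        by (simp only: power_mult_distrib mult.assoc)
    qed
    also have "\<dots> = q + B * (\<Sum>j=1..q. z \<sigma> j) + 6 * B\<^sup>2 * (W \<sigma> + 1 / n)"
      unfolding sum.distrib sum_distrib_left[symmetric] using configs_range[OF \<sigma> v] by (simp add: energy_def)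
    also have "\<dots> = q + e" using sum_color_dev[OF \<sigma> n q] by (simp add: e_def)
    finally show ?thesis .
  qed
  have r: "r \<sigma> v 1 = exp (B * x 1) / D"
  proof -
    have "(\<Sum>j=1..q. exp (2 * \<beta> * clip \<rho> (local_dev q n \<sigma> v j))) = D"
      unfolding D_def B_def x_def using True by (intro sum.cong refl) (simp add: clip_id)
    then show ?thesis using True one_in by (simp add: clipped_rule_def softmax_def clip_id x_def B_def)
  qed
  have y: "\<bar>B * x 1\<bar> \<le> 1" by (rule Bx[OF one_in])
  have "(1 + B * x 1) / q - 2 * e / (real q)\<^sup>2 \<le> (1 + B * x 1) / (q + e)"
  proof -
    define y where "y = 1 + B * x 1"
    have y: "0 \<le> y" "y \<le> 2" using y by (auto simp: y_def abs_le_iff)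
    have "y / q - y / (q + e) = y * e / (q * (q + e))" using q e0 by (simp add: field_simps)
    also have "\<dots> \<le> 2 * e / (real q)\<^sup>2"
      using q e0 y by (intro frac_le mult_right_mono) (auto simp: power2_eq_square)
    finally show ?thesis by (simp add: y_def)
  qed
  also have "\<dots> \<le> exp (B * x 1) / D"
    using D_le D0 y exp_ge_add_one_self[of "B * x 1"] by (intro frac_le) (auto simp: abs_le_iff)
  finally have main: "(1 + B * x 1) / q - 2 * e / (real q)\<^sup>2 \<le> r \<sigma> v 1" unfolding r .
  have "2 * e / (real q)\<^sup>2 \<le> 12 * (W \<sigma> + 1 / n)"
  proof -
    have "2 * e / (real q)\<^sup>2 = 12 * ((B / q)\<^sup>2 * (W \<sigma> + 1 / n))" by (simp add: e_def power_divide)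
    also have "\<dots> \<le> 12 * (1 * (W \<sigma> + 1 / n))"
      using B energy_nonneg[of q n \<sigma>] by (intro mult_left_mono mult_right_mono power_le_one) auto
    finally show ?thesis by simp
  qed
  moreover have "B / q * z \<sigma> 1 - 1 / n \<le> B / q * x 1"
  proof -
    have "B / q * (z \<sigma> 1 - x 1) \<le> 1 * (1 / n)" using B by (intro mult_mono) (auto simp: x)
    then show ?thesis by (simp add: right_diff_distrib)
  qed
  moreover have "(1 + B * x 1) / q = 1 / q + B / q * x 1" by (simp add: add_divide_distrib)
  moreover have "13 * (W \<sigma> + 1 / n) \<le> C3 * (W \<sigma> + 1 / n)"
    using energy_nonneg[of q n \<sigma>] by (intro mult_right_mono) (auto simp: C3_def)
  moreover have "12 * (W \<sigma> + 1 / n) + 1 / n \<le> 13 * (W \<sigma> + 1 / n)" using energy_nonneg[of q n \<sigma>] by simp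
  ultimately show ?thesis using main unfolding B_def by linarith
next
  case False
  then obtain k where k: "k \<in> {1..q}" "\<rho> < \<bar>local_dev q n \<sigma> v k\<bar>" by force
  have "1 / n \<le> \<rho> / 2" using n_\<rho> n by (simp add: field_simps)
  moreover have "0 \<le> 1 / real n" by simp
  ultimately have "\<rho> / 2 \<le> \<bar>z \<sigma> k\<bar>" using k(2) unfolding local_dev_eq[OF v]
    by (cases "\<sigma> v = k"; simp; linarith)
  then have "(\<rho> / 2)\<^sup>2 \<le> (\<bar>z \<sigma> k\<bar>)\<^sup>2" using \<rho> by (intro power_mono) auto
  then have W: "\<rho>\<^sup>2 / 4 \<le> W \<sigma>" using color_dev_sq_le_energy[OF k(1), of n \<sigma>] by (simp add: power_divide)
  \<comment> \<open>An active clip means W \<ge> \<rho>^2/4. The error term then exceeds 2, and the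
    claimed lower bound is at most 0.\<close>
  have "2 \<le> 8 / \<rho>\<^sup>2 * W \<sigma>" using W \<rho> by (simp add: field_simps)
  also have "\<dots> \<le> C3 * (W \<sigma> + 1 / n)" using energy_nonneg[of q n \<sigma>] by (intro mult_mono) (auto simp: C3_def)
  finally have "2 \<le> C3 * (W \<sigma> + 1 / n)" .
  moreover have "1 / q \<le> 1" using q by simp
  moreover have "2 * \<beta> / q * z \<sigma> 1 \<le> 1 * 1"
    using b q abs_color_dev_le_1[OF q, of n \<sigma> 1]
    by (intro order_trans[OF mult_left_mono mult_right_mono]) (auto simp: abs_le_iff)
  ultimately show ?thesis using rule_nonneg[of \<sigma> v 1] by linarith
qed

lemma P_dev_ge:
  assumes \<sigma>: "\<sigma> \<in> configs q n"
  shows "(1 - \<kappa> / n) * z \<sigma> 1 - C3 * W \<sigma> / n - C3 / (real n)\<^sup>2 \<le> P (\<lambda>\<tau>. z \<tau> 1) \<sigma>"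
proof -
  have "P (\<lambda>\<tau>. z \<tau> 1) \<sigma> = (\<Sum>v=1..n. z \<sigma> 1 + r \<sigma> v 1 / n - (if \<sigma> v = 1 then 1 else 0) / n) / n"
    unfolding upd_op_def
  proof (intro arg_cong2[where f = "(/)"] sum.cong refl)
    fix v assume v: "v \<in> {1..n}"
    have "(\<Sum>k=1..q. r \<sigma> v k * z (\<sigma>(v := k)) 1)
        = (\<Sum>k=1..q. (z \<sigma> 1 - (if \<sigma> v = 1 then 1 else 0) / n) * r \<sigma> v k + (if k = 1 then r \<sigma> v k / n else 0))"
      by (intro sum.cong refl) (auto simp: color_dev_upd[OF v] algebra_simps diff_divide_distrib)
    also have "\<dots> = z \<sigma> 1 + r \<sigma> v 1 / n - (if \<sigma> v = 1 then 1 else 0) / n"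
      unfolding sum.distrib sum_distrib_left[symmetric] rule_sum using one_in by simp
    finally show "(\<Sum>k=1..q. r \<sigma> v k * z (\<sigma>(v := k)) 1) = z \<sigma> 1 + r \<sigma> v 1 / n - (if \<sigma> v = 1 then 1 else 0) / n" .
  qed
  also have "\<dots> \<ge> (\<Sum>v=1..n. z \<sigma> 1 + (1 / q + 2 * \<beta> / q * z \<sigma> 1 - C3 * (W \<sigma> + 1 / n)) / n - (if \<sigma> v = 1 then 1 else 0) / n) / n"
    by (intro divide_right_mono sum_mono diff_right_mono add_left_mono rule_linear_lower[OF \<sigma>]) auto
  also have "(\<Sum>v=1..n. z \<sigma> 1 + (1 / q + 2 * \<beta> / q * z \<sigma> 1 - C3 * (W \<sigma> + 1 / n)) / n - (if \<sigma> v = 1 then 1 else 0) / n) / n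
      = z \<sigma> 1 + (1 / q + 2 * \<beta> / q * z \<sigma> 1 - C3 * (W \<sigma> + 1 / n)) / n - (z \<sigma> 1 + 1 / q) / n"
  proof -
    have "(\<Sum>v=1..n. (if \<sigma> v = 1 then 1 else 0 :: real)) = n * (z \<sigma> 1 + 1 / q)"
      using n by (simp add: sum.If_cases color_dev_def color_count_def Int_def)
    then have "(\<Sum>v=1..n. (if \<sigma> v = 1 then 1 else 0) / real n) = z \<sigma> 1 + 1 / q"
      unfolding sum_divide_distrib[symmetric] using n by simp
    then show ?thesis
      unfolding sum_subtractf using n by (simp add: diff_divide_distrib)
  qed
  also have "\<dots> = (1 - \<kappa> / n) * z \<sigma> 1 - C3 * W \<sigma> / n - C3 / (real n)\<^sup>2"
  proof -
    have bq: "2 * \<beta> / q = 1 - \<kappa>" by (simp add: \<kappa>_def)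
    show ?thesis unfolding bq
      by (simp add: algebra_simps add_divide_distrib diff_divide_distrib power2_eq_square)
  qed
  finally show ?thesis by simp
qed

text \<open>The energy decays faster than the deviation, at rate 3/2 \<kappa> against \<kappa>.
  Subtracting B times the energy with B \<kappa> / 2 = C3 therefore absorbs the quadratic error of
  the drift, and the linear rate holds exactly up to a term of order 1/n.\<close>

lemma iter_dev_ge:
  assumes \<sigma>: "\<sigma> \<in> configs q n"
  shows "(1 - \<kappa> / n) ^ t * (z \<sigma> 1 - 2 * C3 / \<kappa> * W \<sigma>) - C4 / (\<kappa> * n) \<le> (P ^^ t) (\<lambda>\<tau>. z \<tau> 1) \<sigma>"
proof -
  define B where "B = 2 * C3 / \<kappa>"
  have B: "0 \<le> B" "B * \<kappa> = 2 * C3" using C3_nonneg \<kappa>_pos by (auto simp: B_def)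
  have C4: "C4 = C3 + B * real (2 * q + 2)" by (simp add: C4_def B_def)
  have C40: "0 \<le> C4" using B C3_nonneg by (simp add: C4)
  define f where "f = (\<lambda>\<tau>. B * W \<tau> - z \<tau> 1)"
  have a: "0 \<le> 1 - \<kappa> / n" "1 - \<kappa> / n < 1"
    using \<kappa>_pos \<kappa>_le n by (auto simp: divide_le_eq)
  have "(P ^^ t) f \<sigma> \<le> (1 - \<kappa> / n) ^ t * f \<sigma> + C4 / (real n)\<^sup>2 / (1 - (1 - \<kappa> / n))"
  proof (rule iter_affine_le[OF \<sigma> a])
    fix \<tau> assume \<tau>: "\<tau> \<in> configs q n"
    have "P f \<tau> = B * P W \<tau> - P (\<lambda>\<tau>. z \<tau> 1) \<tau>" unfolding f_def P_diff P_cmult ..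
    also have "\<dots> \<le> B * ((1 - 3 / 2 * \<kappa> / n) * W \<tau> + (2 * q + 2) / (real n)\<^sup>2)
        - ((1 - \<kappa> / n) * z \<tau> 1 - C3 * W \<tau> / n - C3 / (real n)\<^sup>2)"
      using B P_energy_le[OF \<tau>] P_dev_ge[OF \<tau>] by (intro diff_mono mult_left_mono) auto
    also have "\<dots> = (1 - \<kappa> / n) * f \<tau> + C4 / (real n)\<^sup>2 + (C3 - B * \<kappa> / 2) * W \<tau> / n"
      unfolding f_def C4 using n by (simp add: field_simps power2_eq_square)
    also have "C3 - B * \<kappa> / 2 = 0" unfolding B by simp
    finally show "P f \<tau> \<le> (1 - \<kappa> / n) * f \<tau> + C4 / (real n)\<^sup>2" by simp
  qed (use C40 in auto)
  also have "C4 / (real n)\<^sup>2 / (1 - (1 - \<kappa> / n)) = C4 / (\<kappa> * n)"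
    using n \<kappa>_pos by (simp add: power2_eq_square)
  finally have 1: "(P ^^ t) f \<sigma> \<le> (1 - \<kappa> / n) ^ t * f \<sigma> + C4 / (\<kappa> * n)" .
  have 2: "(P ^^ t) f \<sigma> = B * (P ^^ t) W \<sigma> - (P ^^ t) (\<lambda>\<tau>. z \<tau> 1) \<sigma>" unfolding f_def iter_diff iter_cmult ..
  have "0 \<le> (P ^^ t) W \<sigma>" using iter_mono[OF \<sigma>, of "\<lambda>_. 0" W t] energy_nonneg by simp
  then have 3: "0 \<le> B * (P ^^ t) W \<sigma>" using B by simp
  have "(1 - \<kappa> / n) ^ t * (z \<sigma> 1 - B * W \<sigma>) = - ((1 - \<kappa> / n) ^ t * f \<sigma>)" by (simp add: f_def algebra_simps)
  then show ?thesis using 1 2 3 unfolding B_def[symmetric] by linarith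
qed

text \<open>The gradient of the \<open>j\<close>-th iterate is of order \<open>rate ^ j\<close> / n;
  its squares sum to n^-2 times a geometric series of length n/\<kappa>.\<close>

lemma iter_dev_variance:
  assumes \<sigma>: "\<sigma> \<in> configs q n" and rate: "rate \<le> 1 - \<kappa> / (2 * n)"
  shows "(P ^^ t) (\<lambda>\<tau>. (z \<tau> 1)\<^sup>2) \<sigma> \<le> ((P ^^ t) (\<lambda>\<tau>. z \<tau> 1) \<sigma>)\<^sup>2 + C5 / n"
proof -
  define w where "w = 1 + K * (real q + 1)"
  have w0: "0 \<le> w" using K_nonneg by (simp add: w_def)
  have lip: "lipw (\<lambda>\<tau>. z \<tau> 1) (1 / n)"
    unfolding lipw_def
  proof (intro ballI)
    fix \<tau> v k assume "\<tau> \<in> configs q n" and v: "v \<in> {1..n}" and "k \<in> {1..q}"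
    have "\<bar>z \<tau> 1 - z (\<tau>(v := k)) 1\<bar> \<le> 1 / n * 1" unfolding color_dev_upd[OF v] by auto
    also have "\<dots> \<le> 1 / n * wgt \<tau>" using wgt_ge_1 by (intro mult_left_mono) auto
    finally show "\<bar>z \<tau> 1 - z (\<tau>(v := k)) 1\<bar> \<le> 1 / n * wgt \<tau>" .
  qed
  have "(P ^^ t) (\<lambda>\<tau>. (z \<tau> 1)\<^sup>2) \<sigma> \<le> ((P ^^ t) (\<lambda>\<tau>. z \<tau> 1) \<sigma>)\<^sup>2 + (\<Sum>j<t. (rate ^ j * (1 / n) * w)\<^sup>2)"
  proof (rule iter_variance_le[OF \<sigma>])
    fix j \<tau> v k assume \<tau>: "\<tau> \<in> configs q n" "v \<in> {1..n}" "k \<in> {1..q}"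
    have "\<bar>(P ^^ j) (\<lambda>\<tau>. z \<tau> 1) \<tau> - (P ^^ j) (\<lambda>\<tau>. z \<tau> 1) (\<tau>(v := k))\<bar> \<le> rate ^ j * (1 / n) * wgt \<tau>"
      using lipw_iter[OF lip, of j] \<tau> by (simp add: lipw_def)
    also have "\<dots> \<le> rate ^ j * (1 / n) * w"
      unfolding w_def using rate_nonneg by (intro mult_left_mono wgt_le) auto
    finally show "\<bar>(P ^^ j) (\<lambda>\<tau>. z \<tau> 1) \<tau> - (P ^^ j) (\<lambda>\<tau>. z \<tau> 1) (\<tau>(v := k))\<bar> \<le> rate ^ j * (1 / n) * w" .
  qed
  also have "(\<Sum>j<t. (rate ^ j * (1 / n) * w)\<^sup>2) \<le> C5 / n"
  proof -
    have rate1: "rate < 1"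
    proof -
      have "0 < \<kappa> / (2 * n)" using \<kappa>_pos n by simp
      then show ?thesis using rate by linarith
    qed
    have "(\<Sum>j<t. rate ^ j) \<le> 2 * n / \<kappa>"
    proof -
      have "(\<Sum>j<t. rate ^ j) = (1 - rate ^ t) / (1 - rate)" using rate1 by (simp add: sum_gp_strict)
      also have "\<dots> \<le> 1 / (\<kappa> / (2 * n))"
        using rate rate_nonneg \<kappa>_pos n by (intro frac_le) auto
      finally show ?thesis by simp
    qed
    moreover have "(\<Sum>j<t. (rate ^ j * (1 / n) * w)\<^sup>2) \<le> (\<Sum>j<t. w\<^sup>2 / (real n)\<^sup>2 * rate ^ j)"
    proof (rule sum_mono)
      fix j
      have "rate ^ j \<le> 1" using rate_nonneg rate1 by (simp add: power_le_one)
      then have "rate ^ j * rate ^ j \<le> rate ^ j * 1" using rate_nonneg by (intro mult_left_mono) auto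
      then have "w\<^sup>2 / (real n)\<^sup>2 * (rate ^ j * rate ^ j) \<le> w\<^sup>2 / (real n)\<^sup>2 * rate ^ j"
        by (intro mult_left_mono) auto
      then show "(rate ^ j * (1 / n) * w)\<^sup>2 \<le> w\<^sup>2 / (real n)\<^sup>2 * rate ^ j"
        by (simp add: power2_eq_square mult_ac)
    qed
    ultimately have "(\<Sum>j<t. (rate ^ j * (1 / n) * w)\<^sup>2) \<le> w\<^sup>2 / (real n)\<^sup>2 * (2 * n / \<kappa>)"
      unfolding sum_distrib_left[symmetric] by (meson divide_nonneg_nonneg mult_left_mono order_trans zero_le_power2)
    also have "\<dots> = 2 * w\<^sup>2 / \<kappa> / n" using n by (simp add: power2_eq_square mult_ac)
    also have "\<dots> = C5 / n" by (simp add: C5_def w_def)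
    finally show ?thesis .
  qed
  finally show ?thesis by simp
qed

lemma gibbs_bad_nonneg: "0 \<le> chain.gibbs bad"
  using chain.gibbs_mono[of "\<lambda>_. 0" bad] chain.gibbs_const[of 0] by (simp add: bad_def)

text \<open>The equilibrium energy is read off by running the clipped chain from the Gibbs measure.
  Division by \<open>q\<close> brings the energy into [0, 1], as \<open>gibbs_comparison\<close>
  demands, and \<open>T\<close> is left free to be balanced later.\<close>

lemma gibbs_energy_le:
  "chain.gibbs W \<le> q * exp (- (3 / 2) * \<kappa> * T / n) + (2 * q + 2) / (\<kappa> * n) + q * T * chain.gibbs bad" for T :: nat
proof -
  define f where "f = (\<lambda>\<sigma>. 1 / q * W \<sigma>)"
  have f: "0 \<le> f \<tau> \<and> f \<tau> \<le> 1" for \<tau>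
    using energy_nonneg[of q n \<tau>] energy_le[OF q, of n \<tau>] q by (simp add: f_def)
  have "chain.gibbs f \<le> chain.gibbs ((P ^^ T) f) + T * chain.gibbs bad"
    using gibbs_comparison[of f T] f by (simp add: abs_le_iff)
  moreover have "chain.gibbs ((P ^^ T) f) \<le> chain.gibbs (\<lambda>_. 1 / q * (exp (- (3 / 2) * \<kappa> * T / n) * q + (2 * q + 2) / (\<kappa> * n)))"
  proof (rule chain.gibbs_mono)
    fix \<tau> assume \<tau>: "\<tau> \<in> configs q n"
    define a where "a = 1 - 3 / 2 * \<kappa> / n"
    show "(P ^^ T) f \<tau> \<le> 1 / q * (exp (- (3 / 2) * \<kappa> * T / n) * q + (2 * q + 2) / (\<kappa> * n))"
    proof -
      have n2: "2 \<le> real n"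
      proof -
        have "\<rho> * real n \<le> 1 * real n" using \<rho> by (intro mult_right_mono) auto
        then show ?thesis using n_\<rho> by simp
      qed
      have a: "0 \<le> a" "a < 1"
      proof -
        have "3 / 2 * \<kappa> / n \<le> 1" using \<kappa>_le n2 by (simp add: divide_le_eq)
        moreover have "0 < 3 / 2 * \<kappa> / n" using \<kappa>_pos n by simp
        ultimately show "0 \<le> a" "a < 1" by (auto simp: a_def)
      qed
      have "(P ^^ T) W \<tau> \<le> a ^ T * W \<tau> + (2 * q + 2) / (real n)\<^sup>2 / (1 - a)"
        by (rule iter_affine_le[OF \<tau> a]) (use P_energy_le in \<open>auto simp: a_def\<close>)
      also have "\<dots> \<le> exp (- (3 / 2) * \<kappa> * T / n) * q + (2 * q + 2) / (\<kappa> * n)"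
      proof (intro add_mono mult_mono energy_le[OF q] energy_nonneg)
        have "a ^ T \<le> exp (- (3 / 2 * \<kappa> / n)) ^ T"
          using exp_ge_add_one_self[of "- (3 / 2 * \<kappa> / n)"] a by (intro power_mono) (auto simp: a_def)
        then show "a ^ T \<le> exp (- (3 / 2) * \<kappa> * T / n)"
          by (simp add: mult.commute flip: exp_of_nat_mult)
        have "(2 * q + 2) / (real n)\<^sup>2 / (1 - a) = 2 / 3 * ((2 * q + 2) / (\<kappa> * n))"
          using n \<kappa>_pos by (simp add: a_def field_simps power2_eq_square)
        also have "\<dots> \<le> 1 * ((2 * q + 2) / (\<kappa> * n))" using \<kappa>_pos by (intro mult_right_mono) auto
        finally show "(2 * q + 2) / (real n)\<^sup>2 / (1 - a) \<le> (2 * q + 2) / (\<kappa> * n)" by simp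
      qed auto
      finally have le: "(P ^^ T) W \<tau> \<le> exp (- (3 / 2) * \<kappa> * T / n) * q + (2 * q + 2) / (\<kappa> * n)" .
      have eq: "(P ^^ T) f \<tau> = 1 / q * (P ^^ T) W \<tau>" unfolding f_def by (rule iter_cmult)
      show ?thesis unfolding eq by (intro mult_left_mono le) auto
    qed
  qed
  ultimately have "chain.gibbs f \<le> 1 / q * (exp (- (3 / 2) * \<kappa> * T / n) * q + (2 * q + 2) / (\<kappa> * n)) + T * chain.gibbs bad"
    by (simp only: chain.gibbs_const)
  then have "q * chain.gibbs f \<le> q * (1 / q * (exp (- (3 / 2) * \<kappa> * T / n) * q + (2 * q + 2) / (\<kappa> * n)) + T * chain.gibbs bad)"
    by (intro mult_left_mono) auto
  moreover have "q * chain.gibbs f = chain.gibbs W" unfolding f_def chain.gibbs_cmult using q by simp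
  ultimately show ?thesis using q by (simp add: algebra_simps)
qed

text \<open>The event that the first deviation is at least M/2 separates the two laws: Chebyshev
  makes it likely for the chain, and Markov's inequality for the energy makes it unlikely under the
  Gibbs measure.\<close>

theorem tv_lower:
  assumes \<sigma>: "\<sigma> \<in> configs q n" and W: "W \<sigma> \<le> \<rho>\<^sup>2 / 8" and rate: "rate \<le> 1 - \<kappa> / (2 * n)"
    and M: "0 < M" "M \<le> (P ^^ t) (\<lambda>\<tau>. z \<tau> 1) \<sigma>" and T: "real t \<le> T"
  shows "1 - 4 / M\<^sup>2 * (C5 / n + chain.gibbs W) - exit_bound T \<le> tv_dist (glauber_law q \<beta> n \<sigma> t) (potts q \<beta> n)"
proof -
  define m0 where "m0 = (P ^^ t) (\<lambda>\<tau>. z \<tau> 1) \<sigma>"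
  define A where "A = {\<tau>. M / 2 \<le> z \<tau> 1}"
  have c: "0 \<le> 4 / M\<^sup>2" by simp
  have "(P ^^ t) (\<lambda>\<tau>. 1 - indicator A \<tau>) \<sigma> \<le> (P ^^ t) (\<lambda>\<tau>. 4 / M\<^sup>2 * ((z \<tau> 1)\<^sup>2 + (- 2 * m0) * z \<tau> 1 + m0\<^sup>2)) \<sigma>"
  proof (rule iter_mono[OF \<sigma>])
    fix \<tau>
    have sq: "(z \<tau> 1)\<^sup>2 + (- 2 * m0) * z \<tau> 1 + m0\<^sup>2 = (m0 - z \<tau> 1)\<^sup>2" by (simp add: power2_eq_square algebra_simps)
    show "1 - indicator A \<tau> \<le> 4 / M\<^sup>2 * ((z \<tau> 1)\<^sup>2 + (- 2 * m0) * z \<tau> 1 + m0\<^sup>2)"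
    proof (cases "\<tau> \<in> A")
      case True
      then show ?thesis unfolding sq by simp
    next
      case False
      then have "M / 2 \<le> m0 - z \<tau> 1" using M by (simp add: A_def m0_def)
      then have "(M / 2)\<^sup>2 \<le> (m0 - z \<tau> 1)\<^sup>2" using M by (intro power_mono) auto
      then have "4 / M\<^sup>2 * (M / 2)\<^sup>2 \<le> 4 / M\<^sup>2 * (m0 - z \<tau> 1)\<^sup>2" by (intro mult_left_mono) auto
      then show ?thesis unfolding sq using False M by (simp add: power_divide)
    qed
  qed
  also have "\<dots> = 4 / M\<^sup>2 * ((P ^^ t) (\<lambda>\<tau>. (z \<tau> 1)\<^sup>2) \<sigma> - m0\<^sup>2)"
    unfolding iter_cmult iter_add iter_const m0_def[symmetric] by (simp add: power2_eq_square)
  also have "\<dots> \<le> 4 / M\<^sup>2 * (C5 / n)"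
    using iter_dev_variance[OF \<sigma> rate, of t] c by (intro mult_left_mono) (auto simp: m0_def)
  finally have 1: "1 - (P ^^ t) (indicator A) \<sigma> \<le> 4 / M\<^sup>2 * (C5 / n)"
    unfolding iter_diff iter_const .
  have 2: "(P ^^ t) (indicator A) \<sigma> \<le> (Gl ^^ t) (indicator A) \<sigma> + exit_bound T"
    using iter_comparison[OF \<sigma>, of "indicator A" t] sum_iter_bad_le[OF \<sigma> W T]
    by (simp add: indicator_def abs_le_iff)
  have 3: "chain.gibbs (indicator A) \<le> 4 / M\<^sup>2 * chain.gibbs W"
    unfolding chain.gibbs_cmult[symmetric]
  proof (rule chain.gibbs_mono)
    fix \<tau>
    have "4 / M\<^sup>2 * (M / 2)\<^sup>2 \<le> 4 / M\<^sup>2 * W \<tau>" if "\<tau> \<in> A"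
    proof (rule mult_left_mono[OF _ c])
      have "(M / 2)\<^sup>2 \<le> (z \<tau> 1)\<^sup>2" using that M by (intro power_mono) (auto simp: A_def)
      then show "(M / 2)\<^sup>2 \<le> W \<tau>" using color_dev_sq_le_energy[OF one_in, of n \<tau>] by simp
    qed
    then show "indicator A \<tau> \<le> 4 / M\<^sup>2 * W \<tau>"
      using M energy_nonneg[of q n \<tau>] by (cases "\<tau> \<in> A") (auto simp: power_divide)
  qed
  have "(Gl ^^ t) (indicator A) \<sigma> - chain.gibbs (indicator A) \<le> tv_dist (glauber_law q \<beta> n \<sigma> t) (potts q \<beta> n)"
    using tv_dist_ge[of "glauber_law q \<beta> n \<sigma> t" A "potts q \<beta> n"]
    unfolding chain.prob_glauber_law[OF \<sigma>] chain.prob_potts by linarith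
  then show ?thesis using 1 2 3 by (simp add: distrib_left) 
qed

end

section \<open>Block configurations\<close>

text \<open>Colours 2 to \<open>q\<close> fill consecutive blocks of length \<open>m\<close> and
  colour 1 takes the rest. With \<open>m\<close> near n/q this is the balanced reference, with a
  smaller \<open>m\<close> the tilted start of the lower bound.\<close>

lemma block_config:
  assumes q: "1 \<le> q" and n: "1 \<le> n" and m: "(q - 1) * m \<le> n"
  shows "\<exists>\<sigma>\<in>configs q n. energy q n \<sigma> = real q * (real q - 1) * (real m / n - 1 / q)\<^sup>2 \<and>
    color_dev q n \<sigma> 1 = - ((real q - 1) * (real m / n - 1 / q))"
proof -
  define \<sigma> where "\<sigma> = (\<lambda>v. if v \<in> {1..n} then (if v \<le> (q - 1) * m then 2 + (v - 1) div m else 1) else undefined)"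
  define d where "d = real m / n - 1 / q"
  have range: "\<sigma> v \<in> {1..q}" if "v \<in> {1..n}" for v
  proof (cases "v \<le> (q - 1) * m")
    case True
    then have "v - 1 < (q - 1) * m" using that by auto
    then have "(v - 1) div m < q - 1" by (simp add: less_mult_imp_div_less)
    then show ?thesis using True that by (simp add: \<sigma>_def)
  next
    case False
    then show ?thesis using that q by (simp add: \<sigma>_def)
  qed
  then have \<sigma>: "\<sigma> \<in> configs q n" by (auto simp: configs_def \<sigma>_def)
  have count: "color_count n \<sigma> k = m" if k: "k \<in> {2..q}" for k
  proof -
    have "{v\<in>{1..n}. \<sigma> v = k} = {(k - 2) * m + 1..(k - 1) * m}"
    proof (intro equalityI subsetI)
      fix v assume v: "v \<in> {v\<in>{1..n}. \<sigma> v = k}"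
      then have le: "v \<le> (q - 1) * m" and div: "(v - 1) div m = k - 2" "1 \<le> v"
        using k by (auto simp: \<sigma>_def split: if_splits)
      have "0 < m" using le div(2) by (cases m) auto
      then have "(k - 2) * m \<le> v - 1" "v - 1 < m + (k - 2) * m"
        using div_times_less_eq_dividend[of "v - 1" m] dividend_less_div_times[of m "v - 1"]
        unfolding div(1) by blast+
      moreover have "(k - 1) * m = (k - 2) * m + m" using k by (cases k rule: nat.exhaust; cases "k - 1") auto
      ultimately show "v \<in> {(k - 2) * m + 1..(k - 1) * m}" using div(2) by auto
    next
      fix v assume v: "v \<in> {(k - 2) * m + 1..(k - 1) * m}"
      have km: "(k - 1) * m = (k - 2) * m + m" using k by (cases k rule: nat.exhaust; cases "k - 1") auto
      have "v \<le> (k - 1) * m" using v by simp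
      also have "\<dots> \<le> (q - 1) * m" using k by (intro mult_right_mono) auto
      finally have v': "v \<le> (q - 1) * m" .
      moreover have "1 \<le> v" using v by simp
      ultimately have v1: "v \<in> {1..n}" using m by simp
      have "(v - 1) div m = k - 2"
        using v km by (intro div_nat_eqI) (auto simp: mult.commute)
      then show "v \<in> {v\<in>{1..n}. \<sigma> v = k}" using v' v1 k by (auto simp: \<sigma>_def)
    qed
    then have "color_count n \<sigma> k = (k - 1) * m - (k - 2) * m" by (simp add: color_count_def)
    also have "\<dots> = ((k - 1) - (k - 2)) * m" by (simp add: diff_mult_distrib)
    also have "(k - 1) - (k - 2) = 1" using k by auto
    finally show ?thesis by simp
  qed
  have dev: "color_dev q n \<sigma> k = d" if "k \<in> {2..q}" for k
    using count[OF that] by (simp add: color_dev_def d_def)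
  have split: "{1..q} = insert 1 {2..q}" using q by auto
  have "(\<Sum>k\<in>{2..q}. color_dev q n \<sigma> k) = (real q - 1) * d" using dev q by (simp add: of_nat_diff)
  then have dev1: "color_dev q n \<sigma> 1 = - ((real q - 1) * d)"
    using sum_color_dev[OF \<sigma> n q] unfolding split by simp
  have "(\<Sum>k\<in>{2..q}. (color_dev q n \<sigma> k)\<^sup>2) = (real q - 1) * d\<^sup>2" using dev q by (simp add: of_nat_diff)
  then have "energy q n \<sigma> = ((real q - 1) * d)\<^sup>2 + (real q - 1) * d\<^sup>2"
    unfolding energy_def split by (simp add: dev1[simplified])
  also have "\<dots> = real q * (real q - 1) * d\<^sup>2" by (simp add: power2_eq_square algebra_simps)
  finally show ?thesis using \<sigma> dev1 unfolding d_def by blast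
qed

section \<open>Cutoff\<close>

lemma exit_decay:
  fixes a B s c :: real assumes "0 < a" "0 < B" "0 < s" "0 < c"
  shows "(\<lambda>n::nat. (real n * (a * ln (real n) + s)) * exp (B * (real n * (a * ln (real n) + s)) / real n - c * real n)) \<longlonglongrightarrow> 0"
  using assms by real_asymp

lemma deviation_decay:
  fixes a s c :: real assumes "0 < a" "0 < s" "0 < c"
  shows "(\<lambda>n::nat. (real n * (a * ln (real n) + s)) * ((real n + 1) ^ q * exp (- c * real n))) \<longlonglongrightarrow> 0"
    and "(\<lambda>n::nat. real n * ((real n * (a * ln (real n) + s)) * ((real n + 1) ^ q * exp (- c * real n)))) \<longlonglongrightarrow> 0"
  using assms by real_asymp+

section \<open>Clipping radius and starting region\<close>

locale potts_subcritical =
  fixes q :: nat and \<beta> :: real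
  assumes q3: "3 \<le> q" and \<beta>0: "0 \<le> \<beta>" and \<beta>c: "\<beta> < potts_beta_c q"
begin

definition gap where "gap = 1 - 2 * \<beta> / q"
text \<open>The summand 1 avoids a zero denominator at \<beta> = 0.\<close>

definition radius where
  "radius = min (1 / real q) (gap / (4 * (2 * (2 * \<beta>) * exp (2 * (2 * \<beta>)) + 1)))"
text \<open>For the finitely many small \<open>n\<close> the condition is void, which keeps the set
  nonempty; for the others the energy ball contains a balanced configuration.\<close>

definition start_set where
  "start_set n = {\<sigma>\<in>configs q n. 4 * real q \<le> radius * real n \<longrightarrow> energy q n \<sigma> \<le> radius\<^sup>2 / 8}"

lemma gap_pos: "0 < gap" and gap_le: "gap \<le> 1"
  using potts_beta_c_le[OF q3] \<beta>c \<beta>0 q3 by (auto simp: gap_def field_simps)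

lemma alpha1_gap: "potts_alpha1 \<beta> q = 1 / (2 * gap)"
  by (simp add: potts_alpha1_def gap_def)

lemma radius_pos: "0 < radius" and radius_le: "radius \<le> 1 / q"
  and radius_gap: "2 * (2 * \<beta>) * exp (2 * (2 * \<beta>)) * radius \<le> gap / 4"
proof -
  define c where "c = 2 * (2 * \<beta>) * exp (2 * (2 * \<beta>))"
  have c: "0 \<le> c" using \<beta>0 by (simp add: c_def)
  show "0 < radius" using gap_pos q3 c unfolding radius_def c_def[symmetric] by (simp add: add_nonneg_pos)
  show "radius \<le> 1 / q" unfolding radius_def by simp
  have "c * radius \<le> c * (gap / (4 * (c + 1)))"
    unfolding radius_def c_def[symmetric] using c by (intro mult_left_mono) auto
  also have "\<dots> \<le> gap / 4" using c gap_pos by (simp add: field_simps)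
  finally show "2 * (2 * \<beta>) * exp (2 * (2 * \<beta>)) * radius \<le> gap / 4" by (simp add: c_def)
qed

lemma mixing_locale:
  assumes "4 * real q \<le> radius * real n"
  shows "potts_mixing q n \<beta> radius"
proof
  show q: "1 \<le> q" using q3 by simp
  have "0 < radius * real n" using assms q by linarith
  then show "1 \<le> n" using radius_pos by (cases n) auto
  show "2 * \<beta> < real q" using gap_pos q by (simp add: gap_def field_simps)
  have "1 / real q \<le> 1" using q by simp
  then show "radius \<le> 1" using radius_le by simp
  show "2 * (2 * \<beta>) * exp (2 * (2 * \<beta>)) * radius \<le> (1 - 2 * \<beta> / real q) / 4"
    using radius_gap by (simp add: gap_def)
  show "2 \<le> radius * real n" using assms q by simp
qed (use \<beta>0 radius_pos radius_le in auto)

lemma eventually_large: "\<forall>\<^sub>F n in sequentially. 4 * real q \<le> radius * real n"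
proof -
  have "filterlim (\<lambda>n. radius * real n) at_top sequentially"
    using radius_pos by real_asymp
  then show ?thesis by (simp add: filterlim_at_top)
qed

lemma start_set_subset: "start_set n \<subseteq> configs q n"
  by (auto simp: start_set_def)

lemma balanced_config:
  assumes "1 \<le> n"
  shows "\<exists>\<sigma>\<in>configs q n. energy q n \<sigma> \<le> (real q / n)\<^sup>2"
proof -
  define m where "m = nat \<lfloor>real n / q\<rfloor>"
  have q: "1 \<le> q" "1 \<le> real q" using q3 by auto
  have m: "real m \<le> real n / q" "real n / q < real m + 1"
    unfolding m_def using floor_correct[of "real n / q"] by (auto simp: of_nat_nat)
  have "real q * real m \<le> n" using m q by (simp add: field_simps)
  then have "q * m \<le> n" by (simp only: of_nat_mult[symmetric] of_nat_le_iff)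
  moreover have "(q - 1) * m \<le> q * m" by (intro mult_right_mono) auto
  ultimately have "(q - 1) * m \<le> n" by (rule order_trans[rotated])
  from block_config[OF q(1) assms this] obtain \<sigma> where
    \<sigma>: "\<sigma> \<in> configs q n" "energy q n \<sigma> = real q * (real q - 1) * (real m / n - 1 / q)\<^sup>2" by blast
  have "\<bar>real m / n - 1 / q\<bar> \<le> 1 / n"
  proof -
    have "real m / n \<le> 1 / q" using m assms q by (simp add: field_simps)
    moreover have "1 / q \<le> real m / n + 1 / n"
    proof -
      have "n \<le> (real m + 1) * q" using m q by (simp add: field_simps)
      then show ?thesis using assms q by (simp add: field_simps)
    qed
    ultimately show ?thesis by (simp add: abs_le_iff)
  qed
  then have "(real m / n - 1 / q)\<^sup>2 \<le> (1 / n)\<^sup>2" by (simp add: power2_le_iff_abs_le)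
  then have "energy q n \<sigma> \<le> real q * real q * (1 / n)\<^sup>2"
    unfolding \<sigma>(2) using q by (intro mult_mono mult_nonneg_nonneg) auto
  then show ?thesis using \<sigma>(1) by (auto simp: power2_eq_square)
qed

lemma start_set_nonempty:
  assumes "1 \<le> n"
  shows "start_set n \<noteq> {}"
proof -
  from balanced_config[OF assms] obtain \<sigma> where \<sigma>: "\<sigma> \<in> configs q n" "energy q n \<sigma> \<le> (real q / n)\<^sup>2" by blast
  have "energy q n \<sigma> \<le> radius\<^sup>2 / 8" if "4 * real q \<le> radius * real n"
  proof -
    have "real q / n \<le> radius / 4" using that assms by (simp add: field_simps)
    then have "(real q / n)\<^sup>2 \<le> (radius / 4)\<^sup>2" by (intro power_mono) auto
    also have "\<dots> \<le> radius\<^sup>2 / 8" by (simp add: power_divide)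
    finally show ?thesis using \<sigma>(2) by simp
  qed
  then show ?thesis using \<sigma>(1) by (auto simp: start_set_def)
qed

lemma start_set_complement:
  "\<exists>C1>0. \<exists>C2>0. \<forall>n\<ge>1. measure_pmf.prob (potts q \<beta> n) (configs q n - start_set n) \<le> C1 * exp (- C2 * real n)"
proof -
  define c where "c = (potts_beta_c q - \<beta>) * (radius\<^sup>2 / 8)"
  have c: "0 < c" using \<beta>c radius_pos by (simp add: c_def)
  obtain C where C: "0 < C" "\<And>n::nat. (real n + 1) ^ q * exp (- c * real n) \<le> C * exp (- (c / 2) * real n)"
    using poly_exp_bound[OF c, of q] by blast
  have "measure_pmf.prob (potts q \<beta> n) (configs q n - start_set n) \<le> C * exp (- (c / 2) * real n)" if n: "1 \<le> n" for n
  proof -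
    have "measure_pmf.prob (potts q \<beta> n) (configs q n - start_set n)
        \<le> measure_pmf.prob (potts q \<beta> n) {\<sigma>\<in>configs q n. radius\<^sup>2 / 8 < energy q n \<sigma>}"
      by (rule measure_pmf.finite_measure_mono) (auto simp: start_set_def)
    also have "\<dots> \<le> (real n + 1) ^ q * exp (- c * real n)"
      using potts_energy_large_deviation[OF q3 \<beta>0 \<beta>c n, of "radius\<^sup>2 / 8"]
      by (simp only: c_def mult_minus_left mult.assoc)
    also have "\<dots> \<le> C * exp (- (c / 2) * real n)" by (rule C(2))
    finally show ?thesis .
  qed
  then show ?thesis using C(1) half_gt_zero[OF c] by blast
qed

definition bad_rate where "bad_rate = (potts_beta_c q - \<beta>) * (radius\<^sup>2 / 4)"

lemma bad_rate_pos: "0 < bad_rate"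
  using \<beta>c radius_pos by (simp add: bad_rate_def)

lemma gibbs_bad_le:
  assumes "4 * real q \<le> radius * real n"
  shows "potts_chain.gibbs q n \<beta> (potts_mixing.bad q n radius) \<le> (real n + 1) ^ q * exp (- bad_rate * real n)"
proof -
  interpret potts_mixing q n \<beta> radius by (rule mixing_locale[OF assms])
  have "chain.gibbs bad = measure_pmf.prob (potts q \<beta> n) {\<sigma>\<in>configs q n. radius\<^sup>2 / 4 < energy q n \<sigma>}"
    unfolding chain.prob_potts chain.gibbs_def
    by (intro sum.cong refl) (auto simp: bad_def indicator_def)
  also have "\<dots> \<le> (real n + 1) ^ q * exp (- bad_rate * real n)"
    using potts_energy_large_deviation[OF q3 \<beta>0 \<beta>c n, of "radius\<^sup>2 / 4"]
    by (simp only: bad_rate_def mult_minus_left mult.assoc)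
  finally show ?thesis .
qed

text \<open>The constants of the locale do not depend on \<open>n\<close>, which makes the asymptotics uniform.\<close>

definition Kc where "Kc = clipped_potts.K q (2 * \<beta>)"
definition Ec where "Ec = clipped_potts.E q (2 * \<beta>)"
definition C1c where "C1c = clipped_potts.C1 (2 * \<beta>)"
definition wmax where "wmax = 1 + Kc * (real q + 1)"
definition Sc where "Sc = potts_mixing.smooth_const q"
text \<open>The three terms of \<open>iter_\<phi>_le\<close> multiplied by sqrt n, using
  \<open>rate ^ t\<close> \<le> 3 / sqrt n and a balanced reference.\<close>

definition Ac where "Ac = 9 * wmax + (real q + 1) + 2 * (real q + 2) / gap"

definition horizon :: "real \<Rightarrow> nat \<Rightarrow> real" where
  "horizon s n = real n * (1 / (2 * gap) * ln (real n) + s)"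

text \<open>Over about n log n steps the correction in \<open>rate\<close> accumulates to order log
  n / sqrt n, which is eventually below 1 and costs a factor exp 1 \<le> 3. The main part gives exp
  (- gap s) / sqrt n.\<close>

lemma eventually_rate_power:
  assumes s: "0 \<le> s"
  shows "\<forall>\<^sub>F n in sequentially. \<forall>t. horizon s n \<le> real t \<longrightarrow>
    clipped_potts.rate q n (2 * \<beta>) ^ t \<le> 3 * exp (- gap * s) / sqrt (real n)"
proof -
  have "(\<lambda>n::nat. Ec * (1 / (2 * gap) * ln (real n) + s) / sqrt (real n)) \<longlonglongrightarrow> 0"
    using gap_pos by real_asymp
  then have e1: "\<forall>\<^sub>F n in sequentially. Ec * (1 / (2 * gap) * ln (real n) + s) / sqrt (real n) < 1"
    by (rule order_tendstoD) simp
  have "(\<lambda>n::nat. Ec / sqrt (real n)) \<longlonglongrightarrow> 0" by real_asymp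
  then have e2: "\<forall>\<^sub>F n in sequentially. Ec / sqrt (real n) < gap"
    by (rule order_tendstoD) (rule gap_pos)
  from e1 e2 eventually_large eventually_ge_at_top[of 1] show ?thesis
  proof eventually_elim
    case (elim n)
    interpret potts_mixing q n \<beta> radius by (rule mixing_locale) (rule elim)
    have \<kappa>: "\<kappa> = gap" by (simp add: \<kappa>_def gap_def)
    have E: "E = Ec" by (simp add: Ec_def)
    define x where "x = - gap / n + Ec / (n * sqrt n)"
    have nx: "n * x = - gap + Ec / sqrt n" using n by (simp add: x_def field_simps)
    then have "n * x \<le> 0" using elim by simp
    then have x0: "x \<le> 0" using n by (simp add: mult_le_0_iff)
    show ?case
    proof (intro allI impI)
      fix t assume t: "horizon s n \<le> real t"
      have "rate = 1 + x" by (simp add: rate_def \<kappa> E x_def)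
      then have "rate \<le> exp x" using exp_ge_add_one_self[of x] by (simp only:)
      then have "rate ^ t \<le> exp x ^ t" by (intro power_mono rate_nonneg)
      also have "\<dots> = exp (t * x)" by (simp add: exp_of_nat_mult)
      also have "\<dots> \<le> exp (horizon s n * x)" using t x0 by (simp add: mult_right_mono_neg)
      also have "horizon s n * x = (1 / (2 * gap) * ln n + s) * (n * x)" by (simp add: horizon_def)
      also have "\<dots> = - (ln n / 2) - gap * s + Ec * (1 / (2 * gap) * ln n + s) / sqrt n"
      proof -
        define L where "L = 1 / (2 * gap) * ln n + s"
        have "L * gap = ln n / 2 + gap * s" using gap_pos by (simp add: L_def distrib_right)
        moreover have "L * (- gap + Ec / sqrt n) = - (L * gap) + Ec * L / sqrt n" by (simp add: right_diff_distrib)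
        ultimately show ?thesis unfolding nx L_def[symmetric] by simp
      qed
      also have "\<dots> \<le> - (ln n / 2) - gap * s + 1" using elim by simp
      also have "exp (- (ln n / 2) - gap * s + 1) = exp 1 * exp (- gap * s) / sqrt n"
      proof -
        have "exp (ln n / 2) = sqrt n"
          using n by (simp add: powr_half_sqrt[symmetric] powr_def)
        moreover have "- (ln n / 2) - gap * s + 1 = 1 + - gap * s - ln n / 2" by simp
        ultimately show ?thesis by (simp only: exp_add exp_diff)
      qed
      also have "\<dots> \<le> 3 * exp (- gap * s) / sqrt n"
        using exp_le by (intro divide_right_mono mult_right_mono) auto
      finally show "rate ^ t \<le> 3 * exp (- gap * s) / sqrt n" by simp
    qed
  qed
qed

lemma wmax_ge: "1 \<le> wmax" and Kc_nonneg: "0 \<le> Kc" and C1c_nonneg: "0 \<le> C1c" and Sc_pos: "1 \<le> Sc" and Ac_nonneg: "0 \<le> Ac"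
proof -
  \<comment> \<open>The constants are free of \<open>n\<close>, so one admissible \<open>n\<close>
    proves the bounds for all.\<close>
  obtain n where "4 * real q \<le> radius * real n" using eventually_large by (auto simp: eventually_sequentially)
  then interpret potts_mixing q n \<beta> radius by (rule mixing_locale)
  show K: "0 \<le> Kc" using K_nonneg by (simp add: Kc_def)
  then show w: "1 \<le> wmax" by (simp add: wmax_def)
  show "0 \<le> C1c" using C1_nonneg by (simp add: C1c_def)
  show "1 \<le> Sc" by (simp add: Sc_def smooth_const_def)
  show "0 \<le> Ac" using w gap_pos by (simp add: Ac_def)
qed

lemma eventually_imbalance_small:
  "\<forall>\<^sub>F n in sequentially. \<forall>t. horizon 0 n \<le> real t \<longrightarrow> (\<forall>\<sigma>\<in>configs q n.
    (upd_op q n (clipped_rule q (2 * \<beta>) radius n) ^^ t) (imbalance q n) \<sigma> \<le> Ac / sqrt n)"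
  using eventually_rate_power[of 0, OF order_refl] eventually_large
proof eventually_elim
  case (elim n)
  interpret potts_mixing q n \<beta> radius by (rule mixing_locale) (rule elim)
  have \<kappa>: "\<kappa> = gap" by (simp add: \<kappa>_def gap_def)
  obtain \<tau> where \<tau>: "\<tau> \<in> configs q n" "W \<tau> \<le> (real q / n)\<^sup>2" using balanced_config[OF n] by blast
  have sq: "0 < sqrt n" using n by simp
  have \<phi>\<tau>: "\<phi> \<tau> \<le> (real q + 1) / sqrt n"
  proof -
    have "(\<phi> \<tau>)\<^sup>2 \<le> (real q)\<^sup>2 / n + 1 / n"
    proof -
      have "(real q / n)\<^sup>2 \<le> (real q)\<^sup>2 / n"
        using n by (simp add: power_divide power2_eq_square frac_le)
      then show ?thesis using \<tau>(2) unfolding \<phi>_sq by simp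
    qed
    also have "\<dots> \<le> ((real q + 1) / sqrt n)\<^sup>2"
      by (simp add: power_divide power2_sum add_divide_distrib[symmetric] divide_right_mono)
    finally show ?thesis by (rule power2_le_imp_le) simp
  qed
  show ?case
  proof (intro allI impI ballI)
    fix t \<sigma> assume t: "horizon 0 n \<le> real t" and \<sigma>: "\<sigma> \<in> configs q n"
    have "(P ^^ t) \<phi> \<sigma> \<le> 3 * rate ^ t * (1 + K * (real q + 1)) + \<phi> \<tau> + 2 * (q + 2) / (\<kappa> * sqrt n)"
      by (rule iter_\<phi>_le[OF \<sigma> \<tau>(1)])
    also have "\<dots> \<le> 3 * (3 / sqrt n) * wmax + (real q + 1) / sqrt n + 2 * (q + 2) / (gap * sqrt n)"
    proof (intro add_mono \<phi>\<tau>)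
      have "rate ^ t \<le> 3 / sqrt n" using elim(1) t by simp
      then show "3 * rate ^ t * (1 + K * (real q + 1)) \<le> 3 * (3 / sqrt n) * wmax"
        unfolding wmax_def Kc_def using K_nonneg by (intro mult_right_mono mult_left_mono) auto
    qed (simp add: \<kappa>)
    also have "\<dots> = Ac / sqrt n" using gap_pos sq by (simp add: Ac_def add_divide_distrib)
    finally show "(P ^^ t) \<phi> \<sigma> \<le> Ac / sqrt n" .
  qed
qed

lemma eventually_exit_small:
  assumes "0 < s" "0 < e"
  shows "\<forall>\<^sub>F n in sequentially. potts_mixing.exit_bound q n \<beta> radius (horizon s n) < e"
proof -
  define B where "B = real (2 * q + 26)"
  define c where "c = gap * radius\<^sup>2 / 512"
  have "0 < B" "0 < c" using gap_pos radius_pos by (auto simp: B_def c_def)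
  then have "(\<lambda>n::nat. horizon s n * exp (B * horizon s n / real n - c * real n)) \<longlonglongrightarrow> 0"
    unfolding horizon_def using exit_decay[of "1 / (2 * gap)" B s c] assms gap_pos by simp
  then have "\<forall>\<^sub>F n in sequentially. horizon s n * exp (B * horizon s n / real n - c * real n) < e"
    by (rule order_tendstoD) (rule assms)
  with eventually_large show ?thesis
  proof eventually_elim
    case (elim n)
    interpret potts_mixing q n \<beta> radius by (rule mixing_locale) (rule elim)
    have \<kappa>: "\<kappa> = gap" by (simp add: \<kappa>_def gap_def)
    show ?case using elim(2) by (simp add: exit_bound_def B_def c_def \<kappa>)
  qed
qed

lemma eventually_gibbs_bad_small:
  assumes "0 < s" "0 < e"
  shows "\<forall>\<^sub>F n in sequentially. real n * (horizon s n * potts_chain.gibbs q n \<beta> (potts_mixing.bad q n radius)) < e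
    \<and> horizon s n * potts_chain.gibbs q n \<beta> (potts_mixing.bad q n radius) < e"
proof -
  let ?h = "\<lambda>n. horizon s n * ((real n + 1) ^ q * exp (- bad_rate * real n))"
  have "(\<lambda>n::nat. ?h n) \<longlonglongrightarrow> 0" "(\<lambda>n::nat. real n * ?h n) \<longlonglongrightarrow> 0"
    unfolding horizon_def using deviation_decay[of "1 / (2 * gap)" s bad_rate q] assms gap_pos bad_rate_pos by simp_all
  then have "\<forall>\<^sub>F n in sequentially. ?h n < e" "\<forall>\<^sub>F n in sequentially. real n * ?h n < e"
    using assms(2) by (auto intro: order_tendstoD)
  with eventually_large eventually_ge_at_top[of 1] show ?thesis
  proof eventually_elim
    case (elim n)
    have "0 \<le> horizon s n" using elim(2) gap_pos assms by (simp add: horizon_def)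
    then have "horizon s n * potts_chain.gibbs q n \<beta> (potts_mixing.bad q n radius) \<le> ?h n"
      using gibbs_bad_le[OF elim(1)] by (rule mult_left_mono[rotated])
    moreover from this have "real n * (horizon s n * potts_chain.gibbs q n \<beta> (potts_mixing.bad q n radius)) \<le> real n * ?h n"
      by (rule mult_left_mono) simp
    ultimately show ?case using elim(3,4) by linarith
  qed
qed

section \<open>Upper bound on the mixing time\<close>

lemma finite_start_set: "finite (start_set n)"
  using start_set_subset finite_configs finite_subset by blast

text \<open>The order of choices matters: first \<delta>, making the recolouring error D sqrt
  \<delta> small, then \<open>s\<close>, large enough to beat the factor \<open>F\<close>, which
  grows like the inverse square root of \<delta>.\<close>

lemma mixing_upper:
  assumes \<epsilon>: "0 < \<epsilon>" "\<epsilon> < 1"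
  shows "\<exists>s>0. \<forall>\<^sub>F n in sequentially. \<exists>t. real t \<le> horizon s n \<and> d_restr q \<beta> n (start_set n) t \<le> \<epsilon>"
proof -
  define D where "D = 8 * C1c * Sc * Ac"
  have D0: "0 \<le> D" using C1c_nonneg Sc_pos Ac_nonneg by (simp add: D_def)
  define \<delta> where "\<delta> = min 1 ((\<epsilon> / (4 * (D + 1)))\<^sup>2)"
  have \<delta>: "0 < \<delta>" "\<delta> \<le> 1" using \<epsilon> D0 by (auto simp: \<delta>_def)
  have D\<delta>: "D * sqrt \<delta> \<le> \<epsilon> / 4"
  proof -
    have "sqrt \<delta> \<le> sqrt ((\<epsilon> / (4 * (D + 1)))\<^sup>2)"
      unfolding \<delta>_def by (intro real_sqrt_le_mono) simp
    also have "\<dots> = \<epsilon> / (4 * (D + 1))" using \<epsilon> D0 by simp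
    finally have "D * sqrt \<delta> \<le> D * (\<epsilon> / (4 * (D + 1)))" using D0 by (intro mult_left_mono) auto
    also have "\<dots> \<le> \<epsilon> / 4" using D0 \<epsilon> by (simp add: field_simps)
    finally show ?thesis .
  qed
  define F where "F = 3 * Sc * wmax / sqrt \<delta>"
  have F0: "0 < F" using Sc_pos wmax_ge \<delta> by (simp add: F_def)
  define s where "s = max 0 (ln (4 * F / \<epsilon>) / gap)"
  have s0: "0 \<le> s" by (simp add: s_def)
  have Fs: "F * exp (- gap * s) \<le> \<epsilon> / 4"
  proof -
    have "ln (4 * F / \<epsilon>) / gap \<le> s" by (simp add: s_def)
    then have "ln (4 * F / \<epsilon>) \<le> gap * s" using gap_pos by (simp add: field_simps)
    then have "exp (- gap * s) \<le> exp (- ln (4 * F / \<epsilon>))" by simp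
    also have "\<dots> = \<epsilon> / (4 * F)" using F0 \<epsilon> by (simp add: exp_minus)
    finally show ?thesis using F0 by (simp add: field_simps)
  qed
  \<comment> \<open>The extra 2 covers the smoothing steps, at most \<open>n\<close>, and rounding
    the start of smoothing up to an integer.\<close>
  have s2: "0 < s + 2" using s0 by simp
  have \<epsilon>4: "0 < \<epsilon> / 4" using \<epsilon> by simp
  have "\<forall>\<^sub>F n in sequentially. \<exists>t. real t \<le> horizon (s + 2) n \<and> d_restr q \<beta> n (start_set n) t \<le> \<epsilon>"
    using eventually_rate_power[OF s0] eventually_imbalance_small
      eventually_exit_small[OF s2 \<epsilon>4] eventually_gibbs_bad_small[OF s2 \<epsilon>4] eventually_large
  proof eventually_elim
    case (elim n)
    note large = elim(5)
    interpret potts_mixing q n \<beta> radius by (rule mixing_locale[OF large])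
    have \<kappa>: "\<kappa> = gap" by (simp add: \<kappa>_def gap_def)
    define t where "t = nat \<lceil>horizon s n\<rceil>"
    define m where "m = nat \<lfloor>\<delta> * n\<rfloor>"
    have hs: "0 \<le> horizon s n" using n gap_pos s0 by (simp add: horizon_def)
    have t: "horizon s n \<le> real t" "real t \<le> horizon s n + 1"
      unfolding t_def using hs by (auto simp: of_nat_nat real_nat_ceiling_ge) 
    have m: "real m \<le> \<delta> * n" "\<delta> * n \<le> real m + 1"
      unfolding m_def using \<delta> floor_correct[of "\<delta> * n"] by (auto simp: of_nat_nat)
    have "\<delta> * n \<le> 1 * real n" using \<delta> by (intro mult_right_mono) auto
    then have mn: "m \<le> n" using m by linarith
    have tm: "real (t + m) \<le> horizon (s + 2) n"
      using t(2) mn n by (simp add: horizon_def algebra_simps)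
    have h0: "horizon 0 n \<le> horizon s n" unfolding horizon_def using s0 by (intro mult_left_mono) auto
    have A: "(P ^^ j) \<phi> \<tau> \<le> Ac / sqrt n" if "\<tau> \<in> configs q n" "t \<le> j" for \<tau> j
    proof -
      have "horizon 0 n \<le> real j" using h0 t(1) that(2) by linarith
      then show ?thesis using elim(2) that(1) by blast
    qed
    have tv: "tv_dist (glauber_law q \<beta> n \<sigma> (t + m)) (potts q \<beta> n) \<le> \<epsilon>" if \<sigma>: "\<sigma> \<in> start_set n" for \<sigma>
    proof -
      have \<sigma>': "\<sigma> \<in> configs q n" "W \<sigma> \<le> radius\<^sup>2 / 8" using \<sigma> large by (auto simp: start_set_def)
      have "tv_dist (glauber_law q \<beta> n \<sigma> (t + m)) (potts q \<beta> n)
          \<le> 8 * C1 * smooth_const * Ac * sqrt (m / n) + n * rate ^ t * smooth_const / sqrt (real m + 1) * (1 + K * (real q + 1))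
            + exit_bound (horizon (s + 2) n) + horizon (s + 2) n * chain.gibbs bad"
        using A tm by (intro tv_upper[OF \<sigma>' mn]) auto
      also have "\<dots> \<le> \<epsilon> / 4 + \<epsilon> / 4 + \<epsilon> / 4 + \<epsilon> / 4"
      proof (intro add_mono)
        have "m / n \<le> \<delta>" using m n by (simp add: field_simps)
        then have "sqrt (m / n) \<le> sqrt \<delta>" by simp
        then have "D * sqrt (m / n) \<le> D * sqrt \<delta>" using D0 by (rule mult_left_mono)
        then show "8 * C1 * smooth_const * Ac * sqrt (m / n) \<le> \<epsilon> / 4"
          using D\<delta> by (simp add: D_def C1c_def Sc_def)
        have r: "rate ^ t \<le> 3 * exp (- gap * s) / sqrt n" using elim(1) t(1) by blast
        have "sqrt (\<delta> * n) \<le> sqrt (real m + 1)" using m by simp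
        then have "1 / sqrt (real m + 1) \<le> 1 / sqrt (\<delta> * n)" using \<delta> n by (intro divide_left_mono) auto
        \<comment> \<open>The three square-root factors meet here: n times n^-1/2 from contraction
          times (\<delta>n)^-1/2 from smoothing is independent of \<open>n\<close>.\<close>
        then have "n * rate ^ t * smooth_const * (1 / sqrt (real m + 1)) * wmax
            \<le> n * (3 * exp (- gap * s) / sqrt n) * smooth_const * (1 / sqrt (\<delta> * n)) * wmax"
          using r rate_nonneg Sc_pos wmax_ge
          by (intro mult_right_mono mult_mono mult_left_mono mult_nonneg_nonneg) (auto simp: Sc_def)
        also have "\<dots> = F * exp (- gap * s)"
        proof -
          have "real n = sqrt n * sqrt n" by simp
          then show ?thesis using n \<delta> by (simp add: F_def Sc_def real_sqrt_mult field_simps)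
        qed
        also note Fs
        finally show "n * rate ^ t * smooth_const / sqrt (real m + 1) * (1 + K * (real q + 1)) \<le> \<epsilon> / 4"
          by (simp add: wmax_def Kc_def)
        show "exit_bound (horizon (s + 2) n) \<le> \<epsilon> / 4" using elim(3) by simp
        show "horizon (s + 2) n * chain.gibbs bad \<le> \<epsilon> / 4" using elim(4) by simp
      qed
      finally show ?thesis by simp
    qed
    have "d_restr q \<beta> n (start_set n) (t + m) \<le> \<epsilon>"
      unfolding d_restr_def using tv finite_start_set start_set_nonempty[OF n] by (subst Max_le_iff) auto
    then show ?case using tm by blast
  qed
  then show ?thesis using s2 by blast
qed

section \<open>Lower bound on the mixing time\<close>

definition C3c where "C3c = potts_mixing.C3 radius"
definition C4c where "C4c = potts_mixing.C4 q \<beta> radius"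
definition C5c where "C5c = potts_mixing.C5 q \<beta>"

lemma eventually_gibbs_energy:
  "\<forall>\<^sub>F n in sequentially. real n * potts_chain.gibbs q n \<beta> (energy q n) \<le> q + (2 * q + 2) / gap + q"
proof -
  have quarter: "0 < (1 / 4 :: real)" by simp
  show ?thesis
    using eventually_gibbs_bad_small[OF zero_less_one quarter] eventually_large eventually_ge_at_top[of 3]
  proof eventually_elim
    case (elim n)
    interpret potts_mixing q n \<beta> radius by (rule mixing_locale) (rule elim)
    have \<kappa>: "\<kappa> = gap" by (simp add: \<kappa>_def gap_def)
    have ln0: "0 \<le> ln (real n)" "0 \<le> n * ln n" using n by auto
    \<comment> \<open>Long enough for the transient exp (- (3/2) \<kappa> T / n) to fall below 1/n,
      yet a bounded multiple of the horizon, so that the bad mass stays negligible.\<close>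
    define T where "T = nat \<lceil>n * ln n / gap\<rceil>"
    have "0 \<le> n * ln n / gap" using ln0 gap_pos by simp
    then have T: "n * ln n / gap \<le> real T" "real T \<le> n * ln n / gap + 1"
      unfolding T_def by (auto simp: of_nat_nat real_nat_ceiling_ge)
    have T2: "real T \<le> 4 * horizon 1 n"
    proof -
      have "4 * horizon 1 n = 2 * (n * ln n / gap) + 4 * n" by (simp add: horizon_def distrib_left)
      moreover have "1 \<le> real n" using n by simp
      ultimately show ?thesis using T(2) \<open>0 \<le> n * ln n / gap\<close> by linarith
    qed
    have "n * chain.gibbs W \<le> n * (q * exp (- (3 / 2) * \<kappa> * T / n) + (2 * q + 2) / (\<kappa> * n) + q * T * chain.gibbs bad)"
      using gibbs_energy_le[of T] by (intro mult_left_mono) auto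
    also have "\<dots> = q * (n * exp (- (3 / 2) * \<kappa> * T / n)) + (2 * q + 2) / gap + q * (n * (T * chain.gibbs bad))"
      unfolding \<kappa> using n gap_pos by (simp add: field_simps)
    also have "\<dots> \<le> real q * 1 + (2 * q + 2) / gap + real q * 1"
    proof (intro add_mono mult_left_mono order_refl)
      have "ln n \<le> gap * T / n" using T(1) gap_pos n by (simp add: field_simps)
      then have "- (3 / 2) * \<kappa> * T / n \<le> - ln n" using ln0 by (simp add: \<kappa>)
      then have "exp (- (3 / 2) * \<kappa> * T / n) \<le> exp (- ln n)" by simp
      also have "\<dots> = 1 / n" using n by (simp add: exp_minus inverse_eq_divide)
      finally have "n * exp (- (3 / 2) * \<kappa> * T / n) \<le> n * (1 / n)" by (intro mult_left_mono) auto
      then show "n * exp (- (3 / 2) * \<kappa> * T / n) \<le> 1" using n by simp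
      have "T * chain.gibbs bad \<le> 4 * horizon 1 n * chain.gibbs bad"
        using T2 gibbs_bad_nonneg by (rule mult_right_mono)
      then have "n * (T * chain.gibbs bad) \<le> n * (4 * horizon 1 n * chain.gibbs bad)" by (intro mult_left_mono) auto
      also have "\<dots> \<le> 1" using elim(1) by simp
      finally show "n * (T * chain.gibbs bad) \<le> 1" .
    qed auto
    finally show ?case by simp
  qed
qed

lemma tilted_config:
  assumes c: "0 < c" "c < 1 / q" and n: "1 / n \<le> c" "1 \<le> n"
  shows "\<exists>\<sigma>\<in>configs q n. energy q n \<sigma> \<le> 4 * (real q)\<^sup>2 * c\<^sup>2 \<and> 2 * c \<le> color_dev q n \<sigma> 1"
proof -
  define m where "m = nat \<lfloor>(1 / q - c) * n\<rfloor>"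
  have q: "1 \<le> q" "1 \<le> real q" using q3 by auto
  have m: "real m \<le> (1 / q - c) * n" "(1 / q - c) * n < real m + 1"
    unfolding m_def using c floor_correct[of "(1 / q - c) * n"] by (auto simp: of_nat_nat)
  have "(1 / q - c) * n \<le> 1 / q * n" using c by (intro mult_right_mono) auto
  then have "real m \<le> 1 / q * n" using m(1) by linarith
  then have "real q * real m \<le> n" using q by (simp add: field_simps)
  then have "q * m \<le> n" by (simp only: of_nat_mult[symmetric] of_nat_le_iff)
  moreover have "(q - 1) * m \<le> q * m" by (intro mult_right_mono) auto
  ultimately have "(q - 1) * m \<le> n" by (rule order_trans[rotated])
  define d where "d = real m / n - 1 / q"
  from block_config[OF q(1) n(2) \<open>(q - 1) * m \<le> n\<close>] obtain \<sigma> where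
    \<sigma>: "\<sigma> \<in> configs q n" "energy q n \<sigma> = real q * (real q - 1) * d\<^sup>2" "color_dev q n \<sigma> 1 = - ((real q - 1) * d)"
    unfolding d_def by blast
  have d: "d \<le> - c" "- (2 * c) \<le> d"
  proof -
    have "real m / n \<le> 1 / q - c" using m(1) n by (simp add: divide_le_eq)
    then show "d \<le> - c" by (simp add: d_def)
    have "1 / q - c \<le> (real m + 1) / n" using m(2) n by (simp add: le_divide_eq)
    then show "- (2 * c) \<le> d" using n by (simp add: d_def add_divide_distrib)
  qed
  have "\<bar>d\<bar> \<le> \<bar>2 * c\<bar>" using d c by simp
  then have "d\<^sup>2 \<le> (2 * c)\<^sup>2" by (simp only: abs_le_square_iff)
  then have "energy q n \<sigma> \<le> real q * real q * (2 * c)\<^sup>2"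
    unfolding \<sigma>(2) using q by (intro mult_mono mult_nonneg_nonneg) auto
  \<comment> \<open>Each of the other colours lacks at least \<open>c\<close>, and q - 1 \<ge> 2 of
    them feed colour 1.\<close>
  moreover have "2 * c \<le> (real q - 1) * (- d)" using d(1) q3 c by (intro mult_mono) auto
  ultimately show ?thesis using \<sigma> by (intro bexI[of _ \<sigma>]) (auto simp: power2_eq_square)
qed

lemma mixing_lower:
  assumes \<epsilon>: "0 < \<epsilon>" "\<epsilon> < 1"
  shows "\<exists>s>0. \<forall>\<^sub>F n in sequentially. \<forall>t. real t \<le> horizon (- s) n \<longrightarrow> \<epsilon> < d_restr q \<beta> n (start_set n) t"
proof -
  define C6 where "C6 = q + (2 * q + 2) / gap + q"
  have C3: "0 < C3c" using radius_pos
  proof -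
    obtain n where "4 * real q \<le> radius * real n" using eventually_large by (auto simp: eventually_sequentially)
    then interpret potts_mixing q n \<beta> radius by (rule mixing_locale)
    show ?thesis using radius_pos by (simp add: C3c_def C3_def add_pos_pos)
  qed
  \<comment> \<open>In order: the quadratic loss is at most half of the initial deviation 2c; the
    start lies in the energy ball; all colours keep a positive share.\<close>
  define c where "c = min (gap / (8 * C3c * (real q)\<^sup>2)) (min (radius / (6 * q)) (1 / (2 * q)))"
  have c: "0 < c" "c < 1 / q" "c \<le> gap / (8 * C3c * (real q)\<^sup>2)" "c \<le> radius / (6 * q)"
  proof -
    show "0 < c" using gap_pos C3 radius_pos q3 by (simp add: c_def)
    have "c \<le> 1 / (2 * q)" by (simp add: c_def)
    also have "\<dots> < 1 / q" using q3 by (simp add: field_simps)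
    finally show "c < 1 / q" .
  qed (auto simp: c_def)
  have C5: "0 \<le> C5c"
  proof -
    obtain n where "4 * real q \<le> radius * real n" using eventually_large by (auto simp: eventually_sequentially)
    then interpret potts_mixing q n \<beta> radius by (rule mixing_locale)
    show ?thesis using \<kappa>_pos by (simp add: C5c_def C5_def)
  qed
  have C6: "0 \<le> C6" using gap_pos by (simp add: C6_def)
  \<comment> \<open>The signal-to-noise ratio that pushes both Chebyshev terms below (1 -
    \<epsilon>)/2; the added 1 keeps it positive.\<close>
  define g0 where "g0 = sqrt (8 * (C5c + C6) / (1 - \<epsilon>)) + 1"
  have g0: "0 < g0" "4 / g0\<^sup>2 * (C5c + C6) \<le> (1 - \<epsilon>) / 2"
  proof -
    define X where "X = 8 * (C5c + C6) / (1 - \<epsilon>)"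
    have X: "0 \<le> X" using C5 C6 \<epsilon> by (simp add: X_def)
    have g: "g0 = sqrt X + 1" by (simp add: g0_def X_def)
    show "0 < g0" unfolding g using X by (simp add: add_nonneg_pos)
    have "X \<le> g0\<^sup>2" unfolding g using X by (simp add: power2_sum)
    then have "4 * (C5c + C6) \<le> (1 - \<epsilon>) / 2 * g0\<^sup>2" using \<epsilon> by (simp add: X_def field_simps)
    then show "4 / g0\<^sup>2 * (C5c + C6) \<le> (1 - \<epsilon>) / 2" using \<open>0 < g0\<close> by (simp add: field_simps)
  qed
  \<comment> \<open>The amplification that an initial deviation \<open>c\<close> needs in order to
    reach \<open>g0\<close> after paying the drift error \<open>C4c\<close> / gap.\<close>
  define Y where "Y = (g0 + \<bar>C4c\<bar> / gap) / c"
  have Y: "0 < Y" using g0 gap_pos c by (simp add: Y_def add_pos_nonneg)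
  define s where "s = (\<bar>ln Y\<bar> + 2) / gap"
  have s0: "0 < s" using gap_pos by (simp add: s_def)
  have Ys: "g0 \<le> c * exp (gap * s - 1) - C4c / gap"
  proof -
    have "Y = exp (ln Y)" using Y by simp
    also have "\<dots> \<le> exp (gap * s - 1)" using gap_pos by (simp add: s_def)
    finally have "c * Y \<le> c * exp (gap * s - 1)" using c by (intro mult_left_mono) auto
    moreover have "c * Y = g0 + \<bar>C4c\<bar> / gap" using c by (simp add: Y_def)
    moreover have "C4c / gap \<le> \<bar>C4c\<bar> / gap" using gap_pos by (intro divide_right_mono) auto
    ultimately show ?thesis by linarith
  qed
  have "(\<lambda>n::nat. gap * ln (real n) / real n) \<longlonglongrightarrow> 0" using gap_pos by real_asymp
  then have e1: "\<forall>\<^sub>F n in sequentially. gap * ln (real n) / real n < 1" by (rule order_tendstoD) simp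
  have "(\<lambda>n::nat. Ec / sqrt (real n)) \<longlonglongrightarrow> 0" by real_asymp
  then have e2: "\<forall>\<^sub>F n in sequentially. Ec / sqrt (real n) < gap / 2" by (rule order_tendstoD) (use gap_pos in simp)
  have "(\<lambda>n::nat. 1 / real n) \<longlonglongrightarrow> 0" by real_asymp
  then have e3: "\<forall>\<^sub>F n in sequentially. 1 / real n < c" by (rule order_tendstoD) (rule c)
  have \<epsilon>4: "0 < (1 - \<epsilon>) / 4" using \<epsilon> by simp
  have "\<forall>\<^sub>F n in sequentially. \<forall>t. real t \<le> horizon (- s) n \<longrightarrow> \<epsilon> < d_restr q \<beta> n (start_set n) t"
    using e1 e2 e3 eventually_exit_small[OF zero_less_one \<epsilon>4] eventually_gibbs_energy eventually_large
      eventually_ge_at_top[of 2]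
  proof eventually_elim
    case (elim n)
    note large = elim(6)
    interpret potts_mixing q n \<beta> radius by (rule mixing_locale[OF large])
    have \<kappa>: "\<kappa> = gap" by (simp add: \<kappa>_def gap_def)
    obtain \<sigma> where \<sigma>: "\<sigma> \<in> configs q n" and W\<sigma>: "W \<sigma> \<le> 4 * (real q)\<^sup>2 * c\<^sup>2" and z\<sigma>: "2 * c \<le> z \<sigma> 1"
      using tilted_config[OF c(1,2), of n] elim(3) n by auto
    have W8: "W \<sigma> \<le> radius\<^sup>2 / 8"
    proof -
      have "c\<^sup>2 \<le> (radius / (6 * q))\<^sup>2" using c by (intro power_mono) auto
      then have "4 * (real q)\<^sup>2 * c\<^sup>2 \<le> 4 * (real q)\<^sup>2 * (radius / (6 * q))\<^sup>2" by (intro mult_left_mono) auto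
      also have "\<dots> = radius\<^sup>2 / 9" using q3 by (simp add: power2_eq_square)
      also have "\<dots> \<le> radius\<^sup>2 / 8" by simp
      finally show ?thesis using W\<sigma> by simp
    qed
    have start: "\<sigma> \<in> start_set n" using \<sigma> W8 by (simp add: start_set_def)
    have h: "c \<le> z \<sigma> 1 - 2 * C3 / \<kappa> * W \<sigma>"
    proof -
      have "2 * C3 / \<kappa> * W \<sigma> \<le> 2 * C3 / \<kappa> * (4 * (real q)\<^sup>2 * c\<^sup>2)"
        using W\<sigma> C3_nonneg \<kappa>_pos by (intro mult_left_mono) auto
      also have "\<dots> = (8 * C3c * (real q)\<^sup>2 / gap * c) * c" by (simp add: C3c_def \<kappa> power2_eq_square)
      also have "\<dots> \<le> 1 * c"
      proof (rule mult_right_mono)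
        show "8 * C3c * (real q)\<^sup>2 / gap * c \<le> 1"
          using c(3) C3 gap_pos q3 by (simp add: field_simps)
      qed (use c in simp)
      finally show ?thesis using z\<sigma> by simp
    qed
    have rate: "rate \<le> 1 - \<kappa> / (2 * n)"
    proof -
      have "Ec / (n * sqrt n) = (Ec / sqrt n) / n" by simp
      also have "\<dots> \<le> (gap / 2) / n" using elim(2) by (intro divide_right_mono) auto
      finally have "E / (n * sqrt n) \<le> \<kappa> / (2 * n)" by (simp add: Ec_def \<kappa>)
      moreover have "\<kappa> / n = \<kappa> / (2 * n) + \<kappa> / (2 * n)" by simp
      ultimately show ?thesis unfolding rate_def by linarith
    qed
    show ?case
    proof (intro allI impI)
      fix t assume t: "real t \<le> horizon (- s) n"
      define x where "x = gap / n"
      have x: "0 \<le> x" "x \<le> 1 / 2"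
        using gap_pos gap_le elim(7) by (auto simp: x_def field_simps)
      have t1: "real t \<le> n * ln n / (2 * gap) - s * n" using t by (simp add: horizon_def algebra_simps)
      have pow: "exp (gap * s - 1) / sqrt n \<le> (1 - x) ^ t"
      proof -
        have tx: "real t * x \<le> ln n / 2 - gap * s"
        proof -
          have "real t * x \<le> (n * ln n / (2 * gap) - s * n) * x" using t1 x by (intro mult_right_mono) auto
          also have "\<dots> = ln n / 2 - gap * s" using n gap_pos by (simp add: x_def field_simps)
          finally show ?thesis .
        qed
        \<comment> \<open>The quadratic error in ln (1 - x) \<ge> - x - 2 x^2 adds up to at most 1
          over \<open>t\<close> steps, which is the 1 subtracted in exp (gap s - 1).\<close>
        have "real t * (2 * x\<^sup>2) \<le> 1"
        proof -
          have "real t * x \<le> ln n / 2" using tx gap_pos s0 mult_pos_pos[OF gap_pos s0] by linarith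
          then have "(real t * x) * (2 * x) \<le> (ln n / 2) * (2 * x)" using x by (intro mult_right_mono) auto
          also have "\<dots> = gap * ln n / n" by (simp add: x_def)
          finally show ?thesis using elim(1) by (simp add: power2_eq_square mult_ac)
        qed
        then have "gap * s - 1 - ln n / 2 \<le> real t * (- x - 2 * x\<^sup>2)" using tx by (simp add: algebra_simps)
        also have "\<dots> \<le> real t * ln (1 - x)"
          using ln_one_minus_pos_lower_bound[OF x] by (intro mult_left_mono) auto
        finally have "exp (gap * s - 1 - ln n / 2) \<le> exp (real t * ln (1 - x))" by simp
        also have "\<dots> = (1 - x) ^ t" using x by (simp add: exp_of_nat_mult)
        finally have "exp (gap * s - 1 - ln n / 2) \<le> (1 - x) ^ t" .
        moreover have "exp (ln n / 2) = sqrt n"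
          using n by (simp add: powr_half_sqrt[symmetric] powr_def)
        ultimately show ?thesis by (simp add: exp_diff)
      qed
      define M where "M = g0 / sqrt n"
      have M0: "0 < M" using g0 n by (simp add: M_def)
      have sq: "0 < sqrt n" using n by simp
      have "M \<le> (c * exp (gap * s - 1) - C4c / gap) / sqrt n"
        unfolding M_def using Ys by (intro divide_right_mono) auto
      also have "\<dots> = exp (gap * s - 1) / sqrt n * c - C4c / gap / sqrt n" by (simp add: diff_divide_distrib)
      also have "\<dots> \<le> (1 - x) ^ t * (z \<sigma> 1 - 2 * C3 / \<kappa> * W \<sigma>) - C4c / gap / n"
      proof (rule diff_mono)
        show "exp (gap * s - 1) / sqrt n * c \<le> (1 - x) ^ t * (z \<sigma> 1 - 2 * C3 / \<kappa> * W \<sigma>)"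
          using pow h c(1) x by (intro mult_mono) auto
        have "0 \<le> C4c" using C3_nonneg \<kappa>_pos by (simp add: C4c_def C4_def)
        moreover have "sqrt n \<le> n"
        proof -
          have "sqrt n * 1 \<le> sqrt n * sqrt n" using n by (intro mult_left_mono) auto
          then show ?thesis by simp
        qed
        ultimately show "C4c / gap / n \<le> C4c / gap / sqrt n"
          using sq gap_pos n by (intro divide_left_mono) auto
      qed
      also have "\<dots> \<le> (P ^^ t) (\<lambda>\<tau>. z \<tau> 1) \<sigma>"
        using iter_dev_ge[OF \<sigma>, of t] by (simp add: x_def \<kappa> C4c_def)
      finally have M: "M \<le> (P ^^ t) (\<lambda>\<tau>. z \<tau> 1) \<sigma>" .
      \<comment> \<open>The exit estimate is available for positive offsets, so the time is enlarged
        before it is applied.\<close>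
      have tT: "real t \<le> horizon 1 n"
      proof -
        have "horizon (- s) n \<le> horizon 1 n"
          unfolding horizon_def using s0 by (intro mult_left_mono) auto
        then show ?thesis using t by simp
      qed
      have "4 / M\<^sup>2 * (C5 / n + chain.gibbs W) \<le> (1 - \<epsilon>) / 2"
      proof -
        have "chain.gibbs W * n \<le> C6" using elim(5) unfolding C6_def by (simp only: mult.commute)
        then have "chain.gibbs W \<le> C6 / n" using n by (simp add: pos_le_divide_eq)
        then have "C5 / n + chain.gibbs W \<le> (C5c + C6) / n"
          unfolding C5c_def add_divide_distrib by (rule add_left_mono)
        then have "4 / M\<^sup>2 * (C5 / n + chain.gibbs W) \<le> 4 / M\<^sup>2 * ((C5c + C6) / n)" by (intro mult_left_mono) auto
        also have "\<dots> = 4 / g0\<^sup>2 * (C5c + C6)" using n g0 by (simp add: M_def power_divide)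
        also note g0(2)
        finally show ?thesis .
      qed
      moreover have "exit_bound (horizon 1 n) < (1 - \<epsilon>) / 4" using elim(4) .
      moreover have "1 - 4 / M\<^sup>2 * (C5 / n + chain.gibbs W) - exit_bound (horizon 1 n)
          \<le> tv_dist (glauber_law q \<beta> n \<sigma> t) (potts q \<beta> n)"
        by (rule tv_lower[OF \<sigma> W8 rate M0 M tT])
      moreover have "\<epsilon> < v" if "a \<le> (1 - \<epsilon>) / 2" "e < (1 - \<epsilon>) / 4" "1 - a - e \<le> v" for a e v :: real
        using that \<epsilon> by (simp add: field_simps)
      ultimately have "\<epsilon> < tv_dist (glauber_law q \<beta> n \<sigma> t) (potts q \<beta> n)" by blast
      also have "\<dots> \<le> d_restr q \<beta> n (start_set n) t"
        unfolding d_restr_def using finite_start_set start by (intro Max_ge) auto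
      finally show "\<epsilon> < d_restr q \<beta> n (start_set n) t" .
    qed
  qed
  then show ?thesis using s0 by blast
qed

text \<open>The infimum is bracketed by one time at which the chain is mixed and by failure at every
  time up to the lower horizon. The first also shows that the set of mixed times is nonempty, so the
  infimum belongs to it.\<close>

lemma t_mix_bounds:
  assumes \<epsilon>: "0 < \<epsilon>" "\<epsilon> < 1"
  shows "\<exists>s>0. \<forall>\<^sub>F n in sequentially.
    \<bar>real (t_mix q \<beta> n (start_set n) \<epsilon>) - potts_alpha1 \<beta> q * real n * ln (real n)\<bar> \<le> s * real n"
proof -
  obtain s1 where s1: "0 < s1" "\<forall>\<^sub>F n in sequentially. \<exists>t. real t \<le> horizon s1 n \<and> d_restr q \<beta> n (start_set n) t \<le> \<epsilon>"
    using mixing_upper[OF \<epsilon>] by blast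
  obtain s2 where s2: "0 < s2" "\<forall>\<^sub>F n in sequentially. \<forall>t. real t \<le> horizon (- s2) n \<longrightarrow> \<epsilon> < d_restr q \<beta> n (start_set n) t"
    using mixing_lower[OF \<epsilon>] by blast
  from s1(2) s2(2) have "\<forall>\<^sub>F n in sequentially.
    \<bar>real (t_mix q \<beta> n (start_set n) \<epsilon>) - potts_alpha1 \<beta> q * real n * ln (real n)\<bar> \<le> max s1 s2 * real n"
  proof eventually_elim
    case (elim n)
    define X where "X = {t. d_restr q \<beta> n (start_set n) t \<le> \<epsilon>}"
    obtain t where t: "real t \<le> horizon s1 n" "t \<in> X" using elim(1) by (auto simp: X_def)
    have "t_mix q \<beta> n (start_set n) \<epsilon> \<in> X"
      unfolding t_mix_def X_def[symmetric] using t(2) by (intro Inf_nat_def1) auto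
    then have "\<not> real (t_mix q \<beta> n (start_set n) \<epsilon>) \<le> horizon (- s2) n"
      using elim(2) by (auto simp: X_def)
    moreover have "t_mix q \<beta> n (start_set n) \<epsilon> \<le> t"
      unfolding t_mix_def X_def[symmetric] using t(2) by (intro cInf_lower) auto
    then have "real (t_mix q \<beta> n (start_set n) \<epsilon>) \<le> horizon s1 n" using t(1) by linarith
    moreover have "s1 * n \<le> max s1 s2 * n" "s2 * n \<le> max s1 s2 * n" by (intro mult_right_mono; simp)+
    then have "horizon s1 n \<le> potts_alpha1 \<beta> q * real n * ln (real n) + max s1 s2 * n"
      "potts_alpha1 \<beta> q * real n * ln (real n) - max s1 s2 * n \<le> horizon (- s2) n"
      by (simp_all add: horizon_def alpha1_gap algebra_simps)
    ultimately show ?case by linarith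
  qed
  then show ?thesis using s1(1) by (intro exI[of _ "max s1 s2"]) auto
qed

lemma t_mix_asymptotics:
  assumes "\<epsilon> \<in> {0<..<1}"
  shows "(\<lambda>n. real (t_mix q \<beta> n (start_set n) \<epsilon>) - potts_alpha1 \<beta> q * real n * ln (real n)) \<in> O(\<lambda>n. real n)"
proof -
  obtain s where "\<forall>\<^sub>F n in sequentially.
    \<bar>real (t_mix q \<beta> n (start_set n) \<epsilon>) - potts_alpha1 \<beta> q * real n * ln (real n)\<bar> \<le> s * real n"
    using t_mix_bounds[of \<epsilon>] assms by auto
  then show ?thesis by (intro bigoI[where c = s]) simp
qed

lemma mix_window_asymptotics:
  assumes "\<epsilon> \<in> {0<..<1}"
  shows "(\<lambda>n. mix_window q \<beta> n (start_set n) \<epsilon>) \<in> O(\<lambda>n. real n)"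
proof -
  have "1 - \<epsilon> \<in> {0<..<1}" using assms by auto
  from sum_in_bigo(2)[OF t_mix_asymptotics[OF assms] t_mix_asymptotics[OF this]]
  show ?thesis by (simp add: mix_window_def)
qed

lemma cutoff: "has_cutoff q \<beta> start_set"
  unfolding has_cutoff_def
proof
  fix \<epsilon> :: real assume \<epsilon>: "\<epsilon> \<in> {0<..<1}"
  obtain s where s: "\<forall>\<^sub>F n in sequentially.
    \<bar>real (t_mix q \<beta> n (start_set n) (1 / 4)) - potts_alpha1 \<beta> q * real n * ln (real n)\<bar> \<le> s * real n"
    using t_mix_bounds[of "1 / 4"] by auto
  have "(\<lambda>n. real n) \<in> o(\<lambda>n. real (t_mix q \<beta> n (start_set n) (1 / 4)))"
  proof (rule landau_o.smallI)
    fix c :: real assume c: "0 < c"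
    have "\<forall>\<^sub>F n::nat in sequentially. 1 \<le> c * (1 / (2 * gap) * ln (real n) - s)"
      using gap_pos c by real_asymp
    with s show "\<forall>\<^sub>F n in sequentially. norm (real n) \<le> c * norm (real (t_mix q \<beta> n (start_set n) (1 / 4)))"
    proof eventually_elim
      case (elim n)
      have "real n * 1 \<le> real n * (c * (1 / (2 * gap) * ln (real n) - s))"
        using elim(2) by (intro mult_left_mono) auto
      also have "\<dots> = c * (potts_alpha1 \<beta> q * real n * ln (real n) - s * real n)"
        by (simp add: alpha1_gap algebra_simps)
      also have "\<dots> \<le> c * real (t_mix q \<beta> n (start_set n) (1 / 4))"
        using elim(1) c by (intro mult_left_mono) (auto simp: abs_le_iff)
      finally show ?case by simp
    qed
  qed
  with mix_window_asymptotics[OF \<epsilon>]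
  show "(\<lambda>n. mix_window q \<beta> n (start_set n) \<epsilon>) \<in> o(\<lambda>n. real (t_mix q \<beta> n (start_set n) (1 / 4)))"
    by (rule landau_o.big_small_trans)
qed

end

theorem theorem4:
  fixes q :: nat and \<beta> :: real
  assumes "3 \<le> q" and "0 \<le> \<beta>" and "\<beta> < potts_beta_c q"
  shows "\<exists>C\<^sub>1>0. \<exists>C\<^sub>2>0. \<exists>S :: nat \<Rightarrow> (nat \<Rightarrow> nat) set.
    (\<forall>n\<ge>1. S n \<subseteq> configs q n \<and> S n \<noteq> {} \<and>
       measure_pmf.prob (potts q \<beta> n) (configs q n - S n) \<le> C\<^sub>1 * exp (- C\<^sub>2 * real n)) \<and>
    has_cutoff q \<beta> S \<and>
    (\<forall>\<epsilon>\<in>{0<..<1}.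
       (\<lambda>n. real (t_mix q \<beta> n (S n) \<epsilon>) - potts_alpha1 \<beta> q * real n * ln (real n)) \<in> O(\<lambda>n. real n)) \<and>
    (\<forall>\<epsilon>\<in>{0<..<1}. (\<lambda>n. mix_window q \<beta> n (S n) \<epsilon>) \<in> O(\<lambda>n. real n))"
proof -
  interpret potts_subcritical q \<beta> using assms by unfold_locales
  obtain C1 C2 where "0 < C1" "0 < C2"
    "\<forall>n\<ge>1. measure_pmf.prob (potts q \<beta> n) (configs q n - start_set n) \<le> C1 * exp (- C2 * real n)"
    using start_set_complement by blast
  then show ?thesis
    using start_set_subset start_set_nonempty cutoff t_mix_asymptotics mix_window_asymptotics
    by (intro exI[of _ C1] exI[of _ C2] exI[of _ start_set] conjI allI impI ballI) auto
qed

end
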